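(* For any $k \geq 1$ and any $g \geq k+2$, the abelian group $D_{2k}(H)/\operatorname{Im}(\tau_{2k})$ has non-trivial $2$-torsion.
   Context: Let $\Sigma_{g,1}$ be a compact connected oriented surface of genus $g$ with one boundary component, $\pi=\pi_1(\Sigma_{g,1},\star)$ with $\star\in\partial\Sigma_{g,1}$ (a free group of rank $n=2g$), $\zeta\in\pi$ the class of the oriented boundary component, and $H=\pi/\Gamma_2\pi=H_1(\Sigma_{g,1};\mathbb Z)$, where $(\Gamma_k\pi)_{k\ge1}$ is the lower central series. Write $\{x\}\in H$ for the class of $x\in\pi$. A basis $\alpha_1,\beta_1,\dots,\alpha_g,\beta_g$ of $\pi$ is fixed with $\zeta^{-1}=\prod_{i=1}^g[\beta_i^{-1},\alpha_i]$, where $[x,y]=xyx^{-1}y^{-1}$; $a_i,b_i$ are the classes of $\alpha_i,\beta_i$ in $H$. Let $\mathcal L(H)=\bigoplus_{k\ge1}\mathcal L_k(H)$ be the free Lie ring on $H$ (in degree 1), identified with $\bigoplus_k \Gamma_k\pi/\Gamma_{k+1}\pi$, and let $\omega=\sum_{i=1}^g[a_i,b_i]\in\mathcal L_2(H)$, the class of $\zeta^{-1}$. The mapping class group $\mathcal M$ of $\Sigma_{g,1}$ (rel boundary) is identified (Dehn–Nielsen–Baer) with $\{f\in\operatorname{Aut}(\pi): f(\zeta)=\zeta\}$. $A_k$ is the subgroup of $\operatorname{Aut}(\pi)$ acting trivially on $\pi/\Gamma_{k+1}\pi$, and $J_k=\mathcal M\cap A_k$ (Johnson filtration). $\operatorname{Der}_k(H)\cong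 \operatorname{Hom}(H,\mathcal L_{k+1}(H))=H^*\otimes\mathcal L_{k+1}(H)$ is the group of derivations of $\mathcal L(H)$ raising degree by $k$, and $D_k(H)=\{d\in\operatorname{Der}_k(H): d(\omega)=0\}$ is the group of symplectic derivations. The $k$-th Johnson homomorphism is $\tau_k:J_k\to D_k(H)$, $\tau_k(f)(\{x\})=[f(x)x^{-1}]\in\Gamma_{k+1}\pi/\Gamma_{k+2}\pi\cong\mathcal L_{k+1}(H)$. *)

theory Defs
  imports "HOL-Algebra.FiniteProduct" "HOL-Algebra.Bij" "HOL-Algebra.Generated_Groups" "HOL-Algebra.Product_Groups"
begin

section \<open>Free groups\<close>

text \<open>A letter \<open>(a, False)\<close> stands for the generator \<open>a\<close>, and \<open>(a, True)\<close> for its inverse. The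
  free group on \<open>S\<close> is realised on reduced words.\<close>

type_synonym 'a letter = "'a \<times> bool"

definition letter_inv :: "'a letter \<Rightarrow> 'a letter" where
  "letter_inv x = (fst x, \<not> snd x)"

fun reduced :: "'a letter list \<Rightarrow> bool" where
  "reduced (x # y # ys) \<longleftrightarrow> y \<noteq> letter_inv x \<and> reduced (y # ys)"
| "reduced _ \<longleftrightarrow> True"

fun push_letter :: "'a letter \<Rightarrow> 'a letter list \<Rightarrow> 'a letter list" where
  "push_letter x [] = [x]"
| "push_letter x (y # ys) = (if y = letter_inv x then ys else x # y # ys)"

definition free_group :: "'a set \<Rightarrow> 'a letter list monoid" where
  "free_group S =
     \<lparr>carrier = {w. fst ` set w \<subseteq> S \<and> reduced w},
      mult = (\<lambda>u v. foldr push_letter u v),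
      one = []\<rparr>"

lemma letter_inv_inv [simp]: "letter_inv (letter_inv x) = x"
  by (simp add: letter_inv_def)

lemma fst_letter_inv [simp]: "fst (letter_inv x) = fst x"
  by (simp add: letter_inv_def)

lemma reduced_tl: "reduced (x # w) \<Longrightarrow> reduced w"
  by (cases w) auto

lemma reduced_push: "reduced w \<Longrightarrow> reduced (push_letter x w)"
  by (cases w) (auto dest: reduced_tl)

lemma reduced_foldr_push: "reduced v \<Longrightarrow> reduced (foldr push_letter u v)"
  by (induction u) (auto intro: reduced_push)

lemma set_push: "set (push_letter x w) \<subseteq> insert x (set w)"
  by (cases w) auto

lemma set_foldr_push: "set (foldr push_letter u v) \<subseteq> set u \<union> set v"
  by (induction u) (use set_push in fastforce)+

lemma push_push_inv: "reduced w \<Longrightarrow> push_letter (letter_inv x) (push_letter x w) = w"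
  by (cases w rule: reduced.cases) auto

lemma foldr_push_push:
  "reduced w \<Longrightarrow> foldr push_letter (push_letter x u) w = push_letter x (foldr push_letter u w)"
proof (cases u)
  case (Cons y ys)
  assume "reduced w"
  then show ?thesis
    using Cons push_push_inv[of "foldr push_letter ys w" "letter_inv x"]
    by (auto simp: reduced_foldr_push)
qed simp

lemma foldr_push_assoc:
  "reduced w \<Longrightarrow>
     foldr push_letter (foldr push_letter u v) w = foldr push_letter u (foldr push_letter v w)"
  by (induction u) (auto simp: foldr_push_push)

lemma foldr_push_reduced: "reduced u \<Longrightarrow> foldr push_letter u [] = u"
proof (induction u)
  case (Cons x u)
  then show ?case by (cases u) auto
qed simp

lemma foldr_push_inv:
  "reduced w \<Longrightarrow> foldr push_letter (rev (map letter_inv u)) (foldr push_letter u w) = w"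
  by (induction u) (auto simp: push_push_inv reduced_foldr_push)

lemma group_free_group: "group (free_group S)"
proof (rule groupI)
  fix u assume u: "u \<in> carrier (free_group S)"
  define v where "v = foldr push_letter (rev (map letter_inv u)) []"
  have "set v \<subseteq> letter_inv ` set u"
    using set_foldr_push[of "rev (map letter_inv u)" "[]"] by (simp add: v_def)
  then have "fst ` set v \<subseteq> fst ` letter_inv ` set u"
    by (rule image_mono)
  also have "\<dots> = fst ` set u"
    by (simp add: image_image)
  finally have "fst ` set v \<subseteq> S"
    using u by (auto simp: free_group_def)
  moreover have "reduced v"
    by (simp add: v_def reduced_foldr_push)
  moreover have "foldr push_letter v u = []"
    using u foldr_push_inv[of "[]" u]
    by (simp add: v_def foldr_push_assoc free_group_def foldr_push_reduced)
  ultimately show "\<exists>v\<in>carrier (free_group S). v \<otimes>\<^bsub>free_group S\<^esub> u = \<one>\<^bsub>free_group S\<^esub>"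
    by (auto simp: free_group_def)
next
  fix u v assume "u \<in> carrier (free_group S)" "v \<in> carrier (free_group S)"
  then show "u \<otimes>\<^bsub>free_group S\<^esub> v \<in> carrier (free_group S)"
    using set_foldr_push[of u v] by (fastforce simp: free_group_def reduced_foldr_push)
qed (auto simp: free_group_def foldr_push_assoc)


section \<open>Lie rings and the free Lie ring on an abelian group\<close>

text \<open>As with free abelian groups in \<open>HOL-Algebra\<close>, the additive group of a Lie ring is written as a
  \<open>monoid\<close> record: \<open>\<otimes>\<close> is the addition, \<open>\<one>\<close> is zero.\<close>

record 'a lie_ring = "'a monoid" +
  bracket :: "'a \<Rightarrow> 'a \<Rightarrow> 'a"

datatype 'a lie_term =
    LGen 'a
  | LZero
  | LNeg "'a lie_term"
  | LAdd "'a lie_term" "'a lie_term"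
  | LBr "'a lie_term" "'a lie_term"

definition lie_terms :: "('a, 'm) monoid_scheme \<Rightarrow> 'a lie_term set" where
  "lie_terms A = {t. set_lie_term t \<subseteq> carrier A}"

text \<open>The least congruence on Lie terms over \<open>A\<close> which enforces the axioms of a Lie ring and the
  additivity of \<open>LGen\<close>.\<close>

inductive lie_eq :: "('a, 'm) monoid_scheme \<Rightarrow> 'a lie_term \<Rightarrow> 'a lie_term \<Rightarrow> bool"
  for A :: "('a, 'm) monoid_scheme" where
  refl: "t \<in> lie_terms A \<Longrightarrow> lie_eq A t t"
| sym: "lie_eq A s t \<Longrightarrow> lie_eq A t s"
| trans: "lie_eq A s t \<Longrightarrow> lie_eq A t u \<Longrightarrow> lie_eq A s u"
| cong_neg: "lie_eq A s t \<Longrightarrow> lie_eq A (LNeg s) (LNeg t)"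
| cong_add: "lie_eq A s t \<Longrightarrow> lie_eq A s' t' \<Longrightarrow> lie_eq A (LAdd s s') (LAdd t t')"
| cong_br: "lie_eq A s t \<Longrightarrow> lie_eq A s' t' \<Longrightarrow> lie_eq A (LBr s s') (LBr t t')"
| gen: "x \<in> carrier A \<Longrightarrow> y \<in> carrier A \<Longrightarrow>
    lie_eq A (LGen (x \<otimes>\<^bsub>A\<^esub> y)) (LAdd (LGen x) (LGen y))"
| add_assoc: "s \<in> lie_terms A \<Longrightarrow> t \<in> lie_terms A \<Longrightarrow> u \<in> lie_terms A \<Longrightarrow>
    lie_eq A (LAdd (LAdd s t) u) (LAdd s (LAdd t u))"
| add_comm: "s \<in> lie_terms A \<Longrightarrow> t \<in> lie_terms A \<Longrightarrow> lie_eq A (LAdd s t) (LAdd t s)"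
| add_zero: "t \<in> lie_terms A \<Longrightarrow> lie_eq A (LAdd LZero t) t"
| add_neg: "t \<in> lie_terms A \<Longrightarrow> lie_eq A (LAdd (LNeg t) t) LZero"
| br_add_left: "s \<in> lie_terms A \<Longrightarrow> t \<in> lie_terms A \<Longrightarrow> u \<in> lie_terms A \<Longrightarrow>
    lie_eq A (LBr (LAdd s t) u) (LAdd (LBr s u) (LBr t u))"
| br_add_right: "s \<in> lie_terms A \<Longrightarrow> t \<in> lie_terms A \<Longrightarrow> u \<in> lie_terms A \<Longrightarrow>
    lie_eq A (LBr s (LAdd t u)) (LAdd (LBr s t) (LBr s u))"
| br_alt: "t \<in> lie_terms A \<Longrightarrow> lie_eq A (LBr t t) LZero"
| jacobi: "s \<in> lie_terms A \<Longrightarrow> t \<in> lie_terms A \<Longrightarrow> u \<in> lie_terms A \<Longrightarrow>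
    lie_eq A (LAdd (LBr s (LBr t u)) (LAdd (LBr t (LBr u s)) (LBr u (LBr s t)))) LZero"

definition lie_rel :: "('a, 'm) monoid_scheme \<Rightarrow> ('a lie_term \<times> 'a lie_term) set" where
  "lie_rel A = {(s, t). lie_eq A s t}"

lemma lie_eq_in_terms: "lie_eq A s t \<Longrightarrow> monoid A \<Longrightarrow> s \<in> lie_terms A \<and> t \<in> lie_terms A"
  by (induction rule: lie_eq.induct) (auto simp: lie_terms_def monoid.m_closed)

lemma equiv_lie_rel: "monoid A \<Longrightarrow> equiv (lie_terms A) (lie_rel A)"
  by (auto intro!: equivI refl_onI symI transI simp: lie_rel_def
      intro: lie_eq.intros dest: lie_eq_in_terms)

definition free_lie :: "('a, 'm) monoid_scheme \<Rightarrow> 'a lie_term set lie_ring" where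
  "free_lie A =
     \<lparr>carrier = lie_terms A // lie_rel A,
      mult = (\<lambda>X Y. \<Union>s\<in>X. \<Union>t\<in>Y. lie_rel A `` {LAdd s t}),
      one = lie_rel A `` {LZero},
      bracket = (\<lambda>X Y. \<Union>s\<in>X. \<Union>t\<in>Y. lie_rel A `` {LBr s t})\<rparr>"

definition free_lie_gen :: "('a, 'm) monoid_scheme \<Rightarrow> 'a \<Rightarrow> 'a lie_term set" where
  "free_lie_gen A x = lie_rel A `` {LGen x}"

inductive homogeneous :: "nat \<Rightarrow> 'a lie_term \<Rightarrow> bool" where
  "homogeneous 1 (LGen x)"
| "homogeneous k LZero"
| "homogeneous k t \<Longrightarrow> homogeneous k (LNeg t)"
| "homogeneous k s \<Longrightarrow> homogeneous k t \<Longrightarrow> homogeneous k (LAdd s t)"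
| "homogeneous i s \<Longrightarrow> homogeneous j t \<Longrightarrow> homogeneous (i + j) (LBr s t)"

definition free_lie_degree :: "('a, 'm) monoid_scheme \<Rightarrow> nat \<Rightarrow> 'a lie_term set set" where
  "free_lie_degree A k = {lie_rel A `` {t} | t. t \<in> lie_terms A \<and> homogeneous k t}"

text \<open>The extension of an additive map \<open>\<phi>\<close> from \<open>A\<close> to a Lie ring \<open>R\<close> to a morphism of Lie rings
  from \<open>free_lie A\<close> to \<open>R\<close>.\<close>

primrec lie_eval :: "('b, 'n) lie_ring_scheme \<Rightarrow> ('a \<Rightarrow> 'b) \<Rightarrow> 'a lie_term \<Rightarrow> 'b" where
  "lie_eval R \<phi> (LGen x) = \<phi> x"
| "lie_eval R \<phi> LZero = \<one>\<^bsub>R\<^esub>"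
| "lie_eval R \<phi> (LNeg t) = inv\<^bsub>R\<^esub> (lie_eval R \<phi> t)"
| "lie_eval R \<phi> (LAdd s t) = lie_eval R \<phi> s \<otimes>\<^bsub>R\<^esub> lie_eval R \<phi> t"
| "lie_eval R \<phi> (LBr s t) = bracket R (lie_eval R \<phi> s) (lie_eval R \<phi> t)"

definition free_lie_lift ::
  "('b, 'n) lie_ring_scheme \<Rightarrow> ('a \<Rightarrow> 'b) \<Rightarrow> 'a lie_term set \<Rightarrow> 'b" where
  "free_lie_lift R \<phi> X = the_elem (lie_eval R \<phi> ` X)"


section \<open>The lower central series and its associated graded Lie ring\<close>

definition commutator :: "('a, 'm) monoid_scheme \<Rightarrow> 'a \<Rightarrow> 'a \<Rightarrow> 'a" where
  "commutator G x y = x \<otimes>\<^bsub>G\<^esub> y \<otimes>\<^bsub>G\<^esub> inv\<^bsub>G\<^esub> x \<otimes>\<^bsub>G\<^esub> inv\<^bsub>G\<^esub> y"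

text \<open>The series is indexed from 1; the value at 0 is a dummy.\<close>

fun lcs :: "('a, 'm) monoid_scheme \<Rightarrow> nat \<Rightarrow> 'a set" where
  "lcs G 0 = carrier G"
| "lcs G (Suc 0) = carrier G"
| "lcs G (Suc (Suc k)) =
     generate G {commutator G x y | x y. x \<in> carrier G \<and> y \<in> lcs G (Suc k)}"

definition lcs_quot :: "('a, 'm) monoid_scheme \<Rightarrow> nat \<Rightarrow> 'a set monoid" where
  "lcs_quot G k = G\<lparr>carrier := lcs G k\<rparr> Mod lcs G (k + 1)"

definition lcs_bracket :: "('a, 'm) monoid_scheme \<Rightarrow> nat \<Rightarrow> nat \<Rightarrow> 'a set \<Rightarrow> 'a set \<Rightarrow> 'a set" where
  "lcs_bracket G i j U V =
     the_elem {lcs G (i + j + 1) #>\<^bsub>G\<^esub> commutator G x y | x y. x \<in> U \<and> y \<in> V}"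

definition lcs_graded :: "('a, 'm) monoid_scheme \<Rightarrow> (nat \<Rightarrow> 'a set) lie_ring" where
  "lcs_graded G =
     (let S = sum_group {1..} (lcs_quot G) in
      \<lparr>carrier = carrier S,
       mult = mult S,
       one = one S,
       bracket = (\<lambda>u v. \<lambda>k\<in>{1..}.
         finprod (lcs_quot G k) (\<lambda>i. lcs_bracket G i (k - i) (u i) (v (k - i))) {1..<k})\<rparr>)"

abbreviation abelianization :: "('a, 'm) monoid_scheme \<Rightarrow> 'a set monoid" where
  "abelianization G \<equiv> lcs_quot G 1"

text \<open>The morphism from the free Lie ring on the abelianization of \<open>G\<close> to the associated graded of
  the lower central series, extending the identity in degree 1. It is an isomorphism when \<open>G\<close> is
  free.\<close>

definition lcs_iso :: "('a, 'm) monoid_scheme \<Rightarrow> 'a set lie_term set \<Rightarrow> nat \<Rightarrow> 'a set" where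
  "lcs_iso G = free_lie_lift (lcs_graded G)
     (\<lambda>h. \<lambda>k\<in>{1..}. if k = 1 then h else \<one>\<^bsub>lcs_quot G k\<^esub>)"


section \<open>Derivations\<close>

definition free_lie_derivations ::
  "('a, 'm) monoid_scheme \<Rightarrow> nat \<Rightarrow> ('a lie_term set \<Rightarrow> 'a lie_term set) monoid" where
  "free_lie_derivations A k =
     (let L = free_lie A in
      \<lparr>carrier = {d \<in> carrier L \<rightarrow>\<^sub>E carrier L.
         (\<forall>x\<in>carrier L. \<forall>y\<in>carrier L. d (x \<otimes>\<^bsub>L\<^esub> y) = d x \<otimes>\<^bsub>L\<^esub> d y) \<and>
         (\<forall>x\<in>carrier L. \<forall>y\<in>carrier L.
            d (bracket L x y) = bracket L (d x) y \<otimes>\<^bsub>L\<^esub> bracket L x (d y)) \<and>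
         (\<forall>m\<ge>1. d ` free_lie_degree A m \<subseteq> free_lie_degree A (m + k))},
       mult = (\<lambda>d e. \<lambda>x\<in>carrier L. d x \<otimes>\<^bsub>L\<^esub> e x),
       one = (\<lambda>x\<in>carrier L. \<one>\<^bsub>L\<^esub>)\<rparr>)"


section \<open>Surface groups, the Johnson filtration and the Johnson homomorphisms\<close>

datatype surface_gen = Alpha nat | Beta nat

definition surface_group :: "nat \<Rightarrow> surface_gen letter list monoid" where
  "surface_group g = free_group (Alpha ` {1..g} \<union> Beta ` {1..g})"

definition alpha :: "nat \<Rightarrow> surface_gen letter list" where
  "alpha i = [(Alpha i, False)]"

definition beta :: "nat \<Rightarrow> surface_gen letter list" where
  "beta i = [(Beta i, False)]"

text \<open>The class of the oriented boundary curve, so that its inverse is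
  \<open>[\<beta>\<^sub>1\<^sup>-\<^sup>1, \<alpha>\<^sub>1] \<cdots> [\<beta>\<^sub>g\<^sup>-\<^sup>1, \<alpha>\<^sub>g]\<close>.\<close>

definition zeta :: "nat \<Rightarrow> surface_gen letter list" where
  "zeta g = (let P = surface_group g in
     inv\<^bsub>P\<^esub> (foldr (\<lambda>i w. commutator P (inv\<^bsub>P\<^esub> (beta i)) (alpha i) \<otimes>\<^bsub>P\<^esub> w) [1..<g + 1] \<one>\<^bsub>P\<^esub>))"

abbreviation surface_H :: "nat \<Rightarrow> surface_gen letter list set monoid" where
  "surface_H g \<equiv> abelianization (surface_group g)"

definition H_class :: "nat \<Rightarrow> surface_gen letter list \<Rightarrow> surface_gen letter list set" where
  "H_class g x = lcs (surface_group g) 2 #>\<^bsub>surface_group g\<^esub> x"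

definition omega :: "nat \<Rightarrow> surface_gen letter list set lie_term set" where
  "omega g = (let L = free_lie (surface_H g); \<iota> = free_lie_gen (surface_H g) in
     finprod L (\<lambda>i. bracket L (\<iota> (H_class g (alpha i))) (\<iota> (H_class g (beta i)))) {1..g})"

text \<open>The mapping class group, via the Dehn--Nielsen--Baer theorem.\<close>

definition mapping_class_group ::
  "nat \<Rightarrow> (surface_gen letter list \<Rightarrow> surface_gen letter list) set" where
  "mapping_class_group g = {f \<in> auto (surface_group g). f (zeta g) = zeta g}"

definition johnson_filtration ::
  "nat \<Rightarrow> nat \<Rightarrow> (surface_gen letter list \<Rightarrow> surface_gen letter list) set" where
  "johnson_filtration g k = (let P = surface_group g in
     {f \<in> mapping_class_group g.
        \<forall>x\<in>carrier P. lcs P (k + 1) #>\<^bsub>P\<^esub> f x = lcs P (k + 1) #>\<^bsub>P\<^esub> x})"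

definition symplectic_derivations ::
  "nat \<Rightarrow> nat \<Rightarrow>
     (surface_gen letter list set lie_term set \<Rightarrow> surface_gen letter list set lie_term set) monoid"
where
  "symplectic_derivations g k =
     (let D = free_lie_derivations (surface_H g) k in
      D\<lparr>carrier := {d \<in> carrier D. d (omega g) = \<one>\<^bsub>free_lie (surface_H g)\<^esub>}\<rparr>)"

text \<open>\<open>is_johnson_image g k f d\<close> says that \<open>d\<close> is the value at \<open>f\<close> of the \<open>k\<close>-th Johnson
  homomorphism, i.e. that \<open>d\<close> sends the class \<open>{x}\<close> to the class of \<open>f(x) x\<^sup>-\<^sup>1\<close> in degree \<open>k + 1\<close>,
  under the isomorphism \<open>lcs_iso\<close>. A derivation is determined by its values in degree 1.\<close>

definition is_johnson_image ::
  "nat \<Rightarrow> nat \<Rightarrow> (surface_gen letter list \<Rightarrow> surface_gen letter list) \<Rightarrow>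
     (surface_gen letter list set lie_term set \<Rightarrow> surface_gen letter list set lie_term set) \<Rightarrow> bool"
where
  "is_johnson_image g k f d \<longleftrightarrow> (let P = surface_group g in
     \<forall>x\<in>carrier P. lcs_iso P (d (free_lie_gen (surface_H g) (H_class g x))) (k + 1) =
       lcs P (k + 2) #>\<^bsub>P\<^esub> (f x \<otimes>\<^bsub>P\<^esub> inv\<^bsub>P\<^esub> x))"

definition johnson_image ::
  "nat \<Rightarrow> nat \<Rightarrow>
     (surface_gen letter list set lie_term set \<Rightarrow> surface_gen letter list set lie_term set) set"
where
  "johnson_image g k = {d \<in> carrier (symplectic_derivations g k).
     \<exists>f\<in>johnson_filtration g k. is_johnson_image g k f d}"

end

theory Submission
  imports Defs "Jordan_Normal_Form.Determinant" "HOL-Computational_Algebra.Polynomial_FPS"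
    "HOL-Computational_Algebra.Fraction_Field" "HOL-Library.Z2"
begin

text \<open>Put \<open>e = a\<^sub>2 - a\<^sub>1\<close>, \<open>y\<^sub>0 = a\<^sub>2\<close>, \<open>y\<^sub>n\<^sub>+\<^sub>1 = [e, y\<^sub>n]\<close> and
  \<open>z = \<Sum>\<^sub>j\<^sub><\<^sub>k (-1)\<^sup>j [y\<^sub>j, y\<^sub>2\<^sub>k\<^sub>-\<^sub>1\<^sub>-\<^sub>j]\<close>. The derivation \<open>d\<close> which maps \<open>b\<^sub>1\<close> to \<open>z\<close>, \<open>b\<^sub>2\<close> to
  \<open>y\<^sub>2\<^sub>k - z\<close> and the other basis elements to 0 is symplectic, because \<open>[e, z] = [y\<^sub>0, y\<^sub>2\<^sub>k]\<close> by
  telescoping. It represents a class of order 2.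

  The double of \<open>d\<close> is a Johnson image: two mapping classes \<open>A\<close>, \<open>B\<close> act on the free group on
  \<open>\<alpha>\<^sub>1\<^sup>-\<^sup>1\<close>, \<open>\<beta>\<^sub>2\<^sup>-\<^sup>1 \<alpha>\<^sub>2 \<beta>\<^sub>2\<close>, \<open>\<alpha>\<^sub>2\<^sup>-\<^sup>1\<close> like pure braids, and the iterated commutators
  \<open>f\<^sub>0 = B\<close>, \<open>f\<^sub>n\<^sub>+\<^sub>1 = A f\<^sub>n A\<^sup>-\<^sup>1 f\<^sub>n\<^sup>-\<^sup>1\<close> realise it for \<open>n = 2k\<close>, where the sum defining \<open>z\<close>
  appears folded, each term occurring twice.

  The derivation \<open>d\<close> itself is not: take a field of characteristic 2 with an element \<open>b\<close> other than
  0 and 1, and map \<open>\<pi>\<close> to the units of the power series ring by \<open>\<alpha>\<^sub>1 \<mapsto> 1 + X\<close>, \<open>\<alpha>\<^sub>2 \<mapsto> 1 + b X\<close>,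
  all other generators going to 1. Suppose that \<open>f\<close> in the Johnson filtration realises \<open>d\<close>. The
  determinant of its Jacobian of Fox derivatives is a unit of the polynomial ring localized at
  \<open>1 + X\<close> and \<open>1 + b X\<close>, so it is a constant times powers of these two polynomials. In characteristic 2
  its logarithmic derivative shows that if the coefficients in degrees 1 to \<open>2k\<close> vanish, so does the one in
  degree \<open>2k + 1\<close>. On the other hand this coefficient is the leading term of the trace of the Jacobian minus
  the identity. A second order Fox calculus turns \<open>f \<zeta> = \<zeta>\<close> into a symplecticity relation for the
  Jacobian, which reduces the trace to the Fox derivatives of \<open>z\<close> and \<open>y\<^sub>2\<^sub>k\<close>; it comes out as
  \<open>b (b + 1)\<^sup>2\<^sup>k\<^sup>-\<^sup>1\<close>, which is not zero.\<close>

section \<open>Commutator calculus in the lower central series\<close>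

text \<open>What shapes the non-realizability half is precision. If f acts trivially modulo
  \<Gamma>_(2k+1), the Fox derivatives of f(a) a^-1 start in degree 2k, yet the obstruction sits in
  degree 2k+1, so every congruence is needed modulo X^(2k+2). In degree 2k the symplecticity
  relation cancels the \<alpha> entries of the trace against the \<beta> entries. One degree further
  it remains usable for two reasons: d vanishes on the a_i, and in characteristic 2 a Fox derivative
  agrees with the one for the inverted character to one order more than its size.

  The parameter b must avoid 0 and 1 because the exponents of a unit count only modulo 2: with b
  outside the prime field, 1 + X and 1 + b X stay independent under logarithmic derivation.

  In the realization half, neither A nor B acts trivially on H, so commutator estimates fail in
  \<pi>. They hold in the subgroup on the three loops, where both act by conjugating the generators;
  the estimates are made there and then carried to \<pi>.\<close>

context group
begin

abbreviation comm (infixl \<open>\<lozenge>\<close> 75) where "comm x y \<equiv> commutator G x y"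

text \<open>These cancel inside right-associated words. Together with \<open>word_simps\<close> they
  let the simplifier decide identities that hold in every group, which is how the word identities
  below are proved.\<close>

lemma l_cancel_inv [simp]:
  "x \<in> carrier G \<Longrightarrow> y \<in> carrier G \<Longrightarrow> x \<otimes> (inv x \<otimes> y) = y"
  "x \<in> carrier G \<Longrightarrow> y \<in> carrier G \<Longrightarrow> inv x \<otimes> (x \<otimes> y) = y"
  by (simp_all flip: m_assoc)

lemmas word_simps = commutator_def m_assoc inv_mult_group

lemma commutator_closed [simp, intro]:
  "x \<in> carrier G \<Longrightarrow> y \<in> carrier G \<Longrightarrow> x \<lozenge> y \<in> carrier G"
  by (simp add: commutator_def)

lemma commutator_one [simp]:
  "x \<in> carrier G \<Longrightarrow> x \<lozenge> \<one> = \<one>" "x \<in> carrier G \<Longrightarrow> \<one> \<lozenge> x = \<one>" "x \<in> carrier G \<Longrightarrow> x \<lozenge> x = \<one>"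
  by (simp_all add: word_simps)

lemma inv_commutator: "x \<in> carrier G \<Longrightarrow> y \<in> carrier G \<Longrightarrow> inv (x \<lozenge> y) = y \<lozenge> x"
  by (simp add: word_simps)

lemma conj_commutator:
  "g \<in> carrier G \<Longrightarrow> x \<in> carrier G \<Longrightarrow> y \<in> carrier G \<Longrightarrow>
     g \<otimes> (x \<lozenge> y) \<otimes> inv g = (g \<otimes> x \<otimes> inv g) \<lozenge> (g \<otimes> y \<otimes> inv g)"
  by (simp add: word_simps)

lemma commutator_mult_left:
  "x \<in> carrier G \<Longrightarrow> y \<in> carrier G \<Longrightarrow> z \<in> carrier G \<Longrightarrow>
     (x \<otimes> y) \<lozenge> z = x \<otimes> (y \<lozenge> z) \<otimes> inv x \<otimes> (x \<lozenge> z)"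
  by (simp add: word_simps)

lemma conj_eq_commutator_mult:
  "x \<in> carrier G \<Longrightarrow> y \<in> carrier G \<Longrightarrow> x \<otimes> y \<otimes> inv x = (x \<lozenge> y) \<otimes> y"
  by (simp add: word_simps)

lemma hall_witt:
  assumes "x \<in> carrier G" "y \<in> carrier G" "z \<in> carrier G"
  shows "((x \<lozenge> y) \<lozenge> (y \<otimes> z \<otimes> inv y)) \<otimes> ((y \<lozenge> z) \<lozenge> (z \<otimes> x \<otimes> inv z)) \<otimes>
         ((z \<lozenge> x) \<lozenge> (x \<otimes> y \<otimes> inv x)) = \<one>"
  using assms by (simp add: word_simps)

lemma lcs_subset: "lcs G k \<subseteq> carrier G"
proof (induction k rule: lcs.induct[where ?P = "\<lambda>_ k. lcs G k \<subseteq> carrier G" and ?a0.0 = G])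
  case (3 H k)
  then show ?case by simp (rule generate_incl, auto)
qed auto

lemma lcs_closed [simp]: "x \<in> lcs G k \<Longrightarrow> x \<in> carrier G"
  using lcs_subset by blast

lemma normal_conj:
  "N \<lhd> G \<Longrightarrow> h \<in> N \<Longrightarrow> g \<in> carrier G \<Longrightarrow> g \<otimes> h \<otimes> inv g \<in> N"
  by (simp add: normal.inv_op_closed2)

lemma normal_lcs: "lcs G k \<lhd> G"
proof (induction k rule: lcs.induct[where ?P = "\<lambda>_ k. lcs G k \<lhd> G" and ?a0.0 = G])
  case (3 H k)
  show ?case
    unfolding lcs.simps
  proof (rule normal_generateI)
    fix h g assume "h \<in> {x \<lozenge> y |x y. x \<in> carrier G \<and> y \<in> lcs G (Suc k)}" and g: "g \<in> carrier G"
    then obtain x y where h: "h = x \<lozenge> y" "x \<in> carrier G" "y \<in> lcs G (Suc k)" by blast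
    have "g \<otimes> h \<otimes> inv g = (g \<otimes> x \<otimes> inv g) \<lozenge> (g \<otimes> y \<otimes> inv g)"
      using h g by (simp add: conj_commutator)
    moreover have "g \<otimes> y \<otimes> inv g \<in> lcs G (Suc k)"
      using normal_conj[OF 3] h g by simp
    ultimately show "g \<otimes> h \<otimes> inv g \<in> {x \<lozenge> y |x y. x \<in> carrier G \<and> y \<in> lcs G (Suc k)}"
      using g h by auto
  qed auto
qed (simp_all add: normal_self)

lemma subgroup_lcs: "subgroup (lcs G k) G"
  by (rule normal_imp_subgroup[OF normal_lcs])

lemma lcs_intros [simp, intro]:
  "\<one> \<in> lcs G k"
  "x \<in> lcs G k \<Longrightarrow> y \<in> lcs G k \<Longrightarrow> x \<otimes> y \<in> lcs G k"
  "x \<in> lcs G k \<Longrightarrow> inv x \<in> lcs G k"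
  "x \<in> lcs G k \<Longrightarrow> g \<in> carrier G \<Longrightarrow> g \<otimes> x \<otimes> inv g \<in> lcs G k"
  using subgroup_lcs[of k] normal_conj[OF normal_lcs]
  by (auto simp: subgroup.one_closed subgroup.m_closed subgroup.m_inv_closed)

lemma lcs_Suc_subset: "lcs G (Suc k) \<subseteq> lcs G k"
proof (cases k)
  case (Suc j)
  have "x \<lozenge> y \<in> lcs G (Suc j)" if "x \<in> carrier G" "y \<in> lcs G (Suc j)" for x y
    using lcs_intros(2)[OF lcs_intros(4)[OF that(2,1)] lcs_intros(3)[OF that(2)]]
    by (simp add: commutator_def)
  then show ?thesis
    unfolding Suc lcs.simps(3) by (intro generate_subgroup_incl subgroup_lcs) auto
qed simp

lemma lcs_antimono: "i \<le> j \<Longrightarrow> lcs G j \<subseteq> lcs G i"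
  by (rule lift_Suc_antimono_le) (auto intro: lcs_Suc_subset[THEN subsetD])

lemma lcs_mono: "x \<in> lcs G j \<Longrightarrow> i \<le> j \<Longrightarrow> x \<in> lcs G i"
  using lcs_antimono by blast

lemma commutator_in_lcs_Suc:
  assumes "x \<in> carrier G" "y \<in> lcs G k" "k \<ge> 1"
  shows "x \<lozenge> y \<in> lcs G (Suc k)"
  using assms by (cases k) (auto intro: generate.incl)

lemma commutator_in_lcs_Suc':
  assumes "x \<in> lcs G k" "y \<in> carrier G" "k \<ge> 1"
  shows "x \<lozenge> y \<in> lcs G (Suc k)"
  using commutator_in_lcs_Suc[OF assms(2,1,3)] inv_commutator[of y x] assms
  by (metis lcs_closed lcs_intros(3))

text \<open>Reduces a bound on commutators whose left entry runs through a generated subgroup to a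
  bound on the generators: being a subgroup, the set contains whatever its elements
  generate.\<close>

lemma subgroup_commutator_preimage:
  assumes N: "N \<lhd> G" and z: "Z \<subseteq> carrier G"
  shows "subgroup {u \<in> carrier G. \<forall>z\<in>Z. u \<lozenge> z \<in> N} G"
proof -
  interpret N: normal N G by fact
  show ?thesis
  proof (rule subgroupI)
    show "{u \<in> carrier G. \<forall>z\<in>Z. u \<lozenge> z \<in> N} \<noteq> {}"
      using z by (auto intro!: exI[of _ "\<one>"] simp: subset_iff)
  next
    fix u assume u: "u \<in> {u \<in> carrier G. \<forall>z\<in>Z. u \<lozenge> z \<in> N}"
    have "inv u \<lozenge> z \<in> N" if "z \<in> Z" for z
    proof -
      have "inv u \<lozenge> z = inv u \<otimes> inv (u \<lozenge> z) \<otimes> inv (inv u)"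
        using u that z by (simp add: word_simps subset_iff)
      then show ?thesis using u that normal_conj[OF N, of "inv (u \<lozenge> z)" "inv u"] by simp
    qed
    then show "inv u \<in> {u \<in> carrier G. \<forall>z\<in>Z. u \<lozenge> z \<in> N}" using u by auto
  next
    fix u v assume u: "u \<in> {u \<in> carrier G. \<forall>z\<in>Z. u \<lozenge> z \<in> N}"
      and v: "v \<in> {u \<in> carrier G. \<forall>z\<in>Z. u \<lozenge> z \<in> N}"
    then show "u \<otimes> v \<in> {u \<in> carrier G. \<forall>z\<in>Z. u \<lozenge> z \<in> N}"
      using z normal_conj[OF N] by (auto simp: commutator_mult_left subset_iff)
  qed auto
qed

text \<open>The three subgroups argument, by induction on the first index.\<close>

lemma commutator_in_lcs:
  assumes "x \<in> lcs G i" "y \<in> lcs G j" "i \<ge> 1" "j \<ge> 1"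
  shows "x \<lozenge> y \<in> lcs G (i + j)"
  using assms(3,1,2,4)
proof (induction i arbitrary: x y j rule: dec_induct)
  case base
  then show ?case by (simp add: commutator_in_lcs_Suc)
next
  case (step i)
  let ?T = "{u \<in> carrier G. \<forall>z\<in>lcs G j. u \<lozenge> z \<in> lcs G (Suc i + j)}"
  have T: "subgroup ?T G"
    by (intro subgroup_commutator_preimage normal_lcs lcs_subset)
  have "g \<lozenge> y \<in> ?T" if g: "g \<in> carrier G" and y: "y \<in> lcs G i" for g y
  proof (safe)
    fix w assume w: "w \<in> lcs G j"
    \<comment> \<open>Hall-Witt has a conjugate of its third element in the last slot, so
      \<open>z\<close> is chosen with y z y^-1 = w.\<close>
    define z where "z = inv y \<otimes> w \<otimes> y"
    have z: "z \<in> lcs G j" using lcs_intros(4)[OF w, of "inv y"] y by (simp add: z_def)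
    note c = g lcs_closed[OF y] lcs_closed[OF z] lcs_closed[OF w]
    have w_eq: "w = y \<otimes> z \<otimes> inv y" using c by (simp add: z_def m_assoc)
    define p where "p = (y \<lozenge> z) \<lozenge> (z \<otimes> g \<otimes> inv z)"
    define q where "q = (z \<lozenge> g) \<lozenge> (g \<otimes> y \<otimes> inv g)"
    have "y \<lozenge> z \<in> lcs G (i + j)" using step.IH[OF y z] step by simp
    then have p: "p \<in> lcs G (Suc i + j)"
      using commutator_in_lcs_Suc'[of "y \<lozenge> z" "i + j"] c step by (simp add: p_def)
    have "z \<lozenge> g \<in> lcs G (Suc j)" using commutator_in_lcs_Suc'[OF z g] step by simp
    moreover have "g \<otimes> y \<otimes> inv g \<in> lcs G i" using y g by simp
    ultimately have "(g \<otimes> y \<otimes> inv g) \<lozenge> (z \<lozenge> g) \<in> lcs G (i + Suc j)"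
      using step.IH[of _ _ "Suc j"] by simp
    then have q: "q \<in> lcs G (Suc i + j)"
      using lcs_intros(3)[of "(g \<otimes> y \<otimes> inv g) \<lozenge> (z \<lozenge> g)" "i + Suc j"] c
      by (simp add: q_def inv_commutator)
    have "((g \<lozenge> y) \<lozenge> w) \<otimes> p \<otimes> q = \<one>"
      using hall_witt[of g y z] c by (simp add: p_def q_def w_eq)
    then have "(g \<lozenge> y) \<lozenge> w = inv (p \<otimes> q)"
      using c p q by (metis inv_equality commutator_closed lcs_closed m_assoc m_closed)
    then show "(g \<lozenge> y) \<lozenge> w \<in> lcs G (Suc i + j)" using p q by simp
  qed (use that in auto)
  then have "{g \<lozenge> y |g y. g \<in> carrier G \<and> y \<in> lcs G i} \<subseteq> ?T" by blast
  moreover obtain i' where "i = Suc i'" using step(1) by (cases i) auto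
  ultimately have "lcs G (Suc i) \<subseteq> ?T"
    using generate_subgroup_incl[OF _ T] by simp
  then show ?case using step by blast
qed

text \<open>The elements satisfying the bound form a subgroup, so commutators of g and y suffice.
  There the deviation is a product of conjugates of commutators with an entry a = f(g) g^-1 in
  \<Gamma>_(r+1) or b = f(y) y^-1 in \<Gamma>_(j+r), each of weight at least j + 1 + r.\<close>

lemma endo_shifts_lcs:
  assumes f: "f \<in> hom G G" and r: "\<And>u. u \<in> carrier G \<Longrightarrow> f u \<otimes> inv u \<in> lcs G (Suc r)"
    and "u \<in> lcs G j" "j \<ge> 1"
  shows "f u \<otimes> inv u \<in> lcs G (j + r)"
  using assms(4,3)
proof (induction j arbitrary: u rule: dec_induct)
  case base
  then show ?case using r by simp
next
  case (step j)
  have fc [simp]: "f x \<in> carrier G" if "x \<in> carrier G" for x using f that by (auto simp: hom_def)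
  have fm: "f (x \<otimes> y) = f x \<otimes> f y" if "x \<in> carrier G" "y \<in> carrier G" for x y
    using f that by (auto simp: hom_def)
  have fi: "f (inv x) = inv (f x)" if "x \<in> carrier G" for x
    using group_hom.hom_inv[of G G f x] f that by (simp add: group_hom_def group_hom_axioms_def is_group)
  let ?N = "lcs G (Suc j + r)"
  let ?T = "{u \<in> carrier G. f u \<otimes> inv u \<in> ?N}"
  have T: "subgroup ?T G"
  proof (rule subgroupI)
    show "?T \<noteq> {}" using fm[of \<one> \<one>] by (auto intro!: exI[of _ \<one>])
  next
    fix u assume u: "u \<in> ?T"
    have "inv (f u) \<otimes> u = inv u \<otimes> inv (f u \<otimes> inv u) \<otimes> inv (inv u)"
      using u by (simp add: word_simps)
    then show "inv u \<in> ?T"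
      using u lcs_intros(4)[of "inv (f u \<otimes> inv u)" "Suc j + r" "inv u"] by (auto simp: fi)
  next
    fix u v assume uv: "u \<in> ?T" "v \<in> ?T"
    have "f (u \<otimes> v) \<otimes> inv (u \<otimes> v) = (f u \<otimes> inv u) \<otimes> (u \<otimes> (f v \<otimes> inv v) \<otimes> inv u)"
      using uv by (simp add: fm word_simps)
    then show "u \<otimes> v \<in> ?T" using uv by simp
  qed auto
  have "g \<lozenge> y \<in> ?T" if g: "g \<in> carrier G" and y: "y \<in> lcs G j" for g y
  proof -
    define a b where "a = f g \<otimes> inv g" and "b = f y \<otimes> inv y"
    have a: "a \<in> lcs G (Suc r)" using r g by (simp add: a_def)
    have b: "b \<in> lcs G (j + r)" using step.IH y by (simp add: b_def)
    note c = g lcs_closed[OF y] lcs_closed[OF a] lcs_closed[OF b]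
    have "f g = a \<otimes> g" "f y = b \<otimes> y" using c by (simp_all add: a_def b_def m_assoc)
    then have "f (g \<lozenge> y) \<otimes> inv (g \<lozenge> y) =
        (a \<otimes> (g \<lozenge> b) \<otimes> inv a) \<otimes> (a \<otimes> (b \<otimes> (g \<lozenge> y) \<otimes> inv b) \<otimes> inv a) \<otimes>
        (a \<lozenge> (b \<otimes> y)) \<otimes> inv (g \<lozenge> y)"
      using c by (simp add: fm fi word_simps)
    also have "\<dots> = (a \<otimes> (g \<lozenge> b) \<otimes> inv a) \<otimes> (a \<otimes> (b \<lozenge> (g \<lozenge> y)) \<otimes> inv a) \<otimes>
        (a \<lozenge> (g \<lozenge> y)) \<otimes> ((g \<lozenge> y) \<otimes> (a \<lozenge> (b \<otimes> y)) \<otimes> inv (g \<lozenge> y))"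
      using c by (simp add: word_simps)
    finally have eq: "f (g \<lozenge> y) \<otimes> inv (g \<lozenge> y) = \<dots>" .
    have "g \<lozenge> b \<in> ?N" using commutator_in_lcs_Suc[OF g b] step by simp
    moreover have "b \<lozenge> (g \<lozenge> y) \<in> ?N"
      using commutator_in_lcs_Suc'[OF b] c step by simp
    moreover have "a \<lozenge> (g \<lozenge> y) \<in> ?N"
      using commutator_in_lcs[OF a, of "g \<lozenge> y" j] lcs_mono[OF commutator_in_lcs_Suc[OF g y]] step
      by (simp add: add.commute)
    moreover have "a \<lozenge> (b \<otimes> y) \<in> ?N"
      using commutator_in_lcs[OF a, of "b \<otimes> y" j] lcs_intros(2)[OF lcs_mono[OF b] y] step
      by (simp add: add.commute)
    ultimately have "f (g \<lozenge> y) \<otimes> inv (g \<lozenge> y) \<in> ?N"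
      unfolding eq using c by (intro lcs_intros) auto
    then show ?thesis using c by simp
  qed
  then have "{g \<lozenge> y |g y. g \<in> carrier G \<and> y \<in> lcs G j} \<subseteq> ?T" by blast
  moreover obtain i' where "j = Suc i'" using step(1) by (cases j) auto
  ultimately have "lcs G (Suc j) \<subseteq> ?T"
    using generate_subgroup_incl[OF _ T] by simp
  then show ?case using step by blast
qed

lemma hom_lcs:
  assumes "group H" "f \<in> hom G H" "u \<in> lcs G k"
  shows "f u \<in> lcs H k"
proof -
  interpret H: group H by fact
  interpret f: group_hom G H f using assms by unfold_locales
  have "f ` lcs G k \<subseteq> lcs H k"
  proof (induction k rule: lcs.induct[where ?P = "\<lambda>_ k. f ` lcs G k \<subseteq> lcs H k" and ?a0.0 = G])
    case (3 F k)
    let ?C = "{x \<lozenge> y |x y. x \<in> carrier G \<and> y \<in> lcs G (Suc k)}"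
    have "f (x \<lozenge> y) = commutator H (f x) (f y)" if "x \<in> carrier G" "y \<in> carrier G" for x y
      using that by (simp add: commutator_def)
    then have "f ` ?C \<subseteq> {commutator H x y |x y. x \<in> carrier H \<and> y \<in> lcs H (Suc k)}"
      using 3 by (fastforce simp: image_subset_iff)
    moreover have "f ` generate G ?C = generate H (f ` ?C)"
      by (rule f.generate_img[symmetric]) auto
    ultimately show ?case using H.mono_generate by simp
  qed auto
  then show ?thesis using assms by blast
qed

end

declare lcs.simps(3) [simp del]


section \<open>The graded Lie ring of the lower central series\<close>

context group
begin

abbreviation cls :: "nat \<Rightarrow> 'a \<Rightarrow> 'a set" where "cls k x \<equiv> lcs G (Suc k) #> x"

lemma cls_mult:
  "x \<in> carrier G \<Longrightarrow> y \<in> carrier G \<Longrightarrow> (lcs G k #> x) <#> (lcs G k #> y) = lcs G k #> (x \<otimes> y)"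
  by (rule normal.rcos_sum[OF normal_lcs])

lemma cls_repr: "x \<in> carrier G \<Longrightarrow> y \<in> lcs G k #> x \<Longrightarrow> lcs G k #> y = lcs G k #> x"
  using repr_independence[OF _ _ subgroup_lcs] by blast

lemma cls_self: "x \<in> carrier G \<Longrightarrow> x \<in> lcs G k #> x"
  using rcos_self[OF _ subgroup_lcs] by blast

lemma cls_eq_iff:
  "x \<in> carrier G \<Longrightarrow> y \<in> carrier G \<Longrightarrow> lcs G k #> x = lcs G k #> y \<longleftrightarrow> x \<otimes> inv y \<in> lcs G k"
  using subgroup.rcos_module[OF subgroup_lcs is_group, of y x k] cls_repr[of y x k] cls_self[of x k] by auto

lemma cls_one: "lcs G k #> \<one> = lcs G k"
  by (rule coset_mult_one[OF lcs_subset])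

lemma cls_mult_cong:
  assumes "lcs G k #> x = lcs G k #> x'" "lcs G k #> y = lcs G k #> y'"
    "x \<in> carrier G" "x' \<in> carrier G" "y \<in> carrier G" "y' \<in> carrier G"
  shows "lcs G k #> (x \<otimes> y) = lcs G k #> (x' \<otimes> y')"
  using assms by (metis cls_mult)

lemma normal_lcs_lcs: "lcs G (Suc k) \<lhd> G\<lparr>carrier := lcs G k\<rparr>"
  by (rule normal_restrict_supergroup[OF subgroup_lcs normal_lcs lcs_Suc_subset])

lemma carrier_lcs_quot: "carrier (lcs_quot G k) = cls k ` lcs G k"
  unfolding lcs_quot_def carrier_FactGroup by simp

lemma lcs_quot_sel [simp]:
  "\<one>\<^bsub>lcs_quot G k\<^esub> = lcs G (Suc k)" "X \<otimes>\<^bsub>lcs_quot G k\<^esub> Y = X <#> Y"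
  by (simp_all add: lcs_quot_def)

lemma group_lcs_quot: "group (lcs_quot G k)"
  unfolding lcs_quot_def using normal.factorgroup_is_group[OF normal_lcs_lcs] by simp

lemma comm_group_lcs_quot: assumes "k \<ge> 1" shows "comm_group (lcs_quot G k)"
proof (rule group.group_comm_groupI[OF group_lcs_quot])
  fix X Y assume "X \<in> carrier (lcs_quot G k)" "Y \<in> carrier (lcs_quot G k)"
  then obtain x y where xy: "x \<in> lcs G k" "y \<in> lcs G k" "X = cls k x" "Y = cls k y"
    by (auto simp: carrier_lcs_quot)
  have "x \<otimes> y \<otimes> inv (y \<otimes> x) = x \<lozenge> y" using xy by (simp add: word_simps)
  then have "cls k (x \<otimes> y) = cls k (y \<otimes> x)"
    using xy commutator_in_lcs_Suc[of x y k] assms by (simp add: cls_eq_iff)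
  then show "X \<otimes>\<^bsub>lcs_quot G k\<^esub> Y = Y \<otimes>\<^bsub>lcs_quot G k\<^esub> X"
    using xy by (simp add: cls_mult)
qed

lemma cls_in_lcs_quot [simp, intro]: "x \<in> lcs G k \<Longrightarrow> cls k x \<in> carrier (lcs_quot G k)"
  by (simp add: carrier_lcs_quot)

lemma inv_cls: assumes "x \<in> lcs G k" shows "inv\<^bsub>lcs_quot G k\<^esub> (cls k x) = cls k (inv x)"
proof -
  interpret Q: group "lcs_quot G k" by (rule group_lcs_quot)
  show ?thesis
    by (rule Q.inv_equality) (use assms in \<open>simp_all add: cls_mult cls_one\<close>)
qed

lemma commutator_cls_cong:
  assumes "x \<in> lcs G i" "x' \<in> lcs G i" "y \<in> lcs G j" "y' \<in> lcs G j" "i \<ge> 1" "j \<ge> 1"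
    and "cls i x = cls i x'" "cls j y = cls j y'"
  shows "cls (i + j) (x \<lozenge> y) = cls (i + j) (x' \<lozenge> y')"
proof -
  define a b where "a = x \<otimes> inv x'" and "b = y \<otimes> inv y'"
  have a: "a \<in> lcs G (Suc i)" and b: "b \<in> lcs G (Suc j)"
    using assms by (simp_all add: cls_eq_iff a_def b_def)
  note c = assms(1-4)[THEN lcs_closed] lcs_closed[OF a] lcs_closed[OF b]
  have x: "x = a \<otimes> x'" and y: "y = b \<otimes> y'" using c by (simp_all add: a_def b_def m_assoc)
  let ?N = "lcs G (Suc (i + j))"
  have "a \<lozenge> y \<in> ?N"
    using commutator_in_lcs[OF a assms(3)] assms by simp
  moreover have "x' \<lozenge> b \<in> ?N"
    using commutator_in_lcs[OF assms(2) b] assms by simp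
  moreover have "b \<lozenge> (x' \<lozenge> y') \<in> ?N"
    using commutator_in_lcs[OF b, of "x' \<lozenge> y'" i] lcs_mono[OF commutator_in_lcs[OF assms(2,4)], of i]
      assms by (simp add: add.commute)
  \<comment> \<open>Substituting x = a x' and y = b y' leaves only conjugates of commutators that
    contain \<open>a\<close> or \<open>b\<close>, both one degree deeper than the entry they
    correct.\<close>
  moreover have "(x \<lozenge> y) \<otimes> inv (x' \<lozenge> y') =
      (a \<otimes> ((x' \<lozenge> b) \<otimes> (b \<lozenge> (x' \<lozenge> y'))) \<otimes> inv a) \<otimes> ((a \<otimes> (x' \<lozenge> y') \<otimes> inv a) \<otimes> (a \<lozenge> y) \<otimes> inv (a \<otimes> (x' \<lozenge> y') \<otimes> inv a)) \<otimes> (a \<lozenge> (x' \<lozenge> y'))"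
    unfolding y using c by (simp add: x word_simps)
  moreover have "a \<lozenge> (x' \<lozenge> y') \<in> ?N"
    using commutator_in_lcs[OF a, of "x' \<lozenge> y'" j] lcs_mono[OF commutator_in_lcs[OF assms(2,4)], of j]
      assms by simp
  ultimately have "(x \<lozenge> y) \<otimes> inv (x' \<lozenge> y') \<in> ?N"
    using c by (simp only:) (intro lcs_intros m_closed inv_closed commutator_closed, auto)
  then show ?thesis using c by (simp add: cls_eq_iff)
qed

text \<open>The set under \<open>the_elem\<close> is a singleton: all representatives of a coset of
  \<Gamma>_(i+1) in \<Gamma>_i lie in \<Gamma>_i again, and commutators of representatives agree one
  degree beyond their weight.\<close>

lemma lcs_bracket_cls:
  assumes "x \<in> lcs G i" "y \<in> lcs G j" "i \<ge> 1" "j \<ge> 1"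
  shows "lcs_bracket G i j (cls i x) (cls j y) = cls (i + j) (x \<lozenge> y)"
proof -
  have *: "x' \<in> lcs G i \<and> cls i x' = cls i x" if "x \<in> lcs G i" "x' \<in> cls i x" for x x' i
  proof -
    have x': "x' \<in> carrier G" using that r_coset_subset_G[OF lcs_subset lcs_closed[OF that(1)]] by blast
    have eq: "cls i x' = cls i x" by (rule cls_repr[OF lcs_closed[OF that(1)] that(2)])
    then have "x' \<otimes> inv x \<in> lcs G i"
      using x' that cls_eq_iff[of x' x "Suc i"] lcs_Suc_subset[of i] by auto
    then have "x' \<otimes> inv x \<otimes> x \<in> lcs G i" using that by blast
    then show ?thesis using x' that eq by (simp add: m_assoc)
  qed
  have "cls (i + j) (x' \<lozenge> y') = cls (i + j) (x \<lozenge> y)" if "x' \<in> cls i x" "y' \<in> cls j y" for x' y'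
    using *[OF assms(1) that(1)] *[OF assms(2) that(2)] assms by (intro commutator_cls_cong) auto
  moreover have "x \<in> cls i x" "y \<in> cls j y" using assms by (simp_all add: cls_self)
  ultimately have "{cls (i + j) (x' \<lozenge> y') |x' y'. x' \<in> cls i x \<and> y' \<in> cls j y} = {cls (i + j) (x \<lozenge> y)}"
    by blast
  then show ?thesis by (simp add: lcs_bracket_def)
qed

lemma cls_commutator_mult_left:
  assumes "x \<in> lcs G i" "x' \<in> lcs G i" "y \<in> lcs G j" "i \<ge> 1" "j \<ge> 1"
  shows "cls (i + j) ((x \<otimes> x') \<lozenge> y) = cls (i + j) ((x \<lozenge> y) \<otimes> (x' \<lozenge> y))"
proof -
  note c = assms(1-3)[THEN lcs_closed]
  have "x \<lozenge> (x' \<lozenge> y) \<in> lcs G (Suc (i + j))"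
    using commutator_in_lcs_Suc[OF _ commutator_in_lcs[OF assms(2,3)]] assms by simp
  moreover have "((x \<otimes> x') \<lozenge> y) \<otimes> inv ((x' \<lozenge> y) \<otimes> (x \<lozenge> y)) = x \<lozenge> (x' \<lozenge> y)"
    using c by (simp add: word_simps)
  ultimately have "cls (i + j) ((x \<otimes> x') \<lozenge> y) = cls (i + j) ((x' \<lozenge> y) \<otimes> (x \<lozenge> y))"
    using c by (simp add: cls_eq_iff)
  also have "\<dots> = cls (i + j) ((x \<lozenge> y) \<otimes> (x' \<lozenge> y))"
    using comm_groupE(4)[OF comm_group_lcs_quot, of "i + j" "cls (i + j) (x \<lozenge> y)" "cls (i + j) (x' \<lozenge> y)"]
      assms commutator_in_lcs[OF assms(1,3-5)] commutator_in_lcs[OF assms(2,3-5)]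
    by (simp add: cls_mult)
  finally show ?thesis .
qed

lemma cls_commutator_swap:
  assumes "x \<in> lcs G i" "y \<in> lcs G j" "i \<ge> 1" "j \<ge> 1"
  shows "cls (i + j) (y \<lozenge> x) = inv\<^bsub>lcs_quot G (i + j)\<^esub> (cls (i + j) (x \<lozenge> y))"
  using assms by (simp add: inv_cls commutator_in_lcs inv_commutator)

lemma cls_commutator_mult_right:
  assumes "x \<in> lcs G i" "y \<in> lcs G j" "y' \<in> lcs G j" "i \<ge> 1" "j \<ge> 1"
  shows "cls (i + j) (x \<lozenge> (y \<otimes> y')) = cls (i + j) ((x \<lozenge> y) \<otimes> (x \<lozenge> y'))"
proof -
  note c = assms(1-3)[THEN lcs_closed]
  have "y \<lozenge> (x \<lozenge> y') \<in> lcs G (Suc (i + j))"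
    using commutator_in_lcs_Suc[OF _ commutator_in_lcs[OF assms(1,3)]] assms by simp
  moreover have "(x \<lozenge> (y \<otimes> y')) \<otimes> inv ((x \<lozenge> y) \<otimes> (x \<lozenge> y')) =
      (x \<lozenge> y) \<otimes> (y \<lozenge> (x \<lozenge> y')) \<otimes> inv (x \<lozenge> y)"
    using c by (simp add: word_simps)
  ultimately show ?thesis using c by (simp add: cls_eq_iff)
qed

text \<open>Hall-Witt read modulo \<Gamma>_(i+j+l+1): the conjugations disappear, and reversing the
  outer commutators turns it into the inverse of the Jacobi product.\<close>

lemma cls_jacobi:
  assumes "x \<in> lcs G i" "y \<in> lcs G j" "z \<in> lcs G l" "i \<ge> 1" "j \<ge> 1" "l \<ge> 1"
  shows "cls (i + j + l) ((x \<lozenge> (y \<lozenge> z)) \<otimes> ((y \<lozenge> (z \<lozenge> x)) \<otimes> (z \<lozenge> (x \<lozenge> y)))) = lcs G (Suc (i + j + l))"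
proof -
  note c = assms(1-3)[THEN lcs_closed]
  have conj: "cls i (g \<otimes> x \<otimes> inv g) = cls i x" if "g \<in> carrier G" "x \<in> lcs G i" "i \<ge> 1" for g x i
  proof -
    have "(g \<lozenge> x) \<otimes> x \<otimes> inv x = g \<lozenge> x" using that by (simp add: m_assoc)
    then show ?thesis
      using that commutator_in_lcs_Suc[OF that] conj_eq_commutator_mult[of g x] cls_eq_iff[of "g \<otimes> x \<otimes> inv g" x "Suc i"]
      by simp
  qed
  have nest: "cls (i + j + l) ((x \<lozenge> y) \<lozenge> (y \<otimes> z \<otimes> inv y)) = inv\<^bsub>lcs_quot G (i + j + l)\<^esub> (cls (i + j + l) (z \<lozenge> (x \<lozenge> y)))"
    if "x \<in> lcs G i" "y \<in> lcs G j" "z \<in> lcs G l" "i \<ge> 1" "j \<ge> 1" "l \<ge> 1" for x y z i j l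
  proof -
    have "cls (i + j + l) ((x \<lozenge> y) \<lozenge> (y \<otimes> z \<otimes> inv y)) = cls (i + j + l) ((x \<lozenge> y) \<lozenge> z)"
      by (rule commutator_cls_cong) (use that commutator_in_lcs[of x i y j] conj in simp_all)
    also have "\<dots> = inv\<^bsub>lcs_quot G (i + j + l)\<^esub> (cls (i + j + l) (z \<lozenge> (x \<lozenge> y)))"
      using cls_commutator_swap[OF that(3) commutator_in_lcs[OF that(1,2,4,5)] that(6)] that
      unfolding add.commute[of l "i + j"] by simp
    finally show ?thesis .
  qed
  let ?n = "i + j + l"
  interpret Q: comm_group "lcs_quot G ?n" by (rule comm_group_lcs_quot) (use assms in simp)
  define A B C where "A = cls ?n (x \<lozenge> (y \<lozenge> z))" and "B = cls ?n (y \<lozenge> (z \<lozenge> x))"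
    and "C = cls ?n (z \<lozenge> (x \<lozenge> y))"
  have in3: "x \<lozenge> (y \<lozenge> z) \<in> lcs G ?n" "y \<lozenge> (z \<lozenge> x) \<in> lcs G ?n" "z \<lozenge> (x \<lozenge> y) \<in> lcs G ?n"
    using commutator_in_lcs[OF assms(1) commutator_in_lcs[OF assms(2,3,5,6)] assms(4)]
      commutator_in_lcs[OF assms(2) commutator_in_lcs[OF assms(3,1,6,4)] assms(5)]
      commutator_in_lcs[OF assms(3) commutator_in_lcs[OF assms(1,2,4,5)] assms(6)] assms
    by (simp_all add: add.assoc add.commute[of l] add.left_commute[of j i l])
  have ABC: "A \<in> carrier (lcs_quot G ?n)" "B \<in> carrier (lcs_quot G ?n)" "C \<in> carrier (lcs_quot G ?n)"
    using in3 by (auto simp: A_def B_def C_def)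
  define a b c where "a = (x \<lozenge> y) \<lozenge> (y \<otimes> z \<otimes> inv y)" and "b = (y \<lozenge> z) \<lozenge> (z \<otimes> x \<otimes> inv z)"
    and "c = (z \<lozenge> x) \<lozenge> (x \<otimes> y \<otimes> inv x)"
  have abc: "a \<in> carrier G" "b \<in> carrier G" "c \<in> carrier G" "a \<otimes> b \<otimes> c = \<one>"
    using hall_witt[of x y z] assms(1-3)[THEN lcs_closed] unfolding a_def b_def c_def by blast+
  have perm: "j + l + i = ?n" "l + i + j = ?n" by simp_all
  have "cls ?n a = inv\<^bsub>lcs_quot G ?n\<^esub> C" "cls ?n b = inv\<^bsub>lcs_quot G ?n\<^esub> A" "cls ?n c = inv\<^bsub>lcs_quot G ?n\<^esub> B"
    using nest[OF assms] nest[OF assms(2,3,1,5,6,4)] nest[OF assms(3,1,2,6,4,5)]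
    unfolding perm a_def b_def c_def A_def B_def C_def by blast+
  moreover have "(cls ?n a <#> cls ?n b) <#> cls ?n c = lcs G (Suc ?n)"
    using abc by (simp only: cls_mult m_closed cls_one)
  ultimately have "inv\<^bsub>lcs_quot G ?n\<^esub> C \<otimes>\<^bsub>lcs_quot G ?n\<^esub> inv\<^bsub>lcs_quot G ?n\<^esub> A \<otimes>\<^bsub>lcs_quot G ?n\<^esub> inv\<^bsub>lcs_quot G ?n\<^esub> B = \<one>\<^bsub>lcs_quot G ?n\<^esub>"
    by (simp only: lcs_quot_sel)
  then have "inv\<^bsub>lcs_quot G ?n\<^esub> (A \<otimes>\<^bsub>lcs_quot G ?n\<^esub> (B \<otimes>\<^bsub>lcs_quot G ?n\<^esub> C)) = \<one>\<^bsub>lcs_quot G ?n\<^esub>"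
    using ABC by (simp add: Q.inv_mult Q.m_ac del: lcs_quot_sel)
  then have "A \<otimes>\<^bsub>lcs_quot G ?n\<^esub> (B \<otimes>\<^bsub>lcs_quot G ?n\<^esub> C) = \<one>\<^bsub>lcs_quot G ?n\<^esub>"
    using ABC Q.inv_eq_1_iff by (meson Q.m_closed)
  then show ?thesis using c by (simp add: A_def B_def C_def cls_mult)
qed

end


section \<open>Lie rings and derivations of the free Lie ring\<close>

locale lie_ring = comm_group R for R :: "('a, 'm) lie_ring_scheme" (structure) +
  assumes bracket_closed [simp, intro]:
      "x \<in> carrier R \<Longrightarrow> y \<in> carrier R \<Longrightarrow> bracket R x y \<in> carrier R"
    and bracket_mult_left: "x \<in> carrier R \<Longrightarrow> y \<in> carrier R \<Longrightarrow> z \<in> carrier R \<Longrightarrow>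
      bracket R (x \<otimes> y) z = bracket R x z \<otimes> bracket R y z"
    and bracket_mult_right: "x \<in> carrier R \<Longrightarrow> y \<in> carrier R \<Longrightarrow> z \<in> carrier R \<Longrightarrow>
      bracket R x (y \<otimes> z) = bracket R x y \<otimes> bracket R x z"
    and bracket_self [simp]: "x \<in> carrier R \<Longrightarrow> bracket R x x = \<one>"
    and bracket_jacobi: "x \<in> carrier R \<Longrightarrow> y \<in> carrier R \<Longrightarrow> z \<in> carrier R \<Longrightarrow>
      bracket R x (bracket R y z) \<otimes> (bracket R y (bracket R z x) \<otimes> bracket R z (bracket R x y)) = \<one>"
begin

lemma bracket_one_left [simp]:
  assumes "x \<in> carrier R" shows "bracket R \<one> x = \<one>"
proof -
  have "bracket R \<one> x \<otimes> bracket R \<one> x = bracket R \<one> x"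
    using bracket_mult_left[of \<one> \<one> x] assms by simp
  then show ?thesis using assms by (metis bracket_closed one_closed r_cancel_one')
qed

lemma bracket_one_right [simp]:
  assumes "x \<in> carrier R" shows "bracket R x \<one> = \<one>"
proof -
  have "bracket R x \<one> \<otimes> bracket R x \<one> = bracket R x \<one>"
    using bracket_mult_right[of x \<one> \<one>] assms by simp
  then show ?thesis using assms by (metis bracket_closed one_closed r_cancel_one')
qed

lemma bracket_inv_left:
  assumes "x \<in> carrier R" "y \<in> carrier R" shows "bracket R (inv x) y = inv (bracket R x y)"
  using bracket_mult_left[of "inv x" x y] assms by (intro inv_equality[symmetric]) simp_all

lemma bracket_inv_right:
  assumes "x \<in> carrier R" "y \<in> carrier R" shows "bracket R x (inv y) = inv (bracket R x y)"
  using bracket_mult_right[of x "inv y" y] assms by (intro inv_equality[symmetric]) simp_all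

lemma bracket_swap:
  assumes "x \<in> carrier R" "y \<in> carrier R" shows "bracket R y x = inv (bracket R x y)"
proof -
  have "bracket R (x \<otimes> y) (x \<otimes> y) = bracket R y x \<otimes> bracket R x y"
    using assms by (simp add: bracket_mult_left bracket_mult_right del: bracket_self)
      (simp add: m_comm)
  then show ?thesis using assms by (intro inv_equality[symmetric]) simp_all
qed

end

lemma lie_terms_iff [simp]:
  "LGen x \<in> lie_terms A \<longleftrightarrow> x \<in> carrier A" "LZero \<in> lie_terms A"
  "LNeg t \<in> lie_terms A \<longleftrightarrow> t \<in> lie_terms A"
  "LAdd s t \<in> lie_terms A \<longleftrightarrow> s \<in> lie_terms A \<and> t \<in> lie_terms A"
  "LBr s t \<in> lie_terms A \<longleftrightarrow> s \<in> lie_terms A \<and> t \<in> lie_terms A"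
  by (auto simp: lie_terms_def)

context lie_ring
begin

lemma lie_eval_closed [simp, intro]:
  assumes "\<phi> \<in> carrier A \<rightarrow> carrier R"
  shows "t \<in> lie_terms A \<Longrightarrow> lie_eval R \<phi> t \<in> carrier R"
  using assms by (induction t) auto

lemma lie_eval_respects:
  assumes \<phi>: "\<phi> \<in> hom A R"
  shows "lie_eq A s t \<Longrightarrow> lie_eval R \<phi> s = lie_eval R \<phi> t"
proof -
  have c: "\<phi> \<in> carrier A \<rightarrow> carrier R" using \<phi> by (auto simp: hom_def)
  show "lie_eq A s t \<Longrightarrow> lie_eval R \<phi> s = lie_eval R \<phi> t"
proof (induction rule: lie_eq.induct)
  case (gen x y)
  then show ?case using \<phi> by (simp add: hom_mult)
next
  case (add_comm s t)
  then show ?case using c by (simp add: m_comm)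
next
  case (jacobi s t u)
  then show ?case using c by (simp add: bracket_jacobi)
qed (use c in \<open>simp_all add: m_assoc bracket_mult_left bracket_mult_right\<close>)
qed

end

section \<open>The free Lie ring on an abelian group and its universal property\<close>

locale free_lie_ring = A: comm_group A for A :: "('a, 'm) monoid_scheme" (structure)
begin

definition L where "L = free_lie A"
abbreviation lc where "lc t \<equiv> lie_rel A `` {t}"

lemma carrier_L: "carrier L = lc ` lie_terms A"
  by (auto simp: L_def free_lie_def quotient_def)

lemma lc_in_L [simp, intro]: "t \<in> lie_terms A \<Longrightarrow> lc t \<in> carrier L"
  by (simp add: carrier_L)

lemma L_cases: assumes "X \<in> carrier L" obtains t where "t \<in> lie_terms A" "X = lc t"
  using assms by (auto simp: carrier_L)

lemma lc_eqI: assumes "lie_eq A s t" shows "lc s = lc t"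
  using equiv_class_eq[OF equiv_lie_rel[OF A.is_monoid]] assms by (simp add: lie_rel_def)

lemma lc_binop:
  assumes "\<And>s s' t t'. lie_eq A s s' \<Longrightarrow> lie_eq A t t' \<Longrightarrow> lie_eq A (F s t) (F s' t')"
    and "s \<in> lie_terms A" "t \<in> lie_terms A"
  shows "(\<Union>s'\<in>lc s. \<Union>t'\<in>lc t. lc (F s' t')) = lc (F s t)"
proof -
  have "lc (F s' t') = lc (F s t)" if "s' \<in> lc s" "t' \<in> lc t" for s' t'
    using that by (intro lc_eqI[symmetric] assms(1)) (auto simp: lie_rel_def)
  moreover have "s \<in> lc s" "t \<in> lc t" using assms by (auto simp: lie_rel_def intro: lie_eq.refl)
  ultimately show ?thesis by blast
qed

lemma L_add: "s \<in> lie_terms A \<Longrightarrow> t \<in> lie_terms A \<Longrightarrow> lc s \<otimes>\<^bsub>L\<^esub> lc t = lc (LAdd s t)"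
  unfolding L_def free_lie_def by (simp add: lc_binop lie_eq.cong_add)

lemma L_bracket: "s \<in> lie_terms A \<Longrightarrow> t \<in> lie_terms A \<Longrightarrow> bracket L (lc s) (lc t) = lc (LBr s t)"
  unfolding L_def free_lie_def by (simp add: lc_binop lie_eq.cong_br)

lemma L_one: "\<one>\<^bsub>L\<^esub> = lc LZero"
  by (simp add: L_def free_lie_def)

lemma comm_group_L: "comm_group L"
proof (rule comm_groupI)
  fix X Y Z assume "X \<in> carrier L" "Y \<in> carrier L" "Z \<in> carrier L"
  then obtain s t u where "s \<in> lie_terms A" "X = lc s" "t \<in> lie_terms A" "Y = lc t"
    "u \<in> lie_terms A" "Z = lc u" by (metis L_cases)
  then show "X \<otimes>\<^bsub>L\<^esub> Y \<otimes>\<^bsub>L\<^esub> Z = X \<otimes>\<^bsub>L\<^esub> (Y \<otimes>\<^bsub>L\<^esub> Z)"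
    by (auto simp: L_add intro!: lc_eqI lie_eq.add_assoc)
next
  fix X Y assume "X \<in> carrier L" "Y \<in> carrier L"
  then obtain s t where "s \<in> lie_terms A" "X = lc s" "t \<in> lie_terms A" "Y = lc t" by (metis L_cases)
  then show "X \<otimes>\<^bsub>L\<^esub> Y \<in> carrier L" "X \<otimes>\<^bsub>L\<^esub> Y = Y \<otimes>\<^bsub>L\<^esub> X"
    by (auto simp: L_add intro!: lc_eqI lie_eq.add_comm)
next
  fix X assume "X \<in> carrier L"
  then obtain t where t: "t \<in> lie_terms A" "X = lc t" by (metis L_cases)
  then show "\<one>\<^bsub>L\<^esub> \<otimes>\<^bsub>L\<^esub> X = X"
    by (auto simp: L_add L_one intro!: lc_eqI lie_eq.add_zero)
  show "\<exists>Y\<in>carrier L. Y \<otimes>\<^bsub>L\<^esub> X = \<one>\<^bsub>L\<^esub>"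
    using t by (intro bexI[of _ "lc (LNeg t)"]) (auto simp: L_add L_one intro!: lc_eqI lie_eq.add_neg)
next
  show "\<one>\<^bsub>L\<^esub> \<in> carrier L" unfolding L_one by (rule lc_in_L) simp
qed

sublocale L: lie_ring L
proof -
  interpret L: comm_group L by (rule comm_group_L)
  show "lie_ring L"
  proof
    fix X Y Z assume "X \<in> carrier L" "Y \<in> carrier L" "Z \<in> carrier L"
    then obtain s t u where "s \<in> lie_terms A" "X = lc s" "t \<in> lie_terms A" "Y = lc t"
      "u \<in> lie_terms A" "Z = lc u" by (metis L_cases)
    then show "bracket L (X \<otimes>\<^bsub>L\<^esub> Y) Z = bracket L X Z \<otimes>\<^bsub>L\<^esub> bracket L Y Z"
      "bracket L X (Y \<otimes>\<^bsub>L\<^esub> Z) = bracket L X Y \<otimes>\<^bsub>L\<^esub> bracket L X Z"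
      "bracket L X (bracket L Y Z) \<otimes>\<^bsub>L\<^esub> (bracket L Y (bracket L Z X) \<otimes>\<^bsub>L\<^esub> bracket L Z (bracket L X Y)) = \<one>\<^bsub>L\<^esub>"
      by (auto simp: L_add L_bracket L_one intro!: lc_eqI lie_eq.br_add_left lie_eq.br_add_right lie_eq.jacobi)
  next
    fix X Y assume "X \<in> carrier L" "Y \<in> carrier L"
    then show "bracket L X Y \<in> carrier L" by (metis L_cases L_bracket lc_in_L lie_terms_iff(5))
  next
    fix X assume "X \<in> carrier L"
    then show "bracket L X X = \<one>\<^bsub>L\<^esub>" by (metis L_cases L_bracket L_one lc_eqI lie_eq.br_alt)
  qed
qed

lemma L_inv: "t \<in> lie_terms A \<Longrightarrow> inv\<^bsub>L\<^esub> (lc t) = lc (LNeg t)"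
  by (rule L.inv_equality) (auto simp: L_add L_one intro!: lc_eqI lie_eq.add_neg)

abbreviation "Ldeg \<equiv> free_lie_degree A"

lemma Ldeg_lc: "t \<in> lie_terms A \<Longrightarrow> homogeneous k t \<Longrightarrow> lc t \<in> Ldeg k"
  unfolding free_lie_degree_def by (intro CollectI exI[of _ t]) simp

lemma Ldeg_cases:
  assumes "X \<in> Ldeg k" obtains t where "t \<in> lie_terms A" "homogeneous k t" "X = lc t"
  using assms unfolding free_lie_degree_def by (elim CollectE exE conjE) (rule that)

lemma Ldeg_closed: "X \<in> Ldeg k \<Longrightarrow> X \<in> carrier L"
  by (erule Ldeg_cases) simp

lemma Ldeg_one: "\<one>\<^bsub>L\<^esub> \<in> Ldeg k"
  unfolding L_one by (intro Ldeg_lc homogeneous.intros) simp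

lemma Ldeg_inv: "X \<in> Ldeg k \<Longrightarrow> inv\<^bsub>L\<^esub> X \<in> Ldeg k"
  by (erule Ldeg_cases) (simp add: L_inv Ldeg_lc homogeneous.intros)

lemma Ldeg_mult: "X \<in> Ldeg k \<Longrightarrow> Y \<in> Ldeg k \<Longrightarrow> X \<otimes>\<^bsub>L\<^esub> Y \<in> Ldeg k"
  by (erule Ldeg_cases, erule Ldeg_cases) (simp add: L_add Ldeg_lc homogeneous.intros)

lemma Ldeg_bracket: "X \<in> Ldeg i \<Longrightarrow> Y \<in> Ldeg j \<Longrightarrow> bracket L X Y \<in> Ldeg (i + j)"
  by (erule Ldeg_cases, erule Ldeg_cases) (simp add: L_bracket Ldeg_lc homogeneous.intros)

abbreviation gen where "gen \<equiv> free_lie_gen A"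

lemma gen_hom: "gen \<in> hom A L"
  by (auto simp: hom_def free_lie_gen_def L_add intro!: lc_eqI lie_eq.gen)

lemma gen_closed [simp, intro]: "x \<in> carrier A \<Longrightarrow> gen x \<in> carrier L"
  using gen_hom by (auto simp: hom_def)

lemma free_lie_lift_lc:
  assumes "lie_ring R" "\<phi> \<in> hom A R" "t \<in> lie_terms A"
  shows "free_lie_lift R \<phi> (lc t) = lie_eval R \<phi> t"
proof -
  have "lie_eval R \<phi> s = lie_eval R \<phi> t" if "s \<in> lc t" for s
    using lie_ring.lie_eval_respects[OF assms(1,2), of t s] that by (simp add: lie_rel_def)
  moreover have "t \<in> lc t" using lie_eq.refl[OF assms(3)] by (simp add: lie_rel_def)
  ultimately have "lie_eval R \<phi> ` lc t = {lie_eval R \<phi> t}" by blast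
  then show ?thesis by (simp add: free_lie_lift_def)
qed

lemma
  assumes R: "lie_ring R" and \<phi>: "\<phi> \<in> hom A R"
  shows free_lie_lift_gen: "x \<in> carrier A \<Longrightarrow> free_lie_lift R \<phi> (gen x) = \<phi> x"
    and free_lie_lift_hom: "free_lie_lift R \<phi> \<in> hom L R"
    and free_lie_lift_bracket: "X \<in> carrier L \<Longrightarrow> Y \<in> carrier L \<Longrightarrow>
      free_lie_lift R \<phi> (bracket L X Y) = bracket R (free_lie_lift R \<phi> X) (free_lie_lift R \<phi> Y)"
proof -
  interpret R: lie_ring R by fact
  have c: "\<phi> \<in> carrier A \<rightarrow> carrier R" using \<phi> by (auto simp: hom_def)
  note l = free_lie_lift_lc[OF R \<phi>]
  show "free_lie_lift R \<phi> (gen x) = \<phi> x" if "x \<in> carrier A"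
    using that by (simp add: free_lie_gen_def l)
  show "free_lie_lift R \<phi> \<in> hom L R"
    using R.lie_eval_closed[OF c] by (auto simp: hom_def carrier_L L_add l)
  show "free_lie_lift R \<phi> (bracket L X Y) = bracket R (free_lie_lift R \<phi> X) (free_lie_lift R \<phi> Y)"
    if "X \<in> carrier L" "Y \<in> carrier L"
    using that by (auto simp: carrier_L L_bracket l)
qed

end

text \<open>The Lie ring \<open>R[\<epsilon>]/(\<epsilon>\<^sup>2)\<close>: Lie ring morphisms \<open>x \<mapsto> (x, d x)\<close> into it are the same as derivations.\<close>

definition lie_dual :: "('a, 'm) lie_ring_scheme \<Rightarrow> ('a \<times> 'a) lie_ring" where
  "lie_dual R = \<lparr>carrier = carrier R \<times> carrier R,
     monoid.mult = (\<lambda>(a, b) (c, d). (a \<otimes>\<^bsub>R\<^esub> c, b \<otimes>\<^bsub>R\<^esub> d)),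
     one = (\<one>\<^bsub>R\<^esub>, \<one>\<^bsub>R\<^esub>),
     bracket = (\<lambda>(a, b) (c, d). (bracket R a c, bracket R b c \<otimes>\<^bsub>R\<^esub> bracket R a d))\<rparr>"

lemma (in lie_ring) lie_dual: "lie_ring (lie_dual R)"
proof -
  interpret D: comm_group "lie_dual R"
    by (rule comm_groupI) (auto simp: lie_dual_def m_ac intro: l_inv_ex)
  show ?thesis
  proof
    fix p q r assume "p \<in> carrier (lie_dual R)" "q \<in> carrier (lie_dual R)" "r \<in> carrier (lie_dual R)"
    then obtain x x' y y' z z' where c [simp]: "x \<in> carrier R" "y \<in> carrier R" "z \<in> carrier R"
      "x' \<in> carrier R" "y' \<in> carrier R" "z' \<in> carrier R" and p: "p = (x, x')" "q = (y, y')" "r = (z, z')"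
      by (auto simp: lie_dual_def)
    \<comment> \<open>The \<epsilon>-part of the Jacobi sum is the sum of three Jacobi identities of
      \<open>R\<close>, each with one argument primed.\<close>
    have "(bracket R x' (bracket R y z) \<otimes> (bracket R y (bracket R z x') \<otimes> bracket R z (bracket R x' y))) \<otimes>
       ((bracket R x (bracket R y' z) \<otimes> (bracket R y' (bracket R z x) \<otimes> bracket R z (bracket R x y'))) \<otimes>
       (bracket R x (bracket R y z') \<otimes> (bracket R y (bracket R z' x) \<otimes> bracket R z' (bracket R x y)))) = \<one>"
      by (simp add: bracket_jacobi)
    then have "bracket R x' (bracket R y z) \<otimes> (bracket R x (bracket R y' z) \<otimes> bracket R x (bracket R y z')) \<otimes>
      (bracket R y' (bracket R z x) \<otimes> (bracket R y (bracket R z' x) \<otimes> bracket R y (bracket R z x')) \<otimes>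
       (bracket R z' (bracket R x y) \<otimes> (bracket R z (bracket R x' y) \<otimes> bracket R z (bracket R x y')))) = \<one>"
      by (simp add: m_ac)
    then show "bracket (lie_dual R) p (bracket (lie_dual R) q r) \<otimes>\<^bsub>lie_dual R\<^esub>
       (bracket (lie_dual R) q (bracket (lie_dual R) r p) \<otimes>\<^bsub>lie_dual R\<^esub>
        bracket (lie_dual R) r (bracket (lie_dual R) p q)) = \<one>\<^bsub>lie_dual R\<^esub>"
      by (simp add: p lie_dual_def bracket_jacobi bracket_mult_right)
  next
    fix p assume "p \<in> carrier (lie_dual R)"
    then obtain x x' where "x \<in> carrier R" "x' \<in> carrier R" "p = (x, x')" by (auto simp: lie_dual_def)
    then show "bracket (lie_dual R) p p = \<one>\<^bsub>lie_dual R\<^esub>"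
      by (simp add: lie_dual_def bracket_swap[of x x'])
  next
    fix p q r assume "p \<in> carrier (lie_dual R)" "q \<in> carrier (lie_dual R)" "r \<in> carrier (lie_dual R)"
    then obtain x x' y y' z z' where "x \<in> carrier R" "y \<in> carrier R" "z \<in> carrier R"
      "x' \<in> carrier R" "y' \<in> carrier R" "z' \<in> carrier R" and "p = (x, x')" "q = (y, y')" "r = (z, z')"
      by (auto simp: lie_dual_def)
    then show "bracket (lie_dual R) (p \<otimes>\<^bsub>lie_dual R\<^esub> q) r = bracket (lie_dual R) p r \<otimes>\<^bsub>lie_dual R\<^esub> bracket (lie_dual R) q r"
      "bracket (lie_dual R) p (q \<otimes>\<^bsub>lie_dual R\<^esub> r) = bracket (lie_dual R) p q \<otimes>\<^bsub>lie_dual R\<^esub> bracket (lie_dual R) p r"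
      by (simp_all add: lie_dual_def bracket_mult_left bracket_mult_right m_ac)
  next
    fix p q assume "p \<in> carrier (lie_dual R)" "q \<in> carrier (lie_dual R)"
    then obtain x x' y y' where "x \<in> carrier R" "y \<in> carrier R"
      "x' \<in> carrier R" "y' \<in> carrier R" and "p = (x, x')" "q = (y, y')"
      by (auto simp: lie_dual_def)
    then show "bracket (lie_dual R) p q \<in> carrier (lie_dual R)" by (simp add: lie_dual_def)
  qed
qed

context free_lie_ring
begin

lemma exists_derivation:
  assumes v: "v \<in> hom A L" and vdeg: "\<And>x. x \<in> carrier A \<Longrightarrow> v x \<in> free_lie_degree A (Suc k)"
  obtains d where "d \<in> carrier (free_lie_derivations A k)" "\<And>x. x \<in> carrier A \<Longrightarrow> d (gen x) = v x"
proof -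
  let ?D = "lie_dual L" and ?f = "\<lambda>x. (gen x, v x)"
  interpret D: lie_ring ?D by (rule L.lie_dual)
  have f: "?f \<in> hom A ?D" using v gen_hom by (auto simp: hom_def lie_dual_def)
  note lift = free_lie_lift_gen[OF D.lie_ring_axioms f] free_lie_lift_hom[OF D.lie_ring_axioms f]
    free_lie_lift_bracket[OF D.lie_ring_axioms f]
  let ?F = "free_lie_lift ?D ?f"
  have lc: "?F (lc t) = lie_eval ?D ?f t" if "t \<in> lie_terms A" for t
    by (rule free_lie_lift_lc[OF D.lie_ring_axioms f that])
  have closed: "lie_eval ?D ?f t \<in> carrier ?D" if "t \<in> lie_terms A" for t
    using f that by (intro D.lie_eval_closed) (auto simp: hom_def)
  have inv_D: "inv\<^bsub>?D\<^esub> (x, y) = (inv\<^bsub>L\<^esub> x, inv\<^bsub>L\<^esub> y)" if "x \<in> carrier L" "y \<in> carrier L" for x y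
    using that by (intro D.inv_equality) (auto simp: lie_dual_def)
  \<comment> \<open>The first component of the lift is the identity, so its second component is the
    sought map on \<open>L\<close>. This is checked on terms because the elements of
    \<open>L\<close> are classes of terms.\<close>
  have ex: "\<exists>y\<in>carrier L. lie_eval ?D ?f t = (lc t, y)" if "t \<in> lie_terms A" for t
    using that
  proof (induction t)
    case (LGen x)
    then show ?case using v by (auto simp: free_lie_gen_def hom_def)
  next
    case LZero
    show ?case by (auto simp: lie_dual_def L_one)
  next
    case (LNeg t)
    then show ?case by (auto simp: inv_D L_inv)
  next
    case (LAdd s t)
    then show ?case by (auto simp: lie_dual_def L_add)
  next
    case (LBr s t)
    then show ?case by (auto simp: lie_dual_def L_bracket)
  qed
  have fstF: "fst (?F X) = X" "snd (?F X) \<in> carrier L" if "X \<in> carrier L" for X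
    using that ex lc by (fastforce elim!: L_cases)+
  have FX: "?F X = (X, snd (?F X))" if "X \<in> carrier L" for X
    using fstF(1)[OF that] by (metis prod.collapse)
  define d where "d = (\<lambda>X\<in>carrier L. snd (?F X))"
  have add: "d (X \<otimes>\<^bsub>L\<^esub> Y) = d X \<otimes>\<^bsub>L\<^esub> d Y" if "X \<in> carrier L" "Y \<in> carrier L" for X Y
  proof -
    have "?F (X \<otimes>\<^bsub>L\<^esub> Y) = (X, snd (?F X)) \<otimes>\<^bsub>?D\<^esub> (Y, snd (?F Y))"
      using lift(2) that FX by (metis (no_types, lifting) hom_mult)
    then show ?thesis using that by (simp add: d_def lie_dual_def)
  qed
  have br: "d (bracket L X Y) = bracket L (d X) Y \<otimes>\<^bsub>L\<^esub> bracket L X (d Y)"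
    if "X \<in> carrier L" "Y \<in> carrier L" for X Y
  proof -
    have "?F (bracket L X Y) = bracket ?D (X, snd (?F X)) (Y, snd (?F Y))"
      unfolding FX[OF that(1), symmetric] FX[OF that(2), symmetric] by (rule lift(3)[OF that])
    then show ?thesis using that by (simp add: d_def lie_dual_def)
  qed
  have dgen: "d (gen x) = v x" if "x \<in> carrier A" for x
    using lift(1) that by (simp add: d_def)
  have dmem: "d X \<in> carrier L" if "X \<in> carrier L" for X using that fstF(2) by (simp add: d_def)
  have dzero: "d \<one>\<^bsub>L\<^esub> = \<one>\<^bsub>L\<^esub>"
    by (metis add dmem L.l_one L.one_closed L.r_cancel_one')
  have dinv: "d (inv\<^bsub>L\<^esub> X) = inv\<^bsub>L\<^esub> (d X)" if "X \<in> carrier L" for X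
    using add[of "inv\<^bsub>L\<^esub> X" X] that dmem dzero by (intro L.inv_equality[symmetric]) simp_all
  have deg: "homogeneous m t \<Longrightarrow> t \<in> lie_terms A \<Longrightarrow> d (lc t) \<in> Ldeg (m + k)" for m t
  proof (induction rule: homogeneous.induct)
    case (1 x)
    then show ?case using vdeg[of x] dgen[of x] by (simp add: free_lie_gen_def)
  next
    case (2 m)
    then show ?case using dzero Ldeg_one by (simp add: L_one)
  next
    case (3 m t)
    then show ?case using dinv[of "lc t"] by (simp add: L_inv Ldeg_inv)
  next
    case (4 m s t)
    then show ?case using add[of "lc s" "lc t"] by (simp add: L_add Ldeg_mult)
  next
    case (5 i s j t)
    then have "d (lc s) \<in> Ldeg (i + k)" "d (lc t) \<in> Ldeg (j + k)" "lc s \<in> Ldeg i" "lc t \<in> Ldeg j"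
      by (simp_all add: Ldeg_lc)
    then have "bracket L (d (lc s)) (lc t) \<in> Ldeg (i + k + j)" "bracket L (lc s) (d (lc t)) \<in> Ldeg (i + (j + k))"
      by (simp_all only: Ldeg_bracket)
    then have "bracket L (d (lc s)) (lc t) \<otimes>\<^bsub>L\<^esub> bracket L (lc s) (d (lc t)) \<in> Ldeg (i + j + k)"
      by (intro Ldeg_mult) (simp_all only: ac_simps)
    then show ?case using 5 br[of "lc s" "lc t"] by (simp add: L_bracket)
  qed
  have "d ` Ldeg m \<subseteq> Ldeg (m + k)" for m
    by (rule image_subsetI) (erule Ldeg_cases, simp add: deg)
  moreover have "d \<in> carrier L \<rightarrow>\<^sub>E carrier L" using dmem by (auto simp: d_def)
  ultimately have "d \<in> carrier (free_lie_derivations A k)"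
    using add br by (simp add: free_lie_derivations_def Let_def L_def[symmetric])
  then show thesis using dgen by (rule that)
qed

end


section \<open>The direct sum of the lower central quotients as a Lie ring\<close>

context group
begin

abbreviation "lb \<equiv> lcs_bracket G"
abbreviation "Q \<equiv> lcs_quot G"
abbreviation "S \<equiv> lcs_graded G"

lemma Q_cases: assumes "X \<in> carrier (Q k)" obtains x where "x \<in> lcs G k" "X = cls k x"
  using assms by (auto simp: carrier_lcs_quot)

lemma lb_closed: "U \<in> carrier (Q i) \<Longrightarrow> V \<in> carrier (Q j) \<Longrightarrow> i \<ge> 1 \<Longrightarrow> j \<ge> 1 \<Longrightarrow> lb i j U V \<in> carrier (Q (i + j))"
  by (elim Q_cases) (simp add: lcs_bracket_cls commutator_in_lcs cls_in_lcs_quot)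

lemma lb_mult_left:
  "U \<in> carrier (Q i) \<Longrightarrow> U' \<in> carrier (Q i) \<Longrightarrow> V \<in> carrier (Q j) \<Longrightarrow> i \<ge> 1 \<Longrightarrow> j \<ge> 1 \<Longrightarrow>
     lb i j (U <#> U') V = lb i j U V <#> lb i j U' V"
  by (elim Q_cases) (simp add: lcs_bracket_cls cls_mult cls_commutator_mult_left)

lemma lb_mult_right:
  "U \<in> carrier (Q i) \<Longrightarrow> V \<in> carrier (Q j) \<Longrightarrow> V' \<in> carrier (Q j) \<Longrightarrow> i \<ge> 1 \<Longrightarrow> j \<ge> 1 \<Longrightarrow>
     lb i j U (V <#> V') = lb i j U V <#> lb i j U V'"
  by (elim Q_cases) (simp add: lcs_bracket_cls cls_mult cls_commutator_mult_right)

lemma lb_one_left: "V \<in> carrier (Q j) \<Longrightarrow> i \<ge> 1 \<Longrightarrow> j \<ge> 1 \<Longrightarrow> lb i j (lcs G (Suc i)) V = lcs G (Suc (i + j))"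
  using lcs_bracket_cls[of \<one> i _ j] by (elim Q_cases) (simp add: cls_one)

lemma lb_one_right: "U \<in> carrier (Q i) \<Longrightarrow> i \<ge> 1 \<Longrightarrow> j \<ge> 1 \<Longrightarrow> lb i j U (lcs G (Suc j)) = lcs G (Suc (i + j))"
  using lcs_bracket_cls[of _ i \<one> j] by (elim Q_cases) (simp add: cls_one)

lemma lcs_graded_carrier:
  "carrier S = {u \<in> \<Pi>\<^sub>E k\<in>{1..}. carrier (Q k). finite {k \<in> {1..}. u k \<noteq> lcs G (Suc k)}}"
  using carrier_sum_group[of "{1..}" Q] group_lcs_quot by (simp add: lcs_graded_def Let_def)

lemma lcs_graded_one: "\<one>\<^bsub>S\<^esub> = (\<lambda>k\<in>{1..}. lcs G (Suc k))"
  by (simp add: lcs_graded_def Let_def)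

lemma lcs_graded_mult: "u \<otimes>\<^bsub>S\<^esub> v = (\<lambda>k\<in>{1..}. u k <#> v k)"
  by (simp add: lcs_graded_def Let_def)

lemma lcs_graded_bracket:
  "bracket S u v = (\<lambda>k\<in>{1..}. finprod (Q k) (\<lambda>i. lb i (k - i) (u i) (v (k - i))) {1..<k})"
  by (simp add: lcs_graded_def Let_def)

lemma lcs_graded_comp: "u \<in> carrier S \<Longrightarrow> k \<ge> 1 \<Longrightarrow> u k \<in> carrier (Q k)"
  by (auto simp: lcs_graded_carrier)

lemma lcs_graded_eqI:
  "u \<in> carrier S \<Longrightarrow> v \<in> carrier S \<Longrightarrow> (\<And>k. k \<ge> 1 \<Longrightarrow> u k = v k) \<Longrightarrow> u = v"
  unfolding lcs_graded_carrier by (intro PiE_ext[of u "{1..}" _ v]) auto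

lemma comm_group_lcs_graded: "comm_group S"
proof -
  have g: "group (sum_group {1..} Q)" using group_lcs_quot by simp
  have eqs: "carrier S = carrier (sum_group {1..} Q)" "monoid.mult S = monoid.mult (sum_group {1..} Q)"
    "one S = one (sum_group {1..} Q)" by (simp_all add: lcs_graded_def Let_def)
  have "group S"
    by (rule groupI) (unfold eqs, use g in \<open>auto simp del: mult_sum_group one_sum_group simp: group.is_monoid monoid.m_closed monoid.one_closed
        monoid.m_assoc monoid.l_one intro: group.l_inv_ex\<close>)
  then show ?thesis
  proof (rule group.group_comm_groupI)
    fix u v assume uv: "u \<in> carrier S" "v \<in> carrier S"
    have "u k <#> v k = v k <#> u k" if "k \<ge> 1" for k
      using comm_groupE(4)[OF comm_group_lcs_quot[OF that]] uv[THEN lcs_graded_comp] that by simp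
    then show "u \<otimes>\<^bsub>S\<^esub> v = v \<otimes>\<^bsub>S\<^esub> u" unfolding lcs_graded_mult by (intro restrict_ext) simp
  qed
qed

lemma lb_comp_closed:
  assumes "u \<in> carrier S" "v \<in> carrier S"
  shows "(\<lambda>i. lb i (k - i) (u i) (v (k - i))) \<in> {1..<k} \<rightarrow> carrier (Q k)"
proof
  fix i assume "i \<in> {1..<k}"
  moreover from this have "k - i \<ge> 1" by auto
  ultimately show "lb i (k - i) (u i) (v (k - i)) \<in> carrier (Q k)"
    using lb_closed[of "u i" i "v (k - i)" "k - i"] assms lcs_graded_comp by simp
qed

lemma lcs_graded_bracket_closed:
  assumes "u \<in> carrier S" "v \<in> carrier S"
  shows "bracket S u v \<in> carrier S"
proof -
  define A where "A = {i \<in> {1..}. u i \<noteq> lcs G (Suc i)}"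
  define B where "B = {i \<in> {1..}. v i \<noteq> lcs G (Suc i)}"
  have fin: "finite A" "finite B" using assms by (auto simp: lcs_graded_carrier A_def B_def)
  have "bracket S u v k = lcs G (Suc k)" if k: "k \<ge> 1" "k \<notin> (\<lambda>(i, j). i + j) ` (A \<times> B)" for k
  proof -
    interpret Qk: comm_group "Q k" by (rule comm_group_lcs_quot[OF k(1)])
    have "lb i (k - i) (u i) (v (k - i)) = \<one>\<^bsub>Q k\<^esub>" if i: "i \<in> {1..<k}" for i
    proof -
      have ki: "k - i \<ge> 1" using i by auto
      show ?thesis
    proof (cases "i \<in> A")
      case True
      then have "k - i \<notin> B" using k(2) i by (force simp: image_iff)
      then have "v (k - i) = lcs G (Suc (k - i))" using i ki by (simp add: B_def)
      then show ?thesis using i lb_one_right[of "u i" i "k - i"] lcs_graded_comp[OF assms(1)] ki by simp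
    next
      case False
      then have "u i = lcs G (Suc i)" using i by (simp add: A_def)
      then show ?thesis using i lb_one_left[of "v (k - i)" "k - i" i] lcs_graded_comp[OF assms(2)] ki by simp
    qed
    qed
    then have "finprod (Q k) (\<lambda>i. lb i (k - i) (u i) (v (k - i))) {1..<k} = \<one>\<^bsub>Q k\<^esub>"
      by (intro Qk.finprod_one_eqI)
    then show ?thesis using k by (simp add: lcs_graded_bracket)
  qed
  then have "{k \<in> {1..}. bracket S u v k \<noteq> lcs G (Suc k)} \<subseteq> (\<lambda>(i, j). i + j) ` (A \<times> B)" by force
  then have "finite {k \<in> {1..}. bracket S u v k \<noteq> lcs G (Suc k)}"
    by (rule finite_subset) (use fin in simp)
  moreover have "bracket S u v \<in> (\<Pi>\<^sub>E k\<in>{1..}. carrier (Q k))"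
    unfolding lcs_graded_bracket
    using comm_monoid.finprod_closed[OF comm_group.axioms(1)[OF comm_group_lcs_quot] lb_comp_closed[OF assms]]
    by auto
  ultimately show ?thesis by (simp add: lcs_graded_carrier)
qed

lemma lcs_graded_bracket_mult_left:
  assumes "u \<in> carrier S" "v \<in> carrier S" "w \<in> carrier S"
  shows "bracket S (u \<otimes>\<^bsub>S\<^esub> v) w = bracket S u w \<otimes>\<^bsub>S\<^esub> bracket S v w"
proof -
  have "finprod (Q k) (\<lambda>i. lb i (k - i) ((u \<otimes>\<^bsub>S\<^esub> v) i) (w (k - i))) {1..<k} =
    finprod (Q k) (\<lambda>i. lb i (k - i) (u i) (w (k - i))) {1..<k} \<otimes>\<^bsub>Q k\<^esub>
    finprod (Q k) (\<lambda>i. lb i (k - i) (v i) (w (k - i))) {1..<k}" if "k \<ge> 1" for k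
  proof -
    interpret Qk: comm_group "Q k" by (rule comm_group_lcs_quot[OF that])
    show ?thesis
      unfolding Qk.finprod_multf[OF lb_comp_closed[OF assms(1,3)] lb_comp_closed[OF assms(2,3)], symmetric]
    proof (rule Qk.finprod_cong'[OF HOL.refl])
      show "(\<lambda>i. lb i (k - i) (u i) (w (k - i)) \<otimes>\<^bsub>Q k\<^esub> lb i (k - i) (v i) (w (k - i))) \<in> {1..<k} \<rightarrow> carrier (Q k)"
        using lb_comp_closed[OF assms(1,3)] lb_comp_closed[OF assms(2,3)] by (blast intro: Qk.m_closed)
    next
      fix i assume "i \<in> {1..<k}"
      moreover from this have "k - i \<ge> 1" by auto
      ultimately show "lb i (k - i) ((u \<otimes>\<^bsub>S\<^esub> v) i) (w (k - i)) =
          lb i (k - i) (u i) (w (k - i)) \<otimes>\<^bsub>Q k\<^esub> lb i (k - i) (v i) (w (k - i))"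
        using lb_mult_left[of "u i" i "v i" "w (k - i)" "k - i"] assms[THEN lcs_graded_comp]
        by (simp add: lcs_graded_mult)
    qed
  qed
  then show ?thesis unfolding lcs_graded_bracket lcs_graded_mult[of "restrict _ _"] by (intro restrict_ext) simp
qed

lemma lcs_graded_bracket_mult_right:
  assumes "u \<in> carrier S" "v \<in> carrier S" "w \<in> carrier S"
  shows "bracket S w (u \<otimes>\<^bsub>S\<^esub> v) = bracket S w u \<otimes>\<^bsub>S\<^esub> bracket S w v"
proof -
  have "finprod (Q k) (\<lambda>i. lb i (k - i) (w i) ((u \<otimes>\<^bsub>S\<^esub> v) (k - i))) {1..<k} =
    finprod (Q k) (\<lambda>i. lb i (k - i) (w i) (u (k - i))) {1..<k} \<otimes>\<^bsub>Q k\<^esub>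
    finprod (Q k) (\<lambda>i. lb i (k - i) (w i) (v (k - i))) {1..<k}" if "k \<ge> 1" for k
  proof -
    interpret Qk: comm_group "Q k" by (rule comm_group_lcs_quot[OF that])
    show ?thesis
      unfolding Qk.finprod_multf[OF lb_comp_closed[OF assms(3,1)] lb_comp_closed[OF assms(3,2)], symmetric]
    proof (rule Qk.finprod_cong'[OF HOL.refl])
      show "(\<lambda>i. lb i (k - i) (w i) (u (k - i)) \<otimes>\<^bsub>Q k\<^esub> lb i (k - i) (w i) (v (k - i))) \<in> {1..<k} \<rightarrow> carrier (Q k)"
        using lb_comp_closed[OF assms(3,1)] lb_comp_closed[OF assms(3,2)] by (blast intro: Qk.m_closed)
    next
      fix i assume "i \<in> {1..<k}"
      moreover from this have "k - i \<ge> 1" by auto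
      ultimately show "lb i (k - i) (w i) ((u \<otimes>\<^bsub>S\<^esub> v) (k - i)) =
          lb i (k - i) (w i) (u (k - i)) \<otimes>\<^bsub>Q k\<^esub> lb i (k - i) (w i) (v (k - i))"
        using lb_mult_right[of "w i" i "u (k - i)" "k - i" "v (k - i)"] assms[THEN lcs_graded_comp]
        by (simp add: lcs_graded_mult)
    qed
  qed
  then show ?thesis unfolding lcs_graded_bracket lcs_graded_mult[of "restrict _ _"] by (intro restrict_ext) simp
qed

text \<open>The homogeneous element of degree n with class x. Through it a congruence modulo
  \<Gamma>_(n+1) becomes an equation in the Lie ring \<open>S\<close>.\<close>

definition gr :: "nat \<Rightarrow> 'a \<Rightarrow> nat \<Rightarrow> 'a set" where
  "gr n x = (\<lambda>k\<in>{1..}. if k = n then cls n x else lcs G (Suc k))"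

lemma gr_closed [simp, intro]: "x \<in> lcs G n \<Longrightarrow> gr n x \<in> carrier S"
proof -
  assume x: "x \<in> lcs G n"
  have "{k \<in> {1..}. gr n x k \<noteq> lcs G (Suc k)} \<subseteq> {n}" by (auto simp: gr_def)
  then have "finite {k \<in> {1..}. gr n x k \<noteq> lcs G (Suc k)}" by (rule finite_subset) simp
  moreover have "gr n x \<in> (\<Pi>\<^sub>E k\<in>{1..}. carrier (Q k))"
    using x monoid.one_closed[OF group.is_monoid[OF group_lcs_quot]] by (auto simp: gr_def)
  ultimately show ?thesis by (simp add: lcs_graded_carrier)
qed

lemma gr_mult: "x \<in> lcs G n \<Longrightarrow> y \<in> lcs G n \<Longrightarrow> gr n x \<otimes>\<^bsub>S\<^esub> gr n y = gr n (x \<otimes> y)"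
  unfolding lcs_graded_mult using cls_mult[of \<one> \<one>]
  by (auto simp: gr_def cls_mult cls_one fun_eq_iff)

lemma gr_one: "gr n \<one> = \<one>\<^bsub>S\<^esub>"
  by (auto simp: gr_def lcs_graded_one cls_one fun_eq_iff)

lemma gr_inv: assumes "x \<in> lcs G n" shows "inv\<^bsub>S\<^esub> gr n x = gr n (inv x)"
proof -
  interpret S: comm_group S by (rule comm_group_lcs_graded)
  show ?thesis by (rule S.inv_equality) (use assms in \<open>simp_all add: gr_mult gr_one\<close>)
qed

lemma gr_bracket:
  assumes x: "x \<in> lcs G n" and y: "y \<in> lcs G m" and "n \<ge> 1" "m \<ge> 1"
  shows "bracket S (gr n x) (gr m y) = gr (n + m) (x \<lozenge> y)"
proof (rule lcs_graded_eqI)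
  show "bracket S (gr n x) (gr m y) \<in> carrier S"
    using x y by (intro lcs_graded_bracket_closed) auto
  show "gr (n + m) (x \<lozenge> y) \<in> carrier S" using assms by (simp add: commutator_in_lcs)
next
  fix k :: nat assume k: "k \<ge> 1"
  interpret Qk: comm_group "Q k" by (rule comm_group_lcs_quot[OF k])
  let ?f = "\<lambda>i. lb i (k - i) (gr n x i) (gr m y (k - i))"
  have one: "?f i = \<one>\<^bsub>Q k\<^esub>" if i: "i \<in> {1..<k}" "i \<noteq> n \<or> k - i \<noteq> m" for i
  proof (cases "i = n")
    case True
    moreover have "k - i \<ge> 1" using i by auto
    ultimately show ?thesis using i k lb_one_right[of "cls n x" i "k - i"] x by (simp add: gr_def cls_in_lcs_quot)
  next
    case False
    moreover have "k - i \<ge> 1" using i by auto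
    ultimately show ?thesis using i k lb_one_left[of "gr m y (k - i)" "k - i" i]
        lcs_graded_comp[OF gr_closed[OF y], of "k - i"] by (simp add: gr_def)
  qed
  show "bracket S (gr n x) (gr m y) k = gr (n + m) (x \<lozenge> y) k"
  proof (cases "k = n + m")
    case True
    have "finprod (Q k) ?f {1..<k} = finprod (Q k) ?f {n}"
      by (rule Qk.finprod_mono_neutral_cong_right)
        (use one lb_comp_closed[OF gr_closed[OF x] gr_closed[OF y], of k] assms True in auto)
    also have "\<dots> = ?f n"
    proof -
      have "?f n \<in> carrier (Q k)"
        using assms True by (intro funcset_mem[OF lb_comp_closed[OF gr_closed[OF x] gr_closed[OF y]]]) auto
      then show ?thesis using Qk.finprod_insert[of "{}" n ?f] by (simp del: lcs_quot_sel)
    qed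
    also have "\<dots> = cls (n + m) (x \<lozenge> y)"
      using assms True by (simp add: gr_def lcs_bracket_cls)
    finally show ?thesis using k True by (simp add: lcs_graded_bracket gr_def)
  next
    case False
    then have "finprod (Q k) ?f {1..<k} = \<one>\<^bsub>Q k\<^esub>"
      by (intro Qk.finprod_one_eqI one) auto
    then show ?thesis using k False by (simp add: lcs_graded_bracket gr_def)
  qed
qed

text \<open>Elements of the direct sum have finite support, so they are built by adding one
  homogeneous component at a time; multilinear identities then need only be checked on
  \<open>gr\<close>.\<close>

lemma lcs_graded_induct [consumes 1, case_names one mult]:
  assumes "u \<in> carrier S" "P \<one>\<^bsub>S\<^esub>"
    and step: "\<And>n x u. n \<ge> 1 \<Longrightarrow> x \<in> lcs G n \<Longrightarrow> u \<in> carrier S \<Longrightarrow> P u \<Longrightarrow> P (gr n x \<otimes>\<^bsub>S\<^esub> u)"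
  shows "P u"
proof -
  have "\<forall>u\<in>carrier S. {k \<in> {1..}. u k \<noteq> lcs G (Suc k)} \<subseteq> F \<longrightarrow> P u" if "finite F" for F
    using that
  proof (induction F)
    case empty
    have "u = \<one>\<^bsub>S\<^esub>" if "u \<in> carrier S" "{k \<in> {1..}. u k \<noteq> lcs G (Suc k)} = {}" for u
    proof (rule lcs_graded_eqI[OF that(1)])
      show "\<one>\<^bsub>S\<^esub> \<in> carrier S" using gr_closed[OF lcs_intros(1)] gr_one by metis
    qed (use that in \<open>auto simp: lcs_graded_one\<close>)
    then show ?case using assms(2) by blast
  next
    case (insert n F)
    show ?case
    proof (intro ballI impI)
      fix u assume u: "u \<in> carrier S" and sup: "{k \<in> {1..}. u k \<noteq> lcs G (Suc k)} \<subseteq> insert n F"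
      show "P u"
      proof (cases "n \<ge> 1")
        case False
        then have "{k \<in> {1..}. u k \<noteq> lcs G (Suc k)} \<subseteq> F" using sup by auto
        then show ?thesis using insert.IH u by blast
      next
        case True
        obtain x where x: "x \<in> lcs G n" "u n = cls n x"
          using lcs_graded_comp[OF u True] Q_cases by blast
        define u' where "u' = (\<lambda>k. if k = n then lcs G (Suc k) else u k)"
        have "finite {k \<in> {1..}. u k \<noteq> lcs G (Suc k)}" using u by (simp add: lcs_graded_carrier)
        moreover have "{k \<in> {1..}. u' k \<noteq> lcs G (Suc k)} \<subseteq> {k \<in> {1..}. u k \<noteq> lcs G (Suc k)}"
          by (auto simp: u'_def)
        ultimately have "finite {k \<in> {1..}. u' k \<noteq> lcs G (Suc k)}" by (rule rev_finite_subset)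
        moreover have "u' \<in> (\<Pi>\<^sub>E k\<in>{1..}. carrier (Q k))"
          using u True monoid.one_closed[OF group.is_monoid[OF group_lcs_quot]]
          by (auto simp: u'_def lcs_graded_carrier PiE_iff extensional_def)
        ultimately have u': "u' \<in> carrier S" by (simp add: lcs_graded_carrier)
        have "gr n x \<otimes>\<^bsub>S\<^esub> u' = u"
        proof (rule lcs_graded_eqI[OF _ u])
          show "gr n x \<otimes>\<^bsub>S\<^esub> u' \<in> carrier S"
            using comm_group.axioms(2)[OF comm_group_lcs_graded] u' x gr_closed
            by (simp add: group.is_monoid monoid.m_closed)
          fix k :: nat assume k: "k \<ge> 1"
          obtain y where "y \<in> lcs G k" "u k = cls k y" using lcs_graded_comp[OF u k] Q_cases by blast
          then show "(gr n x \<otimes>\<^bsub>S\<^esub> u') k = u k"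
            using k x cls_mult[of x \<one> "Suc n"] cls_mult[of \<one> y "Suc k"]
            by (auto simp: lcs_graded_mult gr_def u'_def cls_one)
        qed
        moreover have "{k \<in> {1..}. u' k \<noteq> lcs G (Suc k)} \<subseteq> F" using sup by (auto simp: u'_def)
        ultimately show ?thesis using step[OF True x(1) u'] insert.IH u' by force
      qed
    qed
  qed
  then show ?thesis using assms(1) by (auto simp: lcs_graded_carrier)
qed

lemma lie_ring_lcs_graded: "lie_ring S"
proof -
  interpret S: comm_group S by (rule comm_group_lcs_graded)
  note bl = lcs_graded_bracket_mult_left and br = lcs_graded_bracket_mult_right
    and bc [simp] = lcs_graded_bracket_closed
  have one_left: "bracket S \<one>\<^bsub>S\<^esub> u = \<one>\<^bsub>S\<^esub>" if "u \<in> carrier S" for u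
    using bl[of "\<one>\<^bsub>S\<^esub>" "\<one>\<^bsub>S\<^esub>" u] that bc[of "\<one>\<^bsub>S\<^esub>" u]
    by (metis S.l_one S.one_closed S.r_cancel_one')
  have one_right: "bracket S u \<one>\<^bsub>S\<^esub> = \<one>\<^bsub>S\<^esub>" if "u \<in> carrier S" for u
    using br[of "\<one>\<^bsub>S\<^esub>" "\<one>\<^bsub>S\<^esub>" u] that bc[of u "\<one>\<^bsub>S\<^esub>"]
    by (metis S.l_one S.one_closed S.r_cancel_one')
  have gr_gr: "bracket S (gr n x) (gr m y) \<otimes>\<^bsub>S\<^esub> bracket S (gr m y) (gr n x) = \<one>\<^bsub>S\<^esub>"
    if "n \<ge> 1" "m \<ge> 1" "x \<in> lcs G n" "y \<in> lcs G m" for n m x y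
  proof -
    have "y \<lozenge> x = inv (x \<lozenge> y)" using that by (simp add: inv_commutator)
    then show ?thesis
      using that commutator_in_lcs[OF that(3,4,1,2)] gr_mult[of "x \<lozenge> y" "n + m" "y \<lozenge> x"]
      by (simp add: gr_bracket add.commute[of m n] gr_one)
  qed
  have gr_swap: "bracket S (gr n x) u \<otimes>\<^bsub>S\<^esub> bracket S u (gr n x) = \<one>\<^bsub>S\<^esub>"
    if "u \<in> carrier S" "n \<ge> 1" "x \<in> lcs G n" for u n x
    using that(1)
  proof (induction rule: lcs_graded_induct)
    case one
    then show ?case using that by (simp add: one_left one_right)
  next
    case (mult m y u)
    have "bracket S (gr n x) (gr m y \<otimes>\<^bsub>S\<^esub> u) \<otimes>\<^bsub>S\<^esub> bracket S (gr m y \<otimes>\<^bsub>S\<^esub> u) (gr n x) =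
      (bracket S (gr n x) (gr m y) \<otimes>\<^bsub>S\<^esub> bracket S (gr m y) (gr n x)) \<otimes>\<^bsub>S\<^esub>
      (bracket S (gr n x) u \<otimes>\<^bsub>S\<^esub> bracket S u (gr n x))"
      using that(2-) mult.hyps by (simp add: bl br S.m_ac)
    then show ?case using gr_gr[of n m x y] mult that by simp
  qed
  \<comment> \<open>Antisymmetry gives only that twice the self-bracket vanishes. Here the diagonal
    terms vanish because x commutes with itself, and the mixed ones cancel by
    \<open>gr_swap\<close>.\<close>
  have self: "bracket S u u = \<one>\<^bsub>S\<^esub>" if "u \<in> carrier S" for u
    using that
  proof (induction rule: lcs_graded_induct)
    case one
    then show ?case by (simp add: one_left)
  next
    case (mult n x u)
    have "bracket S (gr n x \<otimes>\<^bsub>S\<^esub> u) (gr n x \<otimes>\<^bsub>S\<^esub> u) =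
      bracket S (gr n x) (gr n x) \<otimes>\<^bsub>S\<^esub> bracket S u u \<otimes>\<^bsub>S\<^esub>
      (bracket S (gr n x) u \<otimes>\<^bsub>S\<^esub> bracket S u (gr n x))"
      using mult.hyps by (simp add: bl br S.m_ac)
    then show ?case using gr_swap[of u n x] mult by (simp add: gr_bracket gr_one)
  qed
  \<comment> \<open>\<open>J\<close> is additive in its first argument and invariant under rotation,
    so induction on the first slot, applied three times, reaches all three.\<close>
  define J where "J u v w = bracket S u (bracket S v w) \<otimes>\<^bsub>S\<^esub>
    (bracket S v (bracket S w u) \<otimes>\<^bsub>S\<^esub> bracket S w (bracket S u v))" for u v w
  have J_rot: "J u v w = J v w u" if "u \<in> carrier S" "v \<in> carrier S" "w \<in> carrier S" for u v w
    using that by (simp add: J_def S.m_ac)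
  have J_mult: "J (u \<otimes>\<^bsub>S\<^esub> u') v w = J u v w \<otimes>\<^bsub>S\<^esub> J u' v w"
    if "u \<in> carrier S" "u' \<in> carrier S" "v \<in> carrier S" "w \<in> carrier S" for u u' v w
    using that by (simp add: J_def bl br S.m_ac)
  have J_one: "J \<one>\<^bsub>S\<^esub> v w = \<one>\<^bsub>S\<^esub>" if "v \<in> carrier S" "w \<in> carrier S" for v w
    using that by (simp add: J_def one_left one_right)
  have J_gr: "J (gr i x) (gr j y) (gr l z) = \<one>\<^bsub>S\<^esub>"
    if "i \<ge> 1" "j \<ge> 1" "l \<ge> 1" "x \<in> lcs G i" "y \<in> lcs G j" "z \<in> lcs G l" for i j l x y z
  proof -
    let ?n = "i + j + l"
    have in3: "x \<lozenge> (y \<lozenge> z) \<in> lcs G ?n" "y \<lozenge> (z \<lozenge> x) \<in> lcs G ?n" "z \<lozenge> (x \<lozenge> y) \<in> lcs G ?n"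
      using commutator_in_lcs[OF that(4) commutator_in_lcs[OF that(5,6,2,3)] that(1)]
        commutator_in_lcs[OF that(5) commutator_in_lcs[OF that(6,4,3,1)] that(2)]
        commutator_in_lcs[OF that(6) commutator_in_lcs[OF that(4,5,1,2)] that(3)] that
      by (simp_all add: add.assoc add.commute[of l] add.left_commute[of j i l])
    have "J (gr i x) (gr j y) (gr l z) = gr ?n (x \<lozenge> (y \<lozenge> z)) \<otimes>\<^bsub>S\<^esub> (gr ?n (y \<lozenge> (z \<lozenge> x)) \<otimes>\<^bsub>S\<^esub> gr ?n (z \<lozenge> (x \<lozenge> y)))"
      using that commutator_in_lcs[OF that(5,6,2,3)] commutator_in_lcs[OF that(6,4,3,1)]
        commutator_in_lcs[OF that(4,5,1,2)]
      by (simp add: J_def gr_bracket add.assoc add.commute[of l] add.left_commute[of j i l])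
    also have "\<dots> = gr ?n ((x \<lozenge> (y \<lozenge> z)) \<otimes> ((y \<lozenge> (z \<lozenge> x)) \<otimes> (z \<lozenge> (x \<lozenge> y))))"
      using in3 by (simp add: gr_mult)
    also have "\<dots> = \<one>\<^bsub>S\<^esub>"
      using cls_jacobi[OF that(4-6,1-3)] by (auto simp: gr_def lcs_graded_one fun_eq_iff)
    finally show ?thesis .
  qed
  have J_gr2: "J u (gr j y) (gr l z) = \<one>\<^bsub>S\<^esub>"
    if "u \<in> carrier S" "j \<ge> 1" "l \<ge> 1" "y \<in> lcs G j" "z \<in> lcs G l" for u j l y z
    using that(1) by (induction rule: lcs_graded_induct) (use that in \<open>simp_all add: J_one J_mult J_gr\<close>)
  have J_gr1: "J v w (gr l z) = \<one>\<^bsub>S\<^esub>"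
    if "v \<in> carrier S" "w \<in> carrier S" "l \<ge> 1" "z \<in> lcs G l" for v w l z
  proof -
    have "J w (gr l z) v = \<one>\<^bsub>S\<^esub>"
      using that(2)
    proof (induction rule: lcs_graded_induct)
      case (mult n x u)
      have "J (gr n x) (gr l z) v = J v (gr n x) (gr l z)"
        using mult that J_rot[of "v" "gr n x" "gr l z"] by simp
      then show ?case using mult that J_gr2[of v n l x z] by (simp add: J_mult)
    qed (use that in \<open>simp add: J_one\<close>)
    then show ?thesis using that J_rot[of v w "gr l z"] by simp
  qed
  have "J u v w = \<one>\<^bsub>S\<^esub>" if "u \<in> carrier S" "v \<in> carrier S" "w \<in> carrier S" for u v w
    using that(1)
  proof (induction rule: lcs_graded_induct)
    case (mult n x u)
    have "J (gr n x) v w = \<one>\<^bsub>S\<^esub>"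
      using mult that J_rot[of "gr n x" v w] J_gr1[of v w n x] by simp
    then show ?case using mult that by (simp add: J_mult)
  qed (use that in \<open>simp add: J_one\<close>)
  then show ?thesis
    by unfold_locales (simp_all add: bl br self J_def)
qed

end


section \<open>The Johnson image is a subgroup\<close>

text \<open>A copy of \<open>group\<close>, so that the abelianization, itself a group, does not in
  turn acquire a free Lie ring.\<close>

locale lcs_group = group G for G (structure)
begin

definition Ab where "Ab = abelianization G"

lemma comm_group_Ab: "comm_group Ab"
  unfolding Ab_def by (rule comm_group_lcs_quot) simp

end

sublocale lcs_group \<subseteq> FL: free_lie_ring Ab
  by (rule free_lie_ring.intro, rule comm_group_Ab)

context lcs_group
begin

definition hgen where "hgen x = FL.gen (cls 1 x)"

lemma Ab_cases: assumes "h \<in> carrier Ab" obtains x where "x \<in> carrier G" "h = cls 1 x"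
  using assms by (auto simp: carrier_lcs_quot Ab_def)

lemma cls_in_Ab: "x \<in> carrier G \<Longrightarrow> cls 1 x \<in> carrier Ab"
  unfolding Ab_def by (rule cls_in_lcs_quot) simp

lemma hgen_closed [simp, intro]: "x \<in> carrier G \<Longrightarrow> hgen x \<in> carrier FL.L"
  unfolding hgen_def by (intro FL.gen_closed cls_in_Ab)

lemma
  shows lcs_iso_hgen: "x \<in> carrier G \<Longrightarrow> lcs_iso G (hgen x) = gr 1 x"
    and lcs_iso_hom: "lcs_iso G \<in> hom FL.L S"
    and lcs_iso_bracket: "X \<in> carrier FL.L \<Longrightarrow> Y \<in> carrier FL.L \<Longrightarrow>
      lcs_iso G (bracket FL.L X Y) = bracket S (lcs_iso G X) (lcs_iso G Y)"
proof -
  define \<phi> where "\<phi> = (\<lambda>h. \<lambda>k\<in>{1..}. if k = 1 then h else \<one>\<^bsub>lcs_quot G k\<^esub>)"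
  have iso: "lcs_iso G = free_lie_lift S \<phi>" by (simp only: lcs_iso_def \<phi>_def)
  have \<phi>: "\<phi> (cls 1 x) = gr 1 x" for x by (auto simp: gr_def fun_eq_iff \<phi>_def)
  have hom: "\<phi> \<in> hom Ab S"
  proof (rule homI)
    fix h assume "h \<in> carrier Ab"
    then obtain x where "x \<in> carrier G" "h = cls 1 x" by (rule Ab_cases)
    then show "\<phi> h \<in> carrier S" by (simp only: \<phi>) (simp add: gr_closed)
  next
    fix h h' assume "h \<in> carrier Ab" "h' \<in> carrier Ab"
    then obtain x y where xy: "x \<in> carrier G" "h = cls 1 x" "y \<in> carrier G" "h' = cls 1 y"
      by (metis Ab_cases)
    have "h \<otimes>\<^bsub>Ab\<^esub> h' = cls 1 (x \<otimes> y)"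
      unfolding Ab_def xy lcs_quot_sel by (rule cls_mult) (use xy in simp_all)
    then have "\<phi> (h \<otimes>\<^bsub>Ab\<^esub> h') = gr 1 (x \<otimes> y)" by (simp only: \<phi>)
    also have "\<dots> = gr 1 x \<otimes>\<^bsub>S\<^esub> gr 1 y" using xy by (simp add: gr_mult)
    finally show "\<phi> (h \<otimes>\<^bsub>Ab\<^esub> h') = \<phi> h \<otimes>\<^bsub>S\<^esub> \<phi> h'"
      by (simp only: \<phi> xy)
  qed
  note lift = FL.free_lie_lift_gen[OF lie_ring_lcs_graded hom] FL.free_lie_lift_hom[OF lie_ring_lcs_graded hom]
    FL.free_lie_lift_bracket[OF lie_ring_lcs_graded hom]
  show "lcs_iso G (hgen x) = gr 1 x" if "x \<in> carrier G"
    unfolding iso hgen_def lift(1)[OF cls_in_Ab[OF that]] by (rule \<phi>)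
  show "lcs_iso G \<in> hom FL.L S" unfolding iso by (rule lift(2))
  show "lcs_iso G (bracket FL.L X Y) = bracket S (lcs_iso G X) (lcs_iso G Y)"
    if "X \<in> carrier FL.L" "Y \<in> carrier FL.L" unfolding iso by (rule lift(3)[OF that])
qed

end

section \<open>The abelian group of derivations of a given degree\<close>

context free_lie_ring
begin

abbreviation "Der k \<equiv> free_lie_derivations A k"

lemma Der_iff: "d \<in> carrier (Der k) \<longleftrightarrow> d \<in> carrier L \<rightarrow>\<^sub>E carrier L \<and>
   (\<forall>x\<in>carrier L. \<forall>y\<in>carrier L. d (x \<otimes>\<^bsub>L\<^esub> y) = d x \<otimes>\<^bsub>L\<^esub> d y) \<and>
   (\<forall>x\<in>carrier L. \<forall>y\<in>carrier L.
      d (bracket L x y) = bracket L (d x) y \<otimes>\<^bsub>L\<^esub> bracket L x (d y)) \<and>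
   (\<forall>m\<ge>1. d ` Ldeg m \<subseteq> Ldeg (m + k))"
  by (simp add: free_lie_derivations_def Let_def L_def)

lemma Der_mult: "d \<otimes>\<^bsub>Der k\<^esub> e = (\<lambda>x\<in>carrier L. d x \<otimes>\<^bsub>L\<^esub> e x)"
  and Der_one: "\<one>\<^bsub>Der k\<^esub> = (\<lambda>x\<in>carrier L. \<one>\<^bsub>L\<^esub>)"
  by (simp_all add: free_lie_derivations_def Let_def L_def)

lemma DerI:
  assumes "d \<in> carrier L \<rightarrow>\<^sub>E carrier L"
    and "\<And>x y. x \<in> carrier L \<Longrightarrow> y \<in> carrier L \<Longrightarrow> d (x \<otimes>\<^bsub>L\<^esub> y) = d x \<otimes>\<^bsub>L\<^esub> d y"
    and "\<And>x y. x \<in> carrier L \<Longrightarrow> y \<in> carrier L \<Longrightarrow>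
      d (bracket L x y) = bracket L (d x) y \<otimes>\<^bsub>L\<^esub> bracket L x (d y)"
    and "\<And>m x. m \<ge> 1 \<Longrightarrow> x \<in> Ldeg m \<Longrightarrow> d x \<in> Ldeg (m + k)"
  shows "d \<in> carrier (Der k)"
  using assms by (simp add: Der_iff image_subset_iff)

lemma
  assumes "d \<in> carrier (Der k)"
  shows Der_closed [simp]: "x \<in> carrier L \<Longrightarrow> d x \<in> carrier L"
    and Der_add: "x \<in> carrier L \<Longrightarrow> y \<in> carrier L \<Longrightarrow> d (x \<otimes>\<^bsub>L\<^esub> y) = d x \<otimes>\<^bsub>L\<^esub> d y"
    and Der_bracket: "x \<in> carrier L \<Longrightarrow> y \<in> carrier L \<Longrightarrow>
      d (bracket L x y) = bracket L (d x) y \<otimes>\<^bsub>L\<^esub> bracket L x (d y)"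
    and Der_deg: "m \<ge> 1 \<Longrightarrow> x \<in> Ldeg m \<Longrightarrow> d x \<in> Ldeg (m + k)"
    and Der_ext: "x \<notin> carrier L \<Longrightarrow> d x = undefined"
  using assms by (auto simp: Der_iff image_subset_iff)

lemma comm_group_Der: "comm_group (Der k)"
proof (rule comm_groupI)
  fix d e assume d: "d \<in> carrier (Der k)" and e: "e \<in> carrier (Der k)"
  note simps = Der_closed[OF d] Der_closed[OF e] Der_add[OF d] Der_add[OF e] Der_bracket[OF d] Der_bracket[OF e]
  show "d \<otimes>\<^bsub>Der k\<^esub> e \<in> carrier (Der k)"
    unfolding Der_mult
    by (rule DerI) (auto simp: simps L.m_ac L.bracket_mult_left L.bracket_mult_right Ldeg_closed
        intro!: Ldeg_mult Der_deg[OF d] Der_deg[OF e])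
  show "d \<otimes>\<^bsub>Der k\<^esub> e = e \<otimes>\<^bsub>Der k\<^esub> d"
    unfolding Der_mult by (rule restrict_ext) (simp add: simps L.m_comm)
next
  show "\<one>\<^bsub>Der k\<^esub> \<in> carrier (Der k)"
    unfolding Der_one by (rule DerI) (auto simp: Ldeg_closed Ldeg_one)
next
  fix d e f assume d: "d \<in> carrier (Der k)" and e: "e \<in> carrier (Der k)" and f: "f \<in> carrier (Der k)"
  show "d \<otimes>\<^bsub>Der k\<^esub> e \<otimes>\<^bsub>Der k\<^esub> f = d \<otimes>\<^bsub>Der k\<^esub> (e \<otimes>\<^bsub>Der k\<^esub> f)"
    unfolding Der_mult
    by (rule restrict_ext) (simp add: L.m_assoc Der_closed[OF d] Der_closed[OF e] Der_closed[OF f])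
next
  fix d assume d: "d \<in> carrier (Der k)"
  show "\<one>\<^bsub>Der k\<^esub> \<otimes>\<^bsub>Der k\<^esub> d = d"
    by (rule ext) (simp add: Der_mult Der_one Der_closed[OF d] Der_ext[OF d])
  define e where "e = (\<lambda>x\<in>carrier L. inv\<^bsub>L\<^esub> (d x))"
  note simps = Der_closed[OF d] Der_add[OF d] Der_bracket[OF d]
  have "e \<in> carrier (Der k)"
    unfolding e_def
    by (rule DerI) (auto simp: simps L.inv_mult L.bracket_inv_left L.bracket_inv_right Ldeg_closed
        intro!: Ldeg_inv Der_deg[OF d])
  moreover have "e \<otimes>\<^bsub>Der k\<^esub> d = \<one>\<^bsub>Der k\<^esub>"
    unfolding Der_mult Der_one e_def by (rule restrict_ext) (simp add: simps)
  ultimately show "\<exists>e\<in>carrier (Der k). e \<otimes>\<^bsub>Der k\<^esub> d = \<one>\<^bsub>Der k\<^esub>" by blast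
qed

end

lemma (in comm_group) two_torsion_FactGroup:
  assumes J: "subgroup J G" and d: "d \<in> carrier G" "d \<notin> J" "d \<otimes> d \<in> J"
  shows "\<exists>X\<in>carrier (G Mod J). X \<noteq> \<one>\<^bsub>G Mod J\<^esub> \<and> X [^]\<^bsub>G Mod J\<^esub> (2::nat) = \<one>\<^bsub>G Mod J\<^esub>"
proof -
  interpret J: normal J G using subgroup_imp_normal[OF J] .
  interpret M: group "G Mod J" by (rule J.factorgroup_is_group)
  have X: "J #> d \<in> carrier (G Mod J)" using d by (simp add: carrier_FactGroup)
  have "J #> d \<noteq> J" using rcos_self[OF d(1) J] d(2) by auto
  moreover have "(J #> d) [^]\<^bsub>G Mod J\<^esub> (2::nat) = J #> (d \<otimes> d)"
    using X d by (simp add: numeral_2_eq_2 M.l_one[simplified] J.rcos_sum)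
  moreover have "J #> (d \<otimes> d) = J" by (rule coset_join2[OF _ J d(3)]) (use d in simp)
  ultimately show ?thesis using X by (intro bexI[of _ "J #> d"]) auto
qed

section \<open>Symplectic derivations and the Johnson filtration of a surface\<close>

locale surface =
  fixes g :: nat
begin

definition P where "P = surface_group g"

sublocale lcs_group P
  unfolding P_def lcs_group_def surface_group_def by (rule group_free_group)

lemma H_class: "H_class g x = cls 1 x"
  by (simp add: H_class_def P_def numeral_2_eq_2)

abbreviation "SD K \<equiv> symplectic_derivations g K"

lemma omega_eq: "omega g = finprod FL.L
    (\<lambda>i. bracket FL.L (hgen (alpha i)) (hgen (beta i))) {1..g}"
  unfolding omega_def Let_def P_def[symmetric] FL.L_def hgen_def H_class by (simp only: Ab_def)

lemma SD_eq: "SD K = (FL.Der K)\<lparr>carrier := {d \<in> carrier (FL.Der K). d (omega g) = \<one>\<^bsub>FL.L\<^esub>}\<rparr>"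
  unfolding symplectic_derivations_def Let_def P_def[symmetric] FL.L_def by (simp only: Ab_def)

lemma SD_sel [simp]: "d \<otimes>\<^bsub>SD K\<^esub> e = d \<otimes>\<^bsub>FL.Der K\<^esub> e" "\<one>\<^bsub>SD K\<^esub> = \<one>\<^bsub>FL.Der K\<^esub>"
  by (simp_all add: SD_eq)

lemma alpha_beta_closed [simp, intro]:
  "i \<in> {1..g} \<Longrightarrow> alpha i \<in> carrier P" "i \<in> {1..g} \<Longrightarrow> beta i \<in> carrier P"
  by (auto simp: P_def surface_group_def free_group_def alpha_def beta_def)

lemma omega_closed: "omega g \<in> carrier FL.L"
  unfolding omega_eq by (rule FL.L.finprod_closed) auto

lemma comm_group_SD: "comm_group (SD K)"
proof -
  interpret D: comm_group "FL.Der K" by (rule FL.comm_group_Der)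
  let ?N = "{d \<in> carrier (FL.Der K). d (omega g) = \<one>\<^bsub>FL.L\<^esub>}"
  have sub: "subgroup ?N (FL.Der K)"
  proof (rule D.subgroupI)
    show "?N \<noteq> {}" using D.one_closed omega_closed by (auto simp: FL.Der_one)
  next
    fix d assume d: "d \<in> ?N"
    have "(inv\<^bsub>FL.Der K\<^esub> d \<otimes>\<^bsub>FL.Der K\<^esub> d) (omega g) = \<one>\<^bsub>FL.L\<^esub>"
      using d omega_closed by (simp add: FL.Der_one)
    then have "(inv\<^bsub>FL.Der K\<^esub> d) (omega g) \<otimes>\<^bsub>FL.L\<^esub> \<one>\<^bsub>FL.L\<^esub> = \<one>\<^bsub>FL.L\<^esub>"
      using d omega_closed by (simp add: FL.Der_mult)
    then show "inv\<^bsub>FL.Der K\<^esub> d \<in> ?N"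
      using d omega_closed FL.Der_closed[OF D.inv_closed] by simp
  next
    fix d e assume d: "d \<in> ?N" and e: "e \<in> ?N"
    then have "(d \<otimes>\<^bsub>FL.Der K\<^esub> e) (omega g) = \<one>\<^bsub>FL.L\<^esub>"
      using omega_closed by (simp add: FL.Der_mult)
    then show "d \<otimes>\<^bsub>FL.Der K\<^esub> e \<in> ?N" using d e by blast
  qed auto
  show ?thesis
        unfolding SD_eq
  proof (rule group.group_comm_groupI[OF subgroup.subgroup_is_group[OF sub D.is_group]])
  qed (simp add: D.m_comm)
qed

lemma SD_closed: "d \<in> carrier (SD K) \<Longrightarrow> d \<in> carrier (FL.Der K)"
  by (simp add: SD_eq)

lemma mapping_class_group_iff:
  "f \<in> mapping_class_group g \<longleftrightarrow> f \<in> hom P P \<and> f \<in> Bij (carrier P) \<and> f (zeta g) = zeta g"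
  by (auto simp: mapping_class_group_def auto_def P_def)

lemma johnson_filtration_iff:
  "f \<in> johnson_filtration g K \<longleftrightarrow>
     f \<in> mapping_class_group g \<and> (\<forall>x\<in>carrier P. lcs P (Suc K) #>\<^bsub>P\<^esub> f x = lcs P (Suc K) #>\<^bsub>P\<^esub> x)"
  by (simp add: johnson_filtration_def Let_def P_def)

lemma is_johnson_image_iff:
  "is_johnson_image g K f d \<longleftrightarrow>
     (\<forall>x\<in>carrier P. lcs_iso P (d (hgen x)) (Suc K) = cls (Suc K) (f x \<otimes>\<^bsub>P\<^esub> inv\<^bsub>P\<^esub> x))"
  by (simp only: is_johnson_image_def Let_def H_class hgen_def Ab_def Suc_eq_plus1 add_2_eq_Suc' flip: P_def)

lemma zeta_closed: "zeta g \<in> carrier P"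
proof -
  have "foldr (\<lambda>i w. commutator P (inv\<^bsub>P\<^esub> (beta i)) (alpha i) \<otimes>\<^bsub>P\<^esub> w) is \<one>\<^bsub>P\<^esub> \<in> carrier P"
    if "set is \<subseteq> {1..g}" for "is"
    using that by (induction "is") auto
  moreover have "set [1..<g + 1] \<subseteq> {1..g}" by auto
  ultimately show ?thesis unfolding zeta_def Let_def P_def[symmetric] by (intro inv_closed)
qed

lemma mcg_compose:
  assumes "f \<in> mapping_class_group g" "h \<in> mapping_class_group g"
  shows "compose (carrier P) f h \<in> mapping_class_group g"
  using assms zeta_closed
  by (auto simp: mapping_class_group_iff compose_Bij compose_eq hom_def Pi_def)

lemma mcg_inverse:
  assumes f: "f \<in> mapping_class_group g"
  obtains f' where "f' \<in> mapping_class_group g"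
    "\<And>x. x \<in> carrier P \<Longrightarrow> f' (f x) = x" "\<And>x. x \<in> carrier P \<Longrightarrow> f (f' x) = x"
proof -
  define f' where "f' = restrict (inv_into (carrier P) f) (carrier P)"
  have b: "bij_betw f (carrier P) (carrier P)" and B: "f \<in> Bij (carrier P)" and h: "f \<in> hom P P"
    using f by (auto simp: mapping_class_group_iff Bij_def)
  have 1: "f' (f x) = x" if "x \<in> carrier P" for x
    using b that by (auto simp: f'_def bij_betw_def)
  have 2: "f (f' x) = x" if "x \<in> carrier P" for x
    using b that by (simp add: f'_def bij_betw_def f_inv_into_f)
  have "f' \<in> hom P P" unfolding f'_def using restrict_inv_into_hom[OF h B] .
  moreover have "f' (zeta g) = zeta g" using 1[OF zeta_closed] f by (simp add: mapping_class_group_iff)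
  ultimately have "f' \<in> mapping_class_group g"
    using restrict_inv_into_Bij[OF B] by (simp add: mapping_class_group_iff f'_def)
  then show thesis using that 1 2 by blast
qed

lemma mcg_closed [simp]: "f \<in> mapping_class_group g \<Longrightarrow> x \<in> carrier P \<Longrightarrow> f x \<in> carrier P"
  by (auto simp: mapping_class_group_iff hom_def)

lemma johnson_cls1:
  assumes "f \<in> johnson_filtration g K" "x \<in> carrier P" "K \<ge> 1"
  shows "cls 1 (f x) = cls 1 x"
proof -
  have "f x \<in> carrier P" using assms by (simp add: johnson_filtration_iff)
  then have "f x \<otimes>\<^bsub>P\<^esub> inv\<^bsub>P\<^esub> x \<in> lcs P (Suc K)"
    using assms cls_eq_iff[of "f x" x "Suc K"] by (simp add: johnson_filtration_iff)
  then have "f x \<otimes>\<^bsub>P\<^esub> inv\<^bsub>P\<^esub> x \<in> lcs P (Suc 1)" by (rule lcs_mono) (use assms in simp)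
  then show ?thesis using \<open>f x \<in> carrier P\<close> assms(2) cls_eq_iff by simp
qed

lemma johnson_hgen:
  "f \<in> johnson_filtration g K \<Longrightarrow> x \<in> carrier P \<Longrightarrow> K \<ge> 1 \<Longrightarrow> hgen (f x) = hgen x"
  unfolding hgen_def by (simp only: johnson_cls1)

lemma is_johnson_imageD:
  "is_johnson_image g K f d \<Longrightarrow> x \<in> carrier P \<Longrightarrow>
     lcs_iso P (d (hgen x)) (Suc K) = cls (Suc K) (f x \<otimes>\<^bsub>P\<^esub> inv\<^bsub>P\<^esub> x)"
  by (simp only: is_johnson_image_iff)

lemma lcs_iso_one: "lcs_iso P \<one>\<^bsub>FL.L\<^esub> = \<one>\<^bsub>S\<^esub>"
  using lcs_iso_hom hom_one FL.L.is_group comm_group.axioms(2)[OF comm_group_lcs_graded] by blast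

text \<open>The Johnson map is multiplicative because (f h)(x) x^-1 is the product of f(h(x))
  h(x)^-1 and h(x) x^-1, and h(x) has the same class in H as x. For inverses the relation for f is
  read at the preimage of x.\<close>

lemma subgroup_johnson_image:
  assumes K: "K \<ge> 1"
  shows "subgroup (johnson_image g K) (SD K)"
proof -
  interpret D: comm_group "SD K" by (rule comm_group_SD)
  interpret S: comm_group S by (rule comm_group_lcs_graded)
  show ?thesis
  proof (rule D.subgroupI)
    show "johnson_image g K \<subseteq> carrier (SD K)" by (auto simp: johnson_image_def)
  next
    let ?i = "\<lambda>x\<in>carrier P. x"
    have "?i \<in> mapping_class_group g"
      using id_in_auto zeta_closed by (auto simp: mapping_class_group_iff auto_def)
    then have "?i \<in> johnson_filtration g K" by (simp add: johnson_filtration_iff)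
    moreover have "is_johnson_image g K ?i \<one>\<^bsub>SD K\<^esub>"
      by (simp add: is_johnson_image_iff FL.Der_one lcs_iso_one lcs_graded_one cls_one)
    ultimately show "johnson_image g K \<noteq> {}"
      using D.one_closed unfolding johnson_image_def by blast
  next
    fix d e assume "d \<in> johnson_image g K" "e \<in> johnson_image g K"
    then obtain f h where d: "d \<in> carrier (SD K)" and e: "e \<in> carrier (SD K)"
      and f: "f \<in> johnson_filtration g K" and h: "h \<in> johnson_filtration g K"
      and fd: "is_johnson_image g K f d" and he: "is_johnson_image g K h e"
      by (auto simp: johnson_image_def)
    have fh: "f \<in> mapping_class_group g" "h \<in> mapping_class_group g"
      using f h by (auto simp: johnson_filtration_iff)
    have "compose (carrier P) f h \<in> johnson_filtration g K"
      using f h mcg_compose[OF fh] by (simp add: johnson_filtration_iff compose_eq)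
    moreover have "is_johnson_image g K (compose (carrier P) f h) (d \<otimes>\<^bsub>SD K\<^esub> e)"
      unfolding is_johnson_image_iff
    proof
      fix x assume x: "x \<in> carrier P"
      let ?c = "hgen x"
      have c: "?c \<in> carrier FL.L" "d ?c \<in> carrier FL.L" "e ?c \<in> carrier FL.L"
        using x d e by (auto dest: SD_closed)
      have "lcs_iso P ((d \<otimes>\<^bsub>SD K\<^esub> e) ?c) = lcs_iso P (d ?c) \<otimes>\<^bsub>S\<^esub> lcs_iso P (e ?c)"
        using c hom_mult[OF lcs_iso_hom c(2,3)] by (simp add: FL.Der_mult)
      then have "lcs_iso P ((d \<otimes>\<^bsub>SD K\<^esub> e) ?c) (Suc K) = lcs_iso P (d ?c) (Suc K) <#>\<^bsub>P\<^esub> lcs_iso P (e ?c) (Suc K)"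
        by (simp add: lcs_graded_mult)
      also have "lcs_iso P (d ?c) (Suc K) = cls (Suc K) (f (h x) \<otimes>\<^bsub>P\<^esub> inv\<^bsub>P\<^esub> (h x))"
        using is_johnson_imageD[OF fd, of "h x"] fh x by (simp only: johnson_hgen[OF h x K] mcg_closed)
      also have "lcs_iso P (e ?c) (Suc K) = cls (Suc K) (h x \<otimes>\<^bsub>P\<^esub> inv\<^bsub>P\<^esub> x)"
        using is_johnson_imageD[OF he x] .
      finally show "lcs_iso P ((d \<otimes>\<^bsub>SD K\<^esub> e) ?c) (Suc K) =
          cls (Suc K) (compose (carrier P) f h x \<otimes>\<^bsub>P\<^esub> inv\<^bsub>P\<^esub> x)"
        using x fh by (simp add: cls_mult compose_eq m_assoc)
    qed
    ultimately show "d \<otimes>\<^bsub>SD K\<^esub> e \<in> johnson_image g K"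
      using d e D.m_closed unfolding johnson_image_def by blast
  next
    fix d assume "d \<in> johnson_image g K"
    then obtain f where d: "d \<in> carrier (SD K)" and f: "f \<in> johnson_filtration g K"
      and fd: "is_johnson_image g K f d" by (auto simp: johnson_image_def)
    have fm: "f \<in> mapping_class_group g" using f by (auto simp: johnson_filtration_iff)
    obtain f' where f': "f' \<in> mapping_class_group g"
      "\<And>x. x \<in> carrier P \<Longrightarrow> f' (f x) = x" "\<And>x. x \<in> carrier P \<Longrightarrow> f (f' x) = x"
      using mcg_inverse[OF fm] by blast
    define e where "e = inv\<^bsub>SD K\<^esub> d"
    have e: "e \<in> carrier (SD K)" using d by (simp add: e_def)
    have f'J: "f' \<in> johnson_filtration g K"
      using f f' unfolding johnson_filtration_iff by (metis mcg_closed)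
    moreover have "is_johnson_image g K f' e"
      unfolding is_johnson_image_iff
    proof
      fix x assume x: "x \<in> carrier P"
      let ?c = "hgen x" and ?y = "f' x"
      have y: "?y \<in> carrier P" using f' x by simp
      have c: "?c \<in> carrier FL.L" "d ?c \<in> carrier FL.L" "e ?c \<in> carrier FL.L"
        using x d e by (auto dest: SD_closed)
      have "(e \<otimes>\<^bsub>SD K\<^esub> d) ?c = \<one>\<^bsub>FL.L\<^esub>"
        using c d by (simp add: e_def FL.Der_one del: SD_sel(1)) 
      then have "e ?c = inv\<^bsub>FL.L\<^esub> (d ?c)"
        using c by (intro FL.L.inv_equality[symmetric]) (simp_all add: FL.Der_mult)
      then have "lcs_iso P (e ?c) \<otimes>\<^bsub>S\<^esub> lcs_iso P (d ?c) = \<one>\<^bsub>S\<^esub>"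
        using c hom_mult[OF lcs_iso_hom c(3,2)] by (simp add: lcs_iso_one)
      then have "(lcs_iso P (e ?c) \<otimes>\<^bsub>S\<^esub> lcs_iso P (d ?c)) (Suc K) = lcs P (Suc (Suc K))"
        by (simp add: lcs_graded_one)
      then have *: "lcs_iso P (e ?c) (Suc K) <#>\<^bsub>P\<^esub> lcs_iso P (d ?c) (Suc K) = \<one>\<^bsub>lcs_quot P (Suc K)\<^esub>"
        by (simp add: lcs_graded_mult)
      have "lcs_iso P (d ?c) (Suc K) = cls (Suc K) (f ?y \<otimes>\<^bsub>P\<^esub> inv\<^bsub>P\<^esub> ?y)"
        using is_johnson_imageD[OF fd y] by (simp only: johnson_hgen[OF f'J x K])
      then have dc: "lcs_iso P (d ?c) (Suc K) = cls (Suc K) (x \<otimes>\<^bsub>P\<^esub> inv\<^bsub>P\<^esub> ?y)"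
        using f' x by simp
      have eq: "x \<otimes>\<^bsub>P\<^esub> inv\<^bsub>P\<^esub> ?y \<in> lcs P (Suc K)"
        using f'J x y cls_eq_iff[of x ?y "Suc K"] by (simp add: johnson_filtration_iff)
      interpret QK: comm_group "lcs_quot P (Suc K)" by (rule comm_group_lcs_quot) simp
      have "lcs_iso P (e ?c) (Suc K) \<in> carrier (lcs_quot P (Suc K))"
        using c lcs_iso_hom by (intro lcs_graded_comp) (auto simp: hom_def)
      then have "lcs_iso P (e ?c) (Suc K) = inv\<^bsub>lcs_quot P (Suc K)\<^esub> (cls (Suc K) (x \<otimes>\<^bsub>P\<^esub> inv\<^bsub>P\<^esub> ?y))"
        using * eq unfolding dc by (intro QK.inv_equality[symmetric]) auto
      then show "lcs_iso P (e ?c) (Suc K) = cls (Suc K) (?y \<otimes>\<^bsub>P\<^esub> inv\<^bsub>P\<^esub> x)"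
        using eq x y by (simp add: inv_cls inv_mult_group)
    qed
    ultimately show "inv\<^bsub>SD K\<^esub> d \<in> johnson_image g K"
      using e unfolding johnson_image_def e_def by blast
  qed
qed

end


section \<open>Iterated commutators of braid-like automorphisms\<close>

context group
begin

lemma cls_eq_oneI: "x \<in> lcs G k \<Longrightarrow> lcs G k #> x = lcs G k"
  using cls_eq_iff[of x \<one> k] cls_one by simp

lemma cls_conj: "x \<in> lcs G k \<Longrightarrow> h \<in> carrier G \<Longrightarrow> k \<ge> 1 \<Longrightarrow> cls k (h \<otimes> x \<otimes> inv h) = cls k x"
  using commutator_in_lcs_Suc[of h x k] cls_mult_cong[of "Suc k" "h \<lozenge> x" \<one> x x] cls_eq_oneI[of "h \<lozenge> x" "Suc k"]
  by (simp add: conj_eq_commutator_mult cls_one)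

lemma cls_commute: "x \<in> lcs G k \<Longrightarrow> y \<in> carrier G \<Longrightarrow> k \<ge> 1 \<Longrightarrow> cls k (x \<otimes> y) = cls k (y \<otimes> x)"
proof -
  assume a: "x \<in> lcs G k" "y \<in> carrier G" "k \<ge> 1"
  have "(x \<otimes> y) \<otimes> inv (y \<otimes> x) = x \<lozenge> y" using a by (simp add: word_simps)
  then show ?thesis using a commutator_in_lcs_Suc'[OF a] by (simp add: cls_eq_iff)
qed

lemma hom_generate_shift:
  assumes gen: "carrier G = generate G T" "T \<subseteq> carrier G" and f: "f \<in> hom G G"
    and T: "\<And>x. x \<in> T \<Longrightarrow> f x \<otimes> inv x \<in> lcs G k" and u: "u \<in> carrier G"
  shows "f u \<otimes> inv u \<in> lcs G k"
proof -
  interpret N: normal "lcs G k" G by (rule normal_lcs)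
  interpret f: group_hom G G f using f by unfold_locales
  have "u \<in> generate G T" using u gen(1) by simp
  then show ?thesis
  proof (induction rule: generate.induct)
    case one
    then show ?case by simp
  next
    case (incl h)
    then show ?case using T by simp
  next
    case (inv h)
    then have h: "h \<in> carrier G" using gen(2) by auto
    have "f (inv h) \<otimes> inv (inv h) = inv h \<otimes> inv (f h \<otimes> inv h) \<otimes> inv (inv h)"
      using h by (simp add: word_simps)
    then show ?case using T[OF inv] h lcs_intros(4)[of "inv (f h \<otimes> inv h)" k "inv h"] by simp
  next
    case (eng h1 h2)
    then have h: "h1 \<in> carrier G" "h2 \<in> carrier G" using gen(1) by simp_all
    have "f (h1 \<otimes> h2) \<otimes> inv (h1 \<otimes> h2) = (f h1 \<otimes> inv h1) \<otimes> (h1 \<otimes> (f h2 \<otimes> inv h2) \<otimes> inv h1)"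
      using h by (simp add: word_simps)
    then show ?case using eng.IH h by simp
  qed
qed

text \<open>A change of u by \<Gamma>_(k+1) changes u^-1 f(u) only by \<Gamma>_(k+2), so u may be
  replaced by an explicit word with the same leading term before \<open>f\<close> is
  applied.\<close>

lemma endo_quotient_cong:
  assumes f: "f \<in> hom G G" and r: "\<And>u. u \<in> carrier G \<Longrightarrow> f u \<otimes> inv u \<in> lcs G (Suc 1)"
    and u: "u \<in> lcs G k" "v \<in> lcs G k" "cls k u = cls k v" and k: "k \<ge> 1"
  shows "cls (Suc k) (inv u \<otimes> f u) = cls (Suc k) (inv v \<otimes> f v)"
proof -
  interpret f: group_hom G G f using f by unfold_locales
  define w where "w = u \<otimes> inv v"
  have c: "u \<in> carrier G" "v \<in> carrier G" using u by simp_all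
  have w: "w \<in> lcs G (Suc k)" using u c by (simp add: cls_eq_iff w_def)
  have fw: "f w \<otimes> inv w \<in> lcs G (Suc (Suc k))"
    using endo_shifts_lcs[OF f r w] by simp
  have fv: "f v \<otimes> inv v \<in> lcs G (Suc k)" using endo_shifts_lcs[OF f r u(2)] k by simp
  have wc: "w \<in> carrier G" using w by simp
  have ueq: "u = w \<otimes> v" using c by (simp add: w_def m_assoc)
  have "inv v \<otimes> (f v \<otimes> inv v) \<otimes> inv (inv v) \<in> lcs G (Suc k)"
    using lcs_intros(4)[OF fv, of "inv v"] c by simp
  then have Dv: "inv v \<otimes> f v \<in> lcs G (Suc k)" using c by (simp add: m_assoc)
  have "cls (Suc k) (inv u \<otimes> f u) = cls (Suc k) ((inv v \<otimes> (inv w \<otimes> (f w \<otimes> inv w) \<otimes> inv (inv w)) \<otimes> inv (inv v)) \<otimes> (inv v \<otimes> f v))"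
    unfolding ueq using wc c by (simp add: word_simps)
  also have "\<dots> = cls (Suc k) (\<one> \<otimes> (inv v \<otimes> f v))"
  proof (rule cls_mult_cong)
    have "inv v \<otimes> (inv w \<otimes> (f w \<otimes> inv w) \<otimes> inv (inv w)) \<otimes> inv (inv v) \<in> lcs G (Suc (Suc k))"
      using fw wc c by (intro lcs_intros(4)) auto
    then show "cls (Suc k) (inv v \<otimes> (inv w \<otimes> (f w \<otimes> inv w) \<otimes> inv (inv w)) \<otimes> inv (inv v)) = cls (Suc k) \<one>"
      by (simp add: cls_eq_oneI cls_one)
  qed (use wc c in auto)
  finally show ?thesis using c by simp
qed

end

text \<open>\<open>A\<close> acts like Artin's full twist of the first two of three strands.\<close>

locale strands = group G for G (structure) +
  fixes q1 q2 q3 and A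
  assumes q_closed [simp]: "q1 \<in> carrier G" "q2 \<in> carrier G" "q3 \<in> carrier G"
    and generated: "carrier G = generate G {q1, q2, q3}"
    and A_hom: "A \<in> hom G G"
    and A_q: "A q1 = (q1 \<otimes> q2) \<otimes> q1 \<otimes> inv (q1 \<otimes> q2)" "A q2 = (q1 \<otimes> q2) \<otimes> q2 \<otimes> inv (q1 \<otimes> q2)" "A q3 = q3"
begin

definition m where "m = q1 \<otimes> q2"

lemma m_in [simp]: "m \<in> carrier G" by (simp add: m_def)

sublocale A: group_hom G G A
  using A_hom by unfold_locales

lemma A_m: "A m = m" by (simp add: m_def A_q word_simps)

text \<open>To leading order \<open>X n\<close> is ad(m)^n of \<open>q2\<close>, \<open>Y n\<close>
  is (-1)^n ad(m)^n of \<open>q3\<close>, and \<open>Lw n r\<close> sums the brackets of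
  \<open>X j\<close> and \<open>Y (n - 1 - j)\<close> over j < r. The words are chosen so that
  \<open>A\<close> conjugates \<open>X n\<close> by \<open>m\<close> and \<open>E\<close> sends
  \<open>Y n\<close> to the product of \<open>Y n\<close> and \<open>Y (Suc n)\<close>, both
  exactly.\<close>

fun X where "X 0 = q2" | "X (Suc n) = inv (X n) \<otimes> m \<otimes> X n \<otimes> inv m"
fun Y where "Y 0 = q3" | "Y (Suc n) = inv (Y n) \<otimes> inv m \<otimes> Y n \<otimes> m"
fun Lw where "Lw n 0 = \<one>" | "Lw n (Suc r) = Lw n r \<otimes> (X r \<lozenge> Y (n - Suc r))"

text \<open>\<open>A\<close> corrected by an inner automorphism: \<open>E\<close> fixes
  \<open>m\<close> and every \<open>X n\<close>, and moves only the third generator.\<close>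

definition E where "E u = inv m \<otimes> A u \<otimes> m"

lemma X_closed [simp]: "X n \<in> carrier G" and Y_closed [simp]: "Y n \<in> carrier G"
  by (induction n) simp_all

lemma Lw_closed [simp]: "Lw n r \<in> carrier G"
  by (induction r) simp_all

lemma X_Suc: "X (Suc n) = inv (X n) \<lozenge> m" and Y_Suc: "Y (Suc n) = inv (Y n) \<lozenge> inv m"
  by (simp_all add: commutator_def)

lemma X_lcs: "X n \<in> lcs G (Suc n)"
proof (induction n)
  case (Suc n)
  then show ?case unfolding X_Suc by (intro commutator_in_lcs_Suc') auto
qed simp

lemma Y_lcs: "Y n \<in> lcs G (Suc n)"
proof (induction n)
  case (Suc n)
  then show ?case unfolding Y_Suc by (intro commutator_in_lcs_Suc') auto
qed simp

lemma XY_lcs: "j < n \<Longrightarrow> X j \<lozenge> Y (n - Suc j) \<in> lcs G (Suc n)"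
  using commutator_in_lcs[OF X_lcs[of j] Y_lcs[of "n - Suc j"]] by simp

lemma Lw_lcs: "r \<le> n \<Longrightarrow> Lw n r \<in> lcs G (Suc n)"
  by (induction r) (auto simp: XY_lcs)

lemma A_X: "A (X n) = m \<otimes> X n \<otimes> inv m"
  by (induction n) (simp_all add: A_q(2) A_m m_def[symmetric] word_simps)

lemma E_hom: "E \<in> hom G G"
  by (rule homI) (simp_all add: E_def word_simps)

sublocale E: group_hom G G E
  using E_hom by unfold_locales

lemma E_X: "E (X n) = X n"
  by (simp add: E_def A_X m_assoc)

lemma E_m: "E m = m" by (simp add: E_def A_m m_assoc)

lemma E_Y: "E (Y n) = Y n \<otimes> Y (Suc n)"
proof -
  have "E (Y n) = inv m \<otimes> Y n \<otimes> m"
  proof (induction n)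
    case (Suc n)
    then show ?case by (simp add: E_m m_assoc inv_mult_group del: E_def)
  qed (simp add: E_def A_q)
  then show ?thesis by (simp add: m_assoc)
qed

lemma conj_shift: "g \<in> carrier G \<Longrightarrow> x \<in> carrier G \<Longrightarrow> (g \<otimes> x \<otimes> inv g) \<otimes> inv x \<in> lcs G 2"
  using commutator_in_lcs_Suc[of g x 1] by (simp add: commutator_def numeral_2_eq_2)

lemma A_shift: "u \<in> carrier G \<Longrightarrow> A u \<otimes> inv u \<in> lcs G (Suc 1)"
proof (rule hom_generate_shift[OF generated _ A_hom])
  fix x assume "x \<in> {q1, q2, q3}"
  then consider "x = q1" | "x = q2" | "x = q3" by blast
  then have "A x \<otimes> inv x = (m \<otimes> x \<otimes> inv m) \<otimes> inv x \<or> A x \<otimes> inv x = \<one>"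
    by cases (simp_all add: A_q flip: m_def)
  moreover have "x \<in> carrier G" using \<open>x \<in> {q1, q2, q3}\<close> by auto
  ultimately show "A x \<otimes> inv x \<in> lcs G (Suc 1)"
    using conj_shift[of m x] by (auto simp: numeral_2_eq_2)
qed simp_all

lemma E_shift: "u \<in> carrier G \<Longrightarrow> E u \<otimes> inv u \<in> lcs G (Suc 1)"
proof -
  assume u: "u \<in> carrier G"
  have "E u \<otimes> inv u = inv m \<otimes> (A u \<otimes> inv u) \<otimes> inv (inv m) \<otimes> ((inv m \<otimes> u \<otimes> inv (inv m)) \<otimes> inv u)"
    using u by (simp add: E_def m_assoc)
  moreover have "(inv m \<otimes> u \<otimes> inv (inv m)) \<otimes> inv u \<in> lcs G (Suc 1)"
    using conj_shift[of "inv m" u] u by (simp add: numeral_2_eq_2)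
  ultimately show ?thesis using A_shift[OF u] by (metis inv_closed lcs_intros(2,4) m_in)
qed

text \<open>To leading order u^-1 E(u) is additive in u, and on the bracket of \<open>X r\<close>
  with \<open>Y i\<close> it yields the bracket of \<open>X r\<close> with \<open>Y (Suc i)\<close>,
  by \<open>E_X\<close> and \<open>E_Y\<close>.\<close>

lemma E_Lw: "r \<le> n \<Longrightarrow> cls (n + 2) (inv (Lw n r) \<otimes> E (Lw n r)) = cls (n + 2) (Lw (Suc n) r)"
proof (induction r)
  case 0
  then show ?case by simp
next
  case (Suc r)
  define u v i where "u = Lw n r" and "v = X r \<lozenge> Y (n - Suc r)" and "i = n - Suc r"
  have i: "Suc n - Suc r = Suc i" using Suc.prems by (simp add: i_def)
  have uv: "u \<in> lcs G (Suc n)" "v \<in> lcs G (Suc n)" using Lw_lcs XY_lcs Suc.prems by (simp_all add: u_def v_def)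
  have c [simp]: "u \<in> carrier G" "v \<in> carrier G" using uv by simp_all
  have Ev: "E v = v \<otimes> (Y i \<otimes> (X r \<lozenge> Y (Suc i)) \<otimes> inv (Y i))"
    unfolding v_def i_def[symmetric] commutator_def E.hom_mult E.hom_inv using E_X E_Y
    by (simp add: word_simps del: X.simps Y.simps)
  have w: "X r \<lozenge> Y (Suc i) \<in> lcs G (Suc (Suc n))"
    using XY_lcs[of r "Suc n"] Suc.prems i by simp
  have Du: "inv u \<otimes> E u \<in> carrier G" by simp
  have eq: "inv (u \<otimes> v) \<otimes> E (u \<otimes> v) = (inv v \<otimes> (inv u \<otimes> E u) \<otimes> inv (inv v)) \<otimes> (Y i \<otimes> (X r \<lozenge> Y (Suc i)) \<otimes> inv (Y i))"
    by (simp add: Ev m_assoc inv_mult_group del: Y.simps)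
  have e1: "cls (n + 2) (inv v \<otimes> (inv u \<otimes> E u) \<otimes> inv (inv v)) = cls (n + 2) (inv u \<otimes> E u)"
  proof -
    have "E u \<otimes> inv u \<in> lcs G (Suc (Suc n))"
      using endo_shifts_lcs[OF E_hom E_shift uv(1)] by simp
    then have "inv u \<otimes> (E u \<otimes> inv u) \<otimes> inv (inv u) \<in> lcs G (Suc (Suc n))" by (rule lcs_intros(4)) simp
    then show ?thesis using cls_conj[of "inv u \<otimes> E u" "n + 2" "inv v"] by (simp add: m_assoc)
  qed
  have e2: "cls (n + 2) (Y i \<otimes> (X r \<lozenge> Y (Suc i)) \<otimes> inv (Y i)) = cls (n + 2) (X r \<lozenge> Y (Suc i))"
    using w by (intro cls_conj) simp_all
  have "cls (n + 2) (inv (u \<otimes> v) \<otimes> E (u \<otimes> v)) = cls (n + 2) ((inv u \<otimes> E u) \<otimes> (X r \<lozenge> Y (Suc i)))"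
    unfolding eq by (rule cls_mult_cong[OF e1 e2]) (simp_all del: X.simps Y.simps)
  also have "\<dots> = cls (n + 2) (Lw (Suc n) r \<otimes> (X r \<lozenge> Y (Suc i)))"
    using Suc by (intro cls_mult_cong) (simp_all add: u_def del: X.simps Y.simps)
  finally show ?case by (simp only: Lw.simps i u_def v_def i_def[symmetric])
qed

text \<open>The step from f to f' = A f A^-1 f^-1, in terms of the conjugators \<open>W1\<close>,
  \<open>V\<close>, \<open>W3\<close> of the three strands. To leading order the new first two are z
  u^-1 E(u) with u the old one: the difference u^-1 E(u) raises the index of each \<open>Y\<close>,
  and \<open>z\<close> supplies the new last bracket of \<open>X n\<close> with \<open>q3\<close>.
  The third is W3^-1 A(W3), which turns \<open>X n\<close> into \<open>X (Suc n)\<close>.\<close>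

lemma step:
  assumes f: "f \<in> hom G G" and f': "f' \<in> hom G G"
    and fq: "f q3 = W3 \<otimes> q3 \<otimes> inv W3" and fd: "f (m \<otimes> q3) = m \<otimes> q3"
    and f'q: "f' q1 = W1' \<otimes> q1 \<otimes> inv W1'" "f' q2 = V' \<otimes> q2 \<otimes> inv V'" "f' q3 = W3' \<otimes> q3 \<otimes> inv W3'"
    and W3': "W3' = inv (f' W3) \<otimes> A W3"
    and W1': "W1' = inv (f' W1) \<otimes> A (inv (f m) \<otimes> W1) \<otimes> m"
    and V': "V' = inv (f' V) \<otimes> A (inv (f m) \<otimes> V) \<otimes> m"
    and W: "W1 \<in> lcs G (Suc n)" "V \<in> lcs G (Suc n)" "W3 \<in> lcs G (Suc n)"
    and cW: "cls (Suc n) W1 = cls (Suc n) (Lw n n)" "cls (Suc n) V = cls (Suc n) (Lw n n \<otimes> Y n)"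
      "cls (Suc n) W3 = cls (Suc n) (X n)"
  shows "W1' \<in> lcs G (n + 2) \<and> V' \<in> lcs G (n + 2) \<and> W3' \<in> lcs G (n + 2) \<and>
    cls (n + 2) W1' = cls (n + 2) (Lw (Suc n) (Suc n)) \<and>
    cls (n + 2) V' = cls (n + 2) (Lw (Suc n) (Suc n) \<otimes> Y (Suc n)) \<and>
    cls (n + 2) W3' = cls (n + 2) (X (Suc n))"
proof -
  interpret f: group_hom G G f using f by unfold_locales
  interpret f': group_hom G G f' using f' by unfold_locales
  note [simp del] = X.simps Y.simps Lw.simps
  have Wc [simp]: "W1 \<in> carrier G" "V \<in> carrier G" "W3 \<in> carrier G" using W by simp_all
  have W'c [simp]: "W1' \<in> carrier G" "V' \<in> carrier G" "W3' \<in> carrier G"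
    unfolding W1' V' W3' by simp_all
  \<comment> \<open>Invariance of the total product of \<open>m\<close> and \<open>q3\<close>
    determines \<open>f m\<close>, which brings the commutator of \<open>W3\<close> with
    \<open>q3\<close> into the formulas.\<close>
  have "f m \<otimes> (W3 \<otimes> q3 \<otimes> inv W3) = m \<otimes> q3" using fd fq by simp
  then have "f m = m \<otimes> q3 \<otimes> inv (W3 \<otimes> q3 \<otimes> inv W3)"
    by (metis f.hom_closed inv_closed inv_solve_right m_closed m_in q_closed(3) Wc(3))
  then have ifm: "inv (f m) = (W3 \<lozenge> q3) \<otimes> inv m" by (simp add: word_simps)
  define z where "z = A W3 \<lozenge> q3"
  have zc [simp]: "z \<in> carrier G" by (simp add: z_def)
  have Az: "A (inv (f m) \<otimes> u) \<otimes> m = z \<otimes> E u" if "u \<in> carrier G" for u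
    using that by (simp add: ifm z_def E_def commutator_def A_q A_m m_assoc)
  have W1'': "W1' = inv (f' W1) \<otimes> z \<otimes> E W1" and V'': "V' = inv (f' V) \<otimes> z \<otimes> E V"
    using Az by (simp_all add: W1' V' m_assoc)
  have quot: "inv u \<otimes> h u \<in> lcs G (j + r)" "h u \<in> lcs G j" "inv (h u) \<otimes> u \<in> lcs G (j + r)"
    if h: "h \<in> hom G G" "\<And>u. u \<in> carrier G \<Longrightarrow> h u \<otimes> inv u \<in> lcs G (Suc r)" and u: "u \<in> lcs G j" "j \<ge> 1"
    for h u r j
  proof -
    have hu: "h u \<in> carrier G" using h(1) u by (auto simp: hom_def)
    have 1: "h u \<otimes> inv u \<in> lcs G (j + r)" by (rule endo_shifts_lcs[OF h u])
    then show 2: "inv u \<otimes> h u \<in> lcs G (j + r)"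
      using lcs_intros(4)[OF 1, of "inv u"] u hu by (simp add: m_assoc)
    then show "inv (h u) \<otimes> u \<in> lcs G (j + r)"
      using lcs_intros(3)[OF 2] u hu by (simp add: inv_mult_group)
    have "(h u \<otimes> inv u) \<otimes> u \<in> lcs G j"
      using lcs_intros(2)[OF lcs_mono[OF 1, of j] u(1)] by simp
    moreover have "(h u \<otimes> inv u) \<otimes> u = h u" using hu lcs_closed[OF u(1)] by (simp add: m_assoc)
    ultimately show "h u \<in> lcs G j" by metis
  qed
  have shift1: "f' u \<otimes> inv u \<in> lcs G (Suc 1)" if "u \<in> carrier G" for u
    using that
  proof (rule hom_generate_shift[OF generated _ f', rotated 2])
    fix x assume "x \<in> {q1, q2, q3}"
    then show "f' x \<otimes> inv x \<in> lcs G (Suc 1)"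
      using conj_shift[of W1' q1] conj_shift[of V' q2] conj_shift[of W3' q3]
      by (auto simp: f'q numeral_2_eq_2)
  qed simp
  have AW3: "A W3 \<in> lcs G (Suc n)" using quot(2)[OF A_hom A_shift W(3)] by simp
  have z: "z \<in> lcs G (n + 2)"
    unfolding z_def using commutator_in_lcs_Suc'[OF AW3, of q3] by simp
  have split: "inv (f' u) \<otimes> z \<otimes> E u = (inv (f' u) \<otimes> u) \<otimes> ((inv u \<otimes> z \<otimes> inv (inv u)) \<otimes> (inv u \<otimes> E u))"
    if "u \<in> carrier G" for u using that by (simp add: m_assoc)
  have in2: "inv (f' u) \<otimes> z \<otimes> E u \<in> lcs G (n + 2)" if u: "u \<in> lcs G (Suc n)" for u
    unfolding split[OF lcs_closed[OF u]]
    using lcs_intros(2)[OF quot(3)[OF f' shift1 u]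
        lcs_intros(2)[OF lcs_intros(4)[OF lcs_mono[OF z], of _ "inv u"] quot(1)[OF E_hom E_shift u]]] u
    by simp
  have W1in: "W1' \<in> lcs G (n + 2)" and Vin: "V' \<in> lcs G (n + 2)"
    unfolding W1'' V'' using in2 W by simp_all
  have W3in: "W3' \<in> lcs G (n + 2)"
  proof -
    have "W3' = (inv (f' W3) \<otimes> W3) \<otimes> (inv W3 \<otimes> A W3)" by (simp add: W3' m_assoc)
    then show ?thesis
      using lcs_intros(2)[OF quot(3)[OF f' shift1 W(3)] quot(1)[OF A_hom A_shift W(3)]] by simp
  qed
  \<comment> \<open>Bootstrap: with the new conjugators known to lie in \<Gamma>_(n+2),
    \<open>f'\<close> moves every element by \<Gamma>_(n+3), so its effect on the old conjugators is
    invisible in degree n+2.\<close>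
  have shift2: "f' u \<otimes> inv u \<in> lcs G (Suc (n + 2))" if "u \<in> carrier G" for u
    using that
  proof (rule hom_generate_shift[OF generated _ f', rotated 2])
    fix x assume "x \<in> {q1, q2, q3}"
    then show "f' x \<otimes> inv x \<in> lcs G (Suc (n + 2))"
      using commutator_in_lcs_Suc'[OF W1in, of q1] commutator_in_lcs_Suc'[OF Vin, of q2]
        commutator_in_lcs_Suc'[OF W3in, of q3]
      by (auto simp: f'q commutator_def)
  qed simp
  have triv: "cls (n + 2) (inv (f' u) \<otimes> u) = cls (n + 2) \<one>" if u: "u \<in> lcs G (Suc n)" for u
    using lcs_mono[OF quot(3)[OF f' shift2 u], of "Suc (n + 2)"] by (simp add: cls_eq_oneI cls_one)
  have main: "cls (n + 2) (inv (f' u) \<otimes> z \<otimes> E u) = cls (n + 2) (z \<otimes> (inv u \<otimes> E u))"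
    if u: "u \<in> lcs G (Suc n)" for u
  proof -
    have uc [simp]: "u \<in> carrier G" using u by simp
    have "cls (n + 2) (inv (f' u) \<otimes> z \<otimes> E u) = cls (n + 2) (\<one> \<otimes> ((inv u \<otimes> z \<otimes> inv (inv u)) \<otimes> (inv u \<otimes> E u)))"
      unfolding split[OF uc] by (rule cls_mult_cong[OF triv[OF u] HOL.refl]) simp_all
    also have "\<dots> = cls (n + 2) ((inv u \<otimes> z \<otimes> inv (inv u)) \<otimes> (inv u \<otimes> E u))" by simp
    also have "\<dots> = cls (n + 2) (z \<otimes> (inv u \<otimes> E u))"
      by (rule cls_mult_cong[OF cls_conj[OF z] HOL.refl]) simp_all
    finally show ?thesis .
  qed
  have zX: "cls (n + 2) z = cls (n + 2) (X n \<lozenge> q3)"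
  proof -
    have "A W3 \<otimes> inv W3 \<in> lcs G (Suc (Suc n))"
      using endo_shifts_lcs[OF A_hom A_shift W(3)] by simp
    then have "cls (Suc n) (A W3) = cls (Suc n) W3" using cls_eq_iff[of "A W3" W3 "Suc (Suc n)"] by simp
    also note cW(3)
    finally have "cls (Suc n) (A W3) = cls (Suc n) (X n)" .
    then show ?thesis
      using commutator_cls_cong[OF AW3 X_lcs[of n], of q3 1 q3] by (simp add: z_def)
  qed
  have Xq: "X n \<lozenge> q3 \<in> lcs G (n + 2)" using commutator_in_lcs_Suc'[OF X_lcs[of n], of q3] by simp
  have Lw_Suc: "Lw (Suc n) (Suc n) = Lw (Suc n) n \<otimes> (X n \<lozenge> q3)" by (simp add: Lw.simps Y.simps(1))
  have "cls (n + 2) W1' = cls (n + 2) (z \<otimes> (inv W1 \<otimes> E W1))" unfolding W1'' by (rule main[OF W(1)])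
  also have "\<dots> = cls (n + 2) ((X n \<lozenge> q3) \<otimes> (inv (Lw n n) \<otimes> E (Lw n n)))"
    using endo_quotient_cong[OF E_hom E_shift W(1) Lw_lcs cW(1)] by (intro cls_mult_cong[OF zX]) simp_all
  also have "\<dots> = cls (n + 2) ((X n \<lozenge> q3) \<otimes> Lw (Suc n) n)"
    by (rule cls_mult_cong[OF HOL.refl E_Lw]) simp_all
  also have "\<dots> = cls (n + 2) (Lw (Suc n) (Suc n))"
    unfolding Lw_Suc by (rule cls_commute[OF Xq]) simp_all
  finally have c1: "cls (n + 2) W1' = cls (n + 2) (Lw (Suc n) (Suc n))" .
  let ?v = "Lw n n \<otimes> Y n" and ?D = "inv (Lw n n) \<otimes> E (Lw n n)"
  have D: "?D \<in> lcs G (n + 2)" using quot(1)[OF E_hom E_shift Lw_lcs[of n n]] by simp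
  have vin: "?v \<in> lcs G (Suc n)" by (intro lcs_intros(2) Lw_lcs Y_lcs) simp
  have veq: "inv ?v \<otimes> E ?v = (inv (Y n) \<otimes> ?D \<otimes> inv (inv (Y n))) \<otimes> Y (Suc n)"
    by (simp add: E_Y m_assoc inv_mult_group)
  have "cls (n + 2) V' = cls (n + 2) (z \<otimes> (inv V \<otimes> E V))" unfolding V'' by (rule main[OF W(2)])
  also have "\<dots> = cls (n + 2) ((X n \<lozenge> q3) \<otimes> (inv ?v \<otimes> E ?v))"
    using endo_quotient_cong[OF E_hom E_shift W(2) vin cW(2)] by (intro cls_mult_cong[OF zX]) simp_all
  also have "\<dots> = cls (n + 2) ((X n \<lozenge> q3) \<otimes> (?D \<otimes> Y (Suc n)))"
    unfolding veq by (intro cls_mult_cong[OF HOL.refl] cls_mult_cong[OF cls_conj[OF D] HOL.refl]) simp_all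
  also have "\<dots> = cls (n + 2) ((X n \<lozenge> q3) \<otimes> (Lw (Suc n) n \<otimes> Y (Suc n)))"
    by (intro cls_mult_cong[OF HOL.refl] cls_mult_cong[OF E_Lw HOL.refl]) simp_all
  also have "\<dots> = cls (n + 2) (((X n \<lozenge> q3) \<otimes> Lw (Suc n) n) \<otimes> Y (Suc n))" by (simp add: m_assoc)
  also have "\<dots> = cls (n + 2) (Lw (Suc n) (Suc n) \<otimes> Y (Suc n))"
    unfolding Lw_Suc by (rule cls_mult_cong[OF cls_commute[OF Xq] HOL.refl]) simp_all
  finally have c2: "cls (n + 2) V' = cls (n + 2) (Lw (Suc n) (Suc n) \<otimes> Y (Suc n))" .
  have "W3' = (inv (f' W3) \<otimes> W3) \<otimes> (inv W3 \<otimes> A W3)" by (simp add: W3' m_assoc)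
  then have "cls (n + 2) W3' = cls (n + 2) (\<one> \<otimes> (inv (X n) \<otimes> A (X n)))"
    using endo_quotient_cong[OF A_hom A_shift W(3) X_lcs cW(3)]
    by (simp only:) (rule cls_mult_cong[OF triv[OF W(3)]], simp_all)
  also have "\<dots> = cls (n + 2) (X (Suc n))" by (simp add: A_X X.simps m_assoc)
  finally have c3: "cls (n + 2) W3' = cls (n + 2) (X (Suc n))" .
  show ?thesis using W1in Vin W3in c1 c2 c3 by blast
qed

end


section \<open>Automorphisms of the surface group\<close>

lemma free_group_sel [simp]:
  "u \<otimes>\<^bsub>free_group T\<^esub> v = foldr push_letter u v" "\<one>\<^bsub>free_group T\<^esub> = []"
  by (simp_all add: free_group_def)

lemma free_group_carrier: "w \<in> carrier (free_group T) \<longleftrightarrow> fst ` set w \<subseteq> T \<and> reduced w"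
  by (simp add: free_group_def)

lemma free_group_Cons:
  assumes "l # w \<in> carrier (free_group T)"
  shows "[l] \<in> carrier (free_group T)" "w \<in> carrier (free_group T)"
    "l # w = [l] \<otimes>\<^bsub>free_group T\<^esub> w"
  using assms by (cases w; auto simp: free_group_carrier dest: reduced_tl)+

lemma free_group_inv_letter:
  assumes "a \<in> T" shows "inv\<^bsub>free_group T\<^esub> [(a, False)] = [(a, True)]"
  using assms
  by (intro group.inv_equality[OF group_free_group]) (auto simp: free_group_carrier letter_inv_def)

lemma free_group_hom_eqI:
  assumes "group G" "f \<in> hom (free_group T) G" "h \<in> hom (free_group T) G"
    and eq: "\<And>a. a \<in> T \<Longrightarrow> f [(a, False)] = h [(a, False)]" and "w \<in> carrier (free_group T)"
  shows "f w = h w"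
proof -
  interpret F: group "free_group T" by (rule group_free_group)
  interpret G: group G by fact
  interpret f: group_hom "free_group T" G f using assms by unfold_locales
  interpret h: group_hom "free_group T" G h using assms by unfold_locales
  have letter: "f [l] = h [l]" if l: "[l] \<in> carrier (free_group T)" for l
  proof -
    obtain a e where [simp]: "l = (a, e)" by (cases l)
    have a: "a \<in> T" using l by (simp add: free_group_carrier)
    then have "[(a, False)] \<in> carrier (free_group T)" by (simp add: free_group_carrier)
    then have "f (inv\<^bsub>free_group T\<^esub> [(a, False)]) = h (inv\<^bsub>free_group T\<^esub> [(a, False)])"
      using eq[OF a] by simp
    then show ?thesis using eq[OF a] by (cases e) (simp_all add: free_group_inv_letter[OF a])
  qed
  show ?thesis
    using assms(5)
  proof (induction w)
    case Nil
    then show ?case using f.hom_one h.hom_one by simp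
  next
    case (Cons l w)
    note c = free_group_Cons[OF Cons.prems]
    have "f ([l] \<otimes>\<^bsub>free_group T\<^esub> w) = h ([l] \<otimes>\<^bsub>free_group T\<^esub> w)"
      using c letter Cons.IH by (simp del: free_group_sel)
    then show ?case using c(3) by simp
  qed
qed

primrec word_map :: "('b, 'm) monoid_scheme \<Rightarrow> ('a \<Rightarrow> 'b) \<Rightarrow> 'a letter list \<Rightarrow> 'b" where
  "word_map G h [] = \<one>\<^bsub>G\<^esub>"
| "word_map G h (l # w) =
     (if snd l then inv\<^bsub>G\<^esub> (h (fst l)) else h (fst l)) \<otimes>\<^bsub>G\<^esub> word_map G h w"

lemma word_map_hom:
  assumes "group G" and h: "\<And>a. a \<in> T \<Longrightarrow> h a \<in> carrier G"
  shows "word_map G h \<in> hom (free_group T) G"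
proof (rule homI)
  interpret G: group G by fact
  have closed: "fst ` set w \<subseteq> T \<Longrightarrow> word_map G h w \<in> carrier G" for w
    using h by (induction w) auto
  then show "word_map G h w \<in> carrier G" if "w \<in> carrier (free_group T)" for w
    using that by (simp add: free_group_carrier)
  have push: "word_map G h (push_letter l w) = word_map G h (l # w)" if "fst l \<in> T" "fst ` set w \<subseteq> T" for l w
  proof (cases "\<exists>ys. w = letter_inv l # ys")
    case True
    then obtain ys where w: "w = letter_inv l # ys" by blast
    then have "word_map G h ys \<in> carrier G" using that closed by simp
    then show ?thesis using h that by (cases l) (simp add: w letter_inv_def)
  next
    case False
    then have "push_letter l w = l # w" by (cases w) auto
    then show ?thesis by simp
  qed
  have "word_map G h (foldr push_letter u v) = word_map G h u \<otimes>\<^bsub>G\<^esub> word_map G h v"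
    if "fst ` set u \<subseteq> T" "fst ` set v \<subseteq> T" for u v
    using that(1)
  proof (induction u)
    case Nil
    then show ?case using closed that by simp
  next
    case (Cons l u)
    have "fst ` set (foldr push_letter u v) \<subseteq> fst ` set u \<union> fst ` set v"
      using image_mono[OF set_foldr_push[of u v], of fst] by (simp add: image_Un)
    also have "\<dots> \<subseteq> T" using Cons.prems that(2) by simp
    finally have "word_map G h (foldr push_letter (l # u) v) = word_map G h (l # foldr push_letter u v)"
      using push Cons.prems by simp
    also have "\<dots> = word_map G h (l # u) \<otimes>\<^bsub>G\<^esub> word_map G h v"
      using Cons closed[of u] closed[of v] h that by (simp add: G.m_assoc)
    finally show ?case .
  qed
  then show "word_map G h (u \<otimes>\<^bsub>free_group T\<^esub> v) = word_map G h u \<otimes>\<^bsub>G\<^esub> word_map G h v"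
    if "u \<in> carrier (free_group T)" "v \<in> carrier (free_group T)" for u v
    using that by (simp add: free_group_carrier)
qed

context surface
begin

lemma surface_hom_eqI:
  assumes "group G" "f \<in> hom P G" "h \<in> hom P G"
    and "\<And>i. i \<in> {1..g} \<Longrightarrow> f (alpha i) = h (alpha i)" "\<And>i. i \<in> {1..g} \<Longrightarrow> f (beta i) = h (beta i)"
    and "x \<in> carrier P"
  shows "f x = h x"
proof (rule free_group_hom_eqI[OF assms(1)])
  show "f \<in> hom (free_group (Alpha ` {1..g} \<union> Beta ` {1..g})) G"
    "h \<in> hom (free_group (Alpha ` {1..g} \<union> Beta ` {1..g})) G"
    "x \<in> carrier (free_group (Alpha ` {1..g} \<union> Beta ` {1..g}))"
    using assms(2,3,6) by (simp_all only: P_def surface_group_def)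
  fix a assume "a \<in> Alpha ` {1..g} \<union> Beta ` {1..g}"
  then consider i where "i \<in> {1..g}" "a = Alpha i" | i where "i \<in> {1..g}" "a = Beta i" by blast
  then show "f [(a, False)] = h [(a, False)]"
    by cases (simp_all only: assms(4,5) flip: alpha_def beta_def)
qed

lemma surface_hom_exists:
  assumes "group G" "\<And>i. i \<in> {1..g} \<Longrightarrow> a i \<in> carrier G" "\<And>i. i \<in> {1..g} \<Longrightarrow> b i \<in> carrier G"
  obtains f where "f \<in> hom P G" "f \<in> extensional (carrier P)"
    "\<And>i. i \<in> {1..g} \<Longrightarrow> f (alpha i) = a i" "\<And>i. i \<in> {1..g} \<Longrightarrow> f (beta i) = b i"
proof -
  let ?h = "word_map G (case_surface_gen a b)"
  interpret G: group G by fact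
  have "?h \<in> hom P G"
    unfolding P_def surface_group_def by (rule word_map_hom[OF assms(1)]) (use assms(2,3) in auto)
  then have h: "restrict ?h (carrier P) \<in> hom P G" by (simp add: hom_restrict)
  have "restrict ?h (carrier P) (alpha i) = a i" "restrict ?h (carrier P) (beta i) = b i" if "i \<in> {1..g}" for i
    using assms(2,3)[OF that] alpha_beta_closed[OF that] by (simp_all add: alpha_def beta_def)
  then show thesis by (rule that[OF h restrict_extensional])
qed

lemma id_hom: "(\<lambda>x. x) \<in> hom P P" by (simp add: hom_def)

lemma hom_comp: "f \<in> hom P P \<Longrightarrow> h \<in> hom P P \<Longrightarrow> (\<lambda>x. f (h x)) \<in> hom P P"
  by (auto simp: hom_def)

abbreviation "boundary_factor i \<equiv> comm (inv\<^bsub>P\<^esub> (beta i)) (alpha i)"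

lemma zeta_eq: "zeta g = inv\<^bsub>P\<^esub> (foldr (\<lambda>i w. boundary_factor i \<otimes>\<^bsub>P\<^esub> w) [1..<g + 1] \<one>\<^bsub>P\<^esub>)"
  by (simp only: zeta_def Let_def flip: P_def)

end

section \<open>Mapping classes supported on the first two handles\<close>

locale surface2 = surface +
  assumes g: "g \<ge> 2"
begin

definition "a1 = alpha 1"
definition "b1 = beta 1"
definition "a2 = alpha 2"
definition "b2 = beta 2"

lemma gens12 [simp]: "a1 \<in> carrier P" "b1 \<in> carrier P" "a2 \<in> carrier P" "b2 \<in> carrier P"
  using g by (auto simp: a1_def b1_def a2_def b2_def intro!: alpha_beta_closed)

lemma index_cases:
  assumes "i \<in> {1..g}"
  obtains "i = 1" "alpha i = a1" "beta i = b1" | "i = 2" "alpha i = a2" "beta i = b2" | "i \<in> {3..g}"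
proof -
  have "i = 1 \<or> i = 2 \<or> i \<in> {3..g}" using assms by auto
  then show thesis using that by (auto simp: a1_def b1_def a2_def b2_def simp del: One_nat_def)
qed

abbreviation "c1 \<equiv> comm (inv\<^bsub>P\<^esub> b1) a1"
abbreviation "c2 \<equiv> comm (inv\<^bsub>P\<^esub> b2) a2"

text \<open>Since \<open>f\<close> fixes the generators of the remaining handles, only the first two
  factors of \<zeta>^-1 have to be checked; the inverse \<open>f'\<close>, tested on generators,
  gives bijectivity.\<close>

lemma mcgI:
  assumes f: "f \<in> hom P P" "f \<in> extensional (carrier P)" and f': "f' \<in> hom P P"
    and higher: "\<And>i. i \<in> {3..g} \<Longrightarrow> f (alpha i) = alpha i" "\<And>i. i \<in> {3..g} \<Longrightarrow> f (beta i) = beta i"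
      "\<And>i. i \<in> {3..g} \<Longrightarrow> f' (alpha i) = alpha i" "\<And>i. i \<in> {3..g} \<Longrightarrow> f' (beta i) = beta i"
    and inv1: "f (f' a1) = a1" "f (f' b1) = b1" "f (f' a2) = a2" "f (f' b2) = b2"
    and inv2: "f' (f a1) = a1" "f' (f b1) = b1" "f' (f a2) = a2" "f' (f b2) = b2"
    and c12: "f (c1 \<otimes>\<^bsub>P\<^esub> c2) = c1 \<otimes>\<^bsub>P\<^esub> c2"
  shows "f \<in> mapping_class_group g"
proof -
  interpret f: group_hom P P f using f by unfold_locales
  interpret f': group_hom P P f' using f' by unfold_locales
  have ff': "f (f' x) = x" if "x \<in> carrier P" for x
  proof (rule surface_hom_eqI[OF is_group hom_comp[OF f(1) f'] id_hom _ _ that])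
    fix i assume "i \<in> {1..g}"
    then show "f (f' (alpha i)) = alpha i" "f (f' (beta i)) = beta i"
      by (cases rule: index_cases; simp add: inv1 higher)+
  qed
  have f'f: "f' (f x) = x" if "x \<in> carrier P" for x
  proof (rule surface_hom_eqI[OF is_group hom_comp[OF f' f(1)] id_hom _ _ that])
    fix i assume "i \<in> {1..g}"
    then show "f' (f (alpha i)) = alpha i" "f' (f (beta i)) = beta i"
      by (cases rule: index_cases; simp add: inv2 higher)+
  qed
  have "bij_betw f (carrier P) (carrier P)"
    by (rule bij_betwI[where g = f']) (auto simp: ff' f'f)
  then have B: "f \<in> Bij (carrier P)" using f by (simp add: Bij_def)
  let ?F = "\<lambda>is. foldr (\<lambda>i w. boundary_factor i \<otimes>\<^bsub>P\<^esub> w) is \<one>\<^bsub>P\<^esub>"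
  have F: "?F is \<in> carrier P \<and> f (?F is) = ?F is" if "set is \<subseteq> {3..g}" for "is"
    using that higher by (induction "is") (auto simp: commutator_def)
  have "[1..<g + 1] = 1 # 2 # [3..<g + 1]"
    using g by (simp add: upt_rec numeral_2_eq_2 numeral_3_eq_3)
  then have "?F [1..<g + 1] = boundary_factor 1 \<otimes>\<^bsub>P\<^esub> (boundary_factor 2 \<otimes>\<^bsub>P\<^esub> ?F [3..<g + 1])"
    by (simp only: foldr_Cons comp_apply)
  moreover have "set [3..<g + 1] \<subseteq> {3..g}" by auto
  then obtain Z where Z: "Z = ?F [3..<g + 1]" "Z \<in> carrier P" "f Z = Z" using F by blast
  ultimately have Feq: "?F [1..<g + 1] = (c1 \<otimes>\<^bsub>P\<^esub> c2) \<otimes>\<^bsub>P\<^esub> Z"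
    unfolding Z(1)[symmetric] a1_def[symmetric] b1_def[symmetric] a2_def[symmetric] b2_def[symmetric]
    using Z(2) by (simp only: m_assoc commutator_closed inv_closed gens12)
  have "f ((c1 \<otimes>\<^bsub>P\<^esub> c2) \<otimes>\<^bsub>P\<^esub> Z) = (c1 \<otimes>\<^bsub>P\<^esub> c2) \<otimes>\<^bsub>P\<^esub> Z"
    by (subst f.hom_mult) (use Z c12 in simp_all)
  then have "f (zeta g) = zeta g"
    unfolding zeta_eq Feq using Z by (subst f.hom_inv) simp_all
  then show ?thesis using f B by (simp add: mapping_class_group_iff)
qed

text \<open>Loops around three strands; the product \<open>q1 q2 q3\<close> is fixed by the braids below.\<close>

definition "q1 = inv\<^bsub>P\<^esub> a1"
definition "q2 = inv\<^bsub>P\<^esub> b2 \<otimes>\<^bsub>P\<^esub> a2 \<otimes>\<^bsub>P\<^esub> b2"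
definition "q3 = inv\<^bsub>P\<^esub> a2"
definition "mm = q1 \<otimes>\<^bsub>P\<^esub> q2"
text \<open>The maps \<open>A\<close> and \<open>B\<close> below act nontrivially on H;
  \<open>A\<close> for instance multiplies \<open>b1\<close> by \<open>mm\<close>. On this subgroup
  they only conjugate the generators, hence act trivially on its abelianization, which is what the
  estimates of \<open>strands\<close> rest on.\<close>

definition "Sset = generate P {q1, q2, q3}"
definition "SS = P\<lparr>carrier := Sset\<rparr>"

lemma q_in_P [simp]: "q1 \<in> carrier P" "q2 \<in> carrier P" "q3 \<in> carrier P" "mm \<in> carrier P"
  by (simp_all add: q1_def q2_def q3_def mm_def)

lemma Sset_subgroup: "subgroup Sset P"
  unfolding Sset_def by (rule generate_is_subgroup) simp

lemma Sset_closed [simp]: "x \<in> Sset \<Longrightarrow> x \<in> carrier P"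
  using subgroup.mem_carrier[OF Sset_subgroup] .

lemma Sset_intros [simp, intro]:
  "q1 \<in> Sset" "q2 \<in> Sset" "q3 \<in> Sset" "mm \<in> Sset"
  "x \<in> Sset \<Longrightarrow> y \<in> Sset \<Longrightarrow> x \<otimes>\<^bsub>P\<^esub> y \<in> Sset" "x \<in> Sset \<Longrightarrow> inv\<^bsub>P\<^esub> x \<in> Sset"
proof -
  show *: "q1 \<in> Sset" "q2 \<in> Sset" "q3 \<in> Sset" by (auto simp: Sset_def intro: generate.incl)
  show "x \<in> Sset \<Longrightarrow> y \<in> Sset \<Longrightarrow> x \<otimes>\<^bsub>P\<^esub> y \<in> Sset" for x y using subgroup.m_closed[OF Sset_subgroup] .
  then show "mm \<in> Sset" using * by (simp add: mm_def)
  show "x \<in> Sset \<Longrightarrow> inv\<^bsub>P\<^esub> x \<in> Sset" using subgroup.m_inv_closed[OF Sset_subgroup] .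
qed

sublocale SS: group SS
  unfolding SS_def by (rule subgroup.subgroup_is_group[OF Sset_subgroup is_group])

lemma SS_sel [simp]: "carrier SS = Sset" "monoid.mult SS = monoid.mult P" "one SS = one P"
  by (simp_all add: SS_def)

lemma SS_inv [simp]: "x \<in> Sset \<Longrightarrow> inv\<^bsub>SS\<^esub> x = inv\<^bsub>P\<^esub> x"
  unfolding SS_def by (rule m_inv_consistent[OF Sset_subgroup])

lemma hom_into_SS:
  assumes f: "f \<in> hom P P" and q: "f q1 \<in> Sset" "f q2 \<in> Sset" "f q3 \<in> Sset"
  shows "f \<in> hom SS SS"
proof -
  interpret f: group_hom P P f using f by unfold_locales
  have "f ` Sset = generate P (f ` {q1, q2, q3})"
    unfolding Sset_def by (rule f.generate_img[symmetric]) simp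
  also have "\<dots> \<subseteq> Sset" using q by (intro generate_subgroup_incl[OF _ Sset_subgroup]) auto
  finally show ?thesis using f by (auto simp: hom_def)
qed

text \<open>The mapping classes supported on the first two handles which act on \<open>Sset\<close> like framed braids.\<close>

definition braids where
  "braids = {f \<in> mapping_class_group g. f ` Sset = Sset \<and> f (mm \<otimes>\<^bsub>P\<^esub> q3) = mm \<otimes>\<^bsub>P\<^esub> q3 \<and>
     (\<forall>i\<in>{3..g}. f (alpha i) = alpha i \<and> f (beta i) = beta i)}"

lemma braids_compose:
  assumes "f \<in> braids" "h \<in> braids" shows "compose (carrier P) f h \<in> braids"
proof -
  have "compose (carrier P) f h ` Sset = f ` h ` Sset"
    unfolding image_image by (rule image_cong) (simp_all add: compose_eq)
  then show ?thesis
    using assms mcg_compose[of f h] by (simp add: braids_def compose_eq)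
qed

lemma braids_inverse:
  assumes f: "f \<in> braids"
  obtains f' where "f' \<in> braids"
    "\<And>x. x \<in> carrier P \<Longrightarrow> f' (f x) = x" "\<And>x. x \<in> carrier P \<Longrightarrow> f (f' x) = x"
proof -
  have fm: "f \<in> mapping_class_group g" using f by (simp add: braids_def)
  obtain f' where f': "f' \<in> mapping_class_group g"
    "\<And>x. x \<in> carrier P \<Longrightarrow> f' (f x) = x" "\<And>x. x \<in> carrier P \<Longrightarrow> f (f' x) = x"
    using mcg_inverse[OF fm] by blast
  have "f' ` f ` Sset = Sset" unfolding image_image by (simp add: f'(2))
  then have "f' ` Sset = Sset" using f by (simp add: braids_def)
  moreover have "f' (mm \<otimes>\<^bsub>P\<^esub> q3) = mm \<otimes>\<^bsub>P\<^esub> q3" using f f'(2)[of "mm \<otimes>\<^bsub>P\<^esub> q3"] by (simp add: braids_def)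
  moreover have "f' (alpha i) = alpha i \<and> f' (beta i) = beta i" if "i \<in> {3..g}" for i
    using f f'(2)[of "alpha i"] f'(2)[of "beta i"] that by (simp add: braids_def)
  ultimately have "f' \<in> braids" using f'(1) by (simp add: braids_def)
  then show thesis using f'(2,3) by (rule that)
qed

lemma braids_hom: "f \<in> braids \<Longrightarrow> group_hom P P f"
  by (simp add: group_hom_def group_hom_axioms_def is_group braids_def mapping_class_group_iff)

lemma image_SsetI:
  assumes f: "f \<in> hom SS SS" and q: "q1 \<in> f ` Sset" "q2 \<in> f ` Sset" "q3 \<in> f ` Sset"
  shows "f ` Sset = Sset"
proof
  interpret f: group_hom SS SS f using f by unfold_locales
  show "f ` Sset \<subseteq> Sset" using f by (auto simp: hom_def)
  have "subgroup (f ` Sset) SS" using f.img_is_subgroup by simp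
  then have "subgroup (f ` Sset) P"
    unfolding SS_def by (rule incl_subgroup[OF Sset_subgroup])
  moreover have "{q1, q2, q3} \<subseteq> f ` Sset" using q by simp
  ultimately show "Sset \<subseteq> f ` Sset"
    using generate_subgroup_incl[of "{q1, q2, q3}" "f ` Sset"] Sset_def by simp
qed

lemma exists_A:
  obtains A where "A \<in> braids" "A a1 = mm \<otimes>\<^bsub>P\<^esub> a1 \<otimes>\<^bsub>P\<^esub> inv\<^bsub>P\<^esub> mm" "A b1 = mm \<otimes>\<^bsub>P\<^esub> b1" "A a2 = a2"
    "A b2 = b2 \<otimes>\<^bsub>P\<^esub> inv\<^bsub>P\<^esub> mm"
proof -
  \<comment> \<open>The same shape serves twice, for w = \<open>mm\<close> and for its inverse; the
    two maps are mutually inverse because both fix \<open>mm\<close>.\<close>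
  have ex: "\<exists>A. A \<in> hom P P \<and> A \<in> extensional (carrier P) \<and> A a1 = w \<otimes>\<^bsub>P\<^esub> a1 \<otimes>\<^bsub>P\<^esub> inv\<^bsub>P\<^esub> w \<and> A b1 = w \<otimes>\<^bsub>P\<^esub> b1 \<and>
    A a2 = a2 \<and> A b2 = b2 \<otimes>\<^bsub>P\<^esub> inv\<^bsub>P\<^esub> w \<and> (\<forall>i\<in>{3..g}. A (alpha i) = alpha i \<and> A (beta i) = beta i)"
    if w: "w \<in> carrier P" for w
  proof -
    obtain A where "A \<in> hom P P" "A \<in> extensional (carrier P)"
      "\<And>i. i \<in> {1..g} \<Longrightarrow> A (alpha i) = (if i = 1 then w \<otimes>\<^bsub>P\<^esub> a1 \<otimes>\<^bsub>P\<^esub> inv\<^bsub>P\<^esub> w else alpha i)"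
      "\<And>i. i \<in> {1..g} \<Longrightarrow> A (beta i) = (if i = 1 then w \<otimes>\<^bsub>P\<^esub> b1 else if i = 2 then b2 \<otimes>\<^bsub>P\<^esub> inv\<^bsub>P\<^esub> w else beta i)"
      by (rule surface_hom_exists[of P "\<lambda>i. if i = 1 then w \<otimes>\<^bsub>P\<^esub> a1 \<otimes>\<^bsub>P\<^esub> inv\<^bsub>P\<^esub> w else alpha i"
            "\<lambda>i. if i = 1 then w \<otimes>\<^bsub>P\<^esub> b1 else if i = 2 then b2 \<otimes>\<^bsub>P\<^esub> inv\<^bsub>P\<^esub> w else beta i"])
        (use w is_group in auto)
    then show ?thesis using g by (intro exI[of _ A]) (auto simp: a1_def b1_def a2_def b2_def)
  qed
  obtain A where A: "A \<in> hom P P" "A \<in> extensional (carrier P)" "A a1 = mm \<otimes>\<^bsub>P\<^esub> a1 \<otimes>\<^bsub>P\<^esub> inv\<^bsub>P\<^esub> mm" "A b1 = mm \<otimes>\<^bsub>P\<^esub> b1"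
    "A a2 = a2" "A b2 = b2 \<otimes>\<^bsub>P\<^esub> inv\<^bsub>P\<^esub> mm" "\<forall>i\<in>{3..g}. A (alpha i) = alpha i \<and> A (beta i) = beta i"
    using ex[of mm] by auto
  obtain A' where A': "A' \<in> hom P P" "A' a1 = inv\<^bsub>P\<^esub> mm \<otimes>\<^bsub>P\<^esub> a1 \<otimes>\<^bsub>P\<^esub> mm" "A' b1 = inv\<^bsub>P\<^esub> mm \<otimes>\<^bsub>P\<^esub> b1"
    "A' a2 = a2" "A' b2 = b2 \<otimes>\<^bsub>P\<^esub> mm" "\<forall>i\<in>{3..g}. A' (alpha i) = alpha i \<and> A' (beta i) = beta i"
    using ex[of "inv\<^bsub>P\<^esub> mm"] by auto
  interpret A: group_hom P P A using A by unfold_locales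
  interpret A': group_hom P P A' using A' by unfold_locales
  have Aq: "A q1 = mm \<otimes>\<^bsub>P\<^esub> q1 \<otimes>\<^bsub>P\<^esub> inv\<^bsub>P\<^esub> mm" "A q2 = mm \<otimes>\<^bsub>P\<^esub> q2 \<otimes>\<^bsub>P\<^esub> inv\<^bsub>P\<^esub> mm" "A q3 = q3"
    using A by (simp_all add: q1_def q2_def q3_def m_assoc inv_mult_group)
  have A'q: "A' q1 = inv\<^bsub>P\<^esub> mm \<otimes>\<^bsub>P\<^esub> q1 \<otimes>\<^bsub>P\<^esub> mm" "A' q2 = inv\<^bsub>P\<^esub> mm \<otimes>\<^bsub>P\<^esub> q2 \<otimes>\<^bsub>P\<^esub> mm"
    using A' by (simp_all add: q1_def q2_def m_assoc inv_mult_group)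
  have "A mm = A q1 \<otimes>\<^bsub>P\<^esub> A q2" by (simp add: mm_def)
  also have "\<dots> = mm \<otimes>\<^bsub>P\<^esub> (q1 \<otimes>\<^bsub>P\<^esub> q2) \<otimes>\<^bsub>P\<^esub> inv\<^bsub>P\<^esub> mm" unfolding Aq by (simp add: m_assoc)
  also have "\<dots> = mm" unfolding mm_def[symmetric] by (simp add: m_assoc)
  finally have Am: "A mm = mm" .
  have "A' mm = A' q1 \<otimes>\<^bsub>P\<^esub> A' q2" by (simp add: mm_def)
  also have "\<dots> = inv\<^bsub>P\<^esub> mm \<otimes>\<^bsub>P\<^esub> (q1 \<otimes>\<^bsub>P\<^esub> q2) \<otimes>\<^bsub>P\<^esub> mm" unfolding A'q by (simp add: m_assoc)
  also have "\<dots> = mm" unfolding mm_def[symmetric] by (simp add: m_assoc)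
  finally have A'm: "A' mm = mm" .
  \<comment> \<open>Each of the three factors is fixed by \<open>A\<close>, which explains the
    values chosen on \<open>b1\<close> and \<open>b2\<close>.\<close>
  have "c1 \<otimes>\<^bsub>P\<^esub> c2 = (inv\<^bsub>P\<^esub> b1 \<otimes>\<^bsub>P\<^esub> a1 \<otimes>\<^bsub>P\<^esub> b1) \<otimes>\<^bsub>P\<^esub> mm \<otimes>\<^bsub>P\<^esub> inv\<^bsub>P\<^esub> a2"
    by (simp add: mm_def q1_def q2_def word_simps)
  then have c12: "A (c1 \<otimes>\<^bsub>P\<^esub> c2) = c1 \<otimes>\<^bsub>P\<^esub> c2"
    using A by (simp add: Am m_assoc inv_mult_group)
  have "A \<in> mapping_class_group g"
    by (rule mcgI[OF A(1,2) A'(1) _ _ _ _ _ _ _ _ _ _ _ _ c12])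
      (use A A' in \<open>simp_all add: Am A'm m_assoc inv_mult_group\<close>)
  moreover have "A \<in> hom SS SS" by (rule hom_into_SS[OF A(1)]) (simp_all add: Aq)
  then have "A ` Sset = Sset"
  proof (rule image_SsetI)
    have "A (inv\<^bsub>P\<^esub> mm \<otimes>\<^bsub>P\<^esub> x \<otimes>\<^bsub>P\<^esub> mm) = x" if "x \<in> carrier P" "A x = mm \<otimes>\<^bsub>P\<^esub> x \<otimes>\<^bsub>P\<^esub> inv\<^bsub>P\<^esub> mm" for x
      using that by (simp add: Am m_assoc)
    then have eqs: "A (inv\<^bsub>P\<^esub> mm \<otimes>\<^bsub>P\<^esub> q1 \<otimes>\<^bsub>P\<^esub> mm) = q1" "A (inv\<^bsub>P\<^esub> mm \<otimes>\<^bsub>P\<^esub> q2 \<otimes>\<^bsub>P\<^esub> mm) = q2" "A (q3) = q3"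
      using Aq by simp_all
    show "q1 \<in> A ` Sset" by (subst eqs(1)[symmetric], rule imageI, intro Sset_intros)
    show "q2 \<in> A ` Sset" by (subst eqs(2)[symmetric], rule imageI, intro Sset_intros)
    show "q3 \<in> A ` Sset" by (subst eqs(3)[symmetric], rule imageI, intro Sset_intros)
  qed
  ultimately have "A \<in> braids" using A Am Aq by (simp add: braids_def)
  then show thesis using that A by blast
qed

lemma exists_B:
  obtains B where "B \<in> braids" "B a1 = a1" "B b1 = b1" "B a2 = q2 \<otimes>\<^bsub>P\<^esub> a2 \<otimes>\<^bsub>P\<^esub> inv\<^bsub>P\<^esub> q2"
    "B b2 = q2 \<otimes>\<^bsub>P\<^esub> b2 \<otimes>\<^bsub>P\<^esub> inv\<^bsub>P\<^esub> (q2 \<otimes>\<^bsub>P\<^esub> q3 \<otimes>\<^bsub>P\<^esub> inv\<^bsub>P\<^esub> q2)"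
proof -
  have ex: "\<exists>A. A \<in> hom P P \<and> A \<in> extensional (carrier P) \<and> A a1 = a1 \<and> A b1 = b1 \<and>
    A a2 = u \<and> A b2 = v \<and> (\<forall>i\<in>{3..g}. A (alpha i) = alpha i \<and> A (beta i) = beta i)"
    if w: "u \<in> carrier P" "v \<in> carrier P" for u v
  proof -
    obtain A where "A \<in> hom P P" "A \<in> extensional (carrier P)"
      "\<And>i. i \<in> {1..g} \<Longrightarrow> A (alpha i) = (if i = 2 then u else alpha i)"
      "\<And>i. i \<in> {1..g} \<Longrightarrow> A (beta i) = (if i = 2 then v else beta i)"
      by (rule surface_hom_exists[of P "\<lambda>i. if i = 2 then u else alpha i" "\<lambda>i. if i = 2 then v else beta i"])
        (use w is_group in auto)
    then show ?thesis using g by (intro exI[of _ A]) (auto simp: a1_def b1_def a2_def b2_def)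
  qed
  \<comment> \<open>\<open>B\<close> acts like the full twist of the last two strands, conjugation
    by their product \<open>c\<close>, which is also the second factor of \<zeta>^-1.\<close>
  define c where "c = q2 \<otimes>\<^bsub>P\<^esub> q3"
  have c [simp]: "c \<in> carrier P" "c \<in> Sset" by (simp_all add: c_def)
  have c_eq: "c = c2" by (simp add: c_def q2_def q3_def word_simps)
  \<comment> \<open>\<open>p\<close> and \<open>a\<close> will be the preimages of \<open>q2\<close>
    and \<open>a2\<close> under \<open>B\<close>; they serve to write down its inverse.\<close>
  define p where "p = inv\<^bsub>P\<^esub> c \<otimes>\<^bsub>P\<^esub> q2 \<otimes>\<^bsub>P\<^esub> c"
  define a where "a = inv\<^bsub>P\<^esub> c \<otimes>\<^bsub>P\<^esub> a2 \<otimes>\<^bsub>P\<^esub> c"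
  have pa [simp]: "p \<in> carrier P" "a \<in> carrier P" by (simp_all add: p_def a_def)
  obtain B where B: "B \<in> hom P P" "B \<in> extensional (carrier P)" "B a1 = a1" "B b1 = b1"
    "B a2 = c \<otimes>\<^bsub>P\<^esub> a2 \<otimes>\<^bsub>P\<^esub> inv\<^bsub>P\<^esub> c" "B b2 = q2 \<otimes>\<^bsub>P\<^esub> b2 \<otimes>\<^bsub>P\<^esub> inv\<^bsub>P\<^esub> (q2 \<otimes>\<^bsub>P\<^esub> q3 \<otimes>\<^bsub>P\<^esub> inv\<^bsub>P\<^esub> q2)"
    "\<forall>i\<in>{3..g}. B (alpha i) = alpha i \<and> B (beta i) = beta i"
    using ex[of "c \<otimes>\<^bsub>P\<^esub> a2 \<otimes>\<^bsub>P\<^esub> inv\<^bsub>P\<^esub> c" "q2 \<otimes>\<^bsub>P\<^esub> b2 \<otimes>\<^bsub>P\<^esub> inv\<^bsub>P\<^esub> (q2 \<otimes>\<^bsub>P\<^esub> q3 \<otimes>\<^bsub>P\<^esub> inv\<^bsub>P\<^esub> q2)"] by auto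
  obtain B' where B': "B' \<in> hom P P" "B' a1 = a1" "B' b1 = b1"
    "B' a2 = a" "B' b2 = inv\<^bsub>P\<^esub> p \<otimes>\<^bsub>P\<^esub> b2 \<otimes>\<^bsub>P\<^esub> (p \<otimes>\<^bsub>P\<^esub> inv\<^bsub>P\<^esub> a \<otimes>\<^bsub>P\<^esub> inv\<^bsub>P\<^esub> p)"
    "\<forall>i\<in>{3..g}. B' (alpha i) = alpha i \<and> B' (beta i) = beta i"
    using ex[of a "inv\<^bsub>P\<^esub> p \<otimes>\<^bsub>P\<^esub> b2 \<otimes>\<^bsub>P\<^esub> (p \<otimes>\<^bsub>P\<^esub> inv\<^bsub>P\<^esub> a \<otimes>\<^bsub>P\<^esub> inv\<^bsub>P\<^esub> p)"] by auto
  interpret B: group_hom P P B using B by unfold_locales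
  interpret B': group_hom P P B' using B' by unfold_locales
  have a2_q2: "a2 = b2 \<otimes>\<^bsub>P\<^esub> q2 \<otimes>\<^bsub>P\<^esub> inv\<^bsub>P\<^esub> b2" by (simp add: q2_def m_assoc)
  \<comment> \<open>\<open>q3\<close> is the inverse of \<open>a2\<close>, so conjugating
    \<open>a2\<close> by \<open>c\<close> or by \<open>q2\<close> is the same. With the shorter form
    the third conjugator starts at \<open>X 0\<close>.\<close>
  have ca: "c \<otimes>\<^bsub>P\<^esub> a2 \<otimes>\<^bsub>P\<^esub> inv\<^bsub>P\<^esub> c = q2 \<otimes>\<^bsub>P\<^esub> a2 \<otimes>\<^bsub>P\<^esub> inv\<^bsub>P\<^esub> q2"
    by (simp add: c_def q3_def m_assoc inv_mult_group)
  have Bq: "B q1 = q1" "B q3 = c \<otimes>\<^bsub>P\<^esub> q3 \<otimes>\<^bsub>P\<^esub> inv\<^bsub>P\<^esub> c" "B q2 = c \<otimes>\<^bsub>P\<^esub> q2 \<otimes>\<^bsub>P\<^esub> inv\<^bsub>P\<^esub> c"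
  proof -
    show "B q1 = q1" by (simp add: q1_def B)
    show "B q3 = c \<otimes>\<^bsub>P\<^esub> q3 \<otimes>\<^bsub>P\<^esub> inv\<^bsub>P\<^esub> c" by (simp add: q3_def B m_assoc inv_mult_group)
    have "B q2 = inv\<^bsub>P\<^esub> (B b2) \<otimes>\<^bsub>P\<^esub> (q2 \<otimes>\<^bsub>P\<^esub> a2 \<otimes>\<^bsub>P\<^esub> inv\<^bsub>P\<^esub> q2) \<otimes>\<^bsub>P\<^esub> B b2"
    proof -
      have "B q2 = inv\<^bsub>P\<^esub> (B b2) \<otimes>\<^bsub>P\<^esub> B a2 \<otimes>\<^bsub>P\<^esub> B b2" unfolding q2_def by simp
      then show ?thesis unfolding B(5) ca .
    qed
    also have "\<dots> = (q2 \<otimes>\<^bsub>P\<^esub> q3 \<otimes>\<^bsub>P\<^esub> inv\<^bsub>P\<^esub> q2) \<otimes>\<^bsub>P\<^esub> (inv\<^bsub>P\<^esub> b2 \<otimes>\<^bsub>P\<^esub> a2 \<otimes>\<^bsub>P\<^esub> b2) \<otimes>\<^bsub>P\<^esub> inv\<^bsub>P\<^esub> (q2 \<otimes>\<^bsub>P\<^esub> q3 \<otimes>\<^bsub>P\<^esub> inv\<^bsub>P\<^esub> q2)"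
      by (simp add: B(6) m_assoc inv_mult_group)
    also have "\<dots> = c \<otimes>\<^bsub>P\<^esub> q2 \<otimes>\<^bsub>P\<^esub> inv\<^bsub>P\<^esub> c"
      unfolding q2_def[symmetric] by (simp add: c_def m_assoc inv_mult_group)
    finally show "B q2 = c \<otimes>\<^bsub>P\<^esub> q2 \<otimes>\<^bsub>P\<^esub> inv\<^bsub>P\<^esub> c" .
  qed
  have "B c = B q2 \<otimes>\<^bsub>P\<^esub> B q3" by (simp add: c_def)
  also have "\<dots> = c \<otimes>\<^bsub>P\<^esub> (q2 \<otimes>\<^bsub>P\<^esub> q3) \<otimes>\<^bsub>P\<^esub> inv\<^bsub>P\<^esub> c" unfolding Bq by (simp add: m_assoc)
  also have "\<dots> = c" unfolding c_def[symmetric] by (simp add: m_assoc)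
  finally have Bc: "B c = c" .
  have Bp: "B p = q2" and Ba: "B a = a2" by (simp_all add: p_def a_def Bc Bq B(5) m_assoc)
  have B'q: "B' q3 = inv\<^bsub>P\<^esub> a" by (simp add: q3_def B')
  have B'q2: "B' q2 = p"
  proof -
    have "B' q2 = inv\<^bsub>P\<^esub> (B' b2) \<otimes>\<^bsub>P\<^esub> a \<otimes>\<^bsub>P\<^esub> B' b2" by (simp add: q2_def B'(4))
    also have "\<dots> = (p \<otimes>\<^bsub>P\<^esub> a \<otimes>\<^bsub>P\<^esub> inv\<^bsub>P\<^esub> p) \<otimes>\<^bsub>P\<^esub> inv\<^bsub>P\<^esub> b2 \<otimes>\<^bsub>P\<^esub> (p \<otimes>\<^bsub>P\<^esub> a \<otimes>\<^bsub>P\<^esub> inv\<^bsub>P\<^esub> p) \<otimes>\<^bsub>P\<^esub> b2 \<otimes>\<^bsub>P\<^esub> inv\<^bsub>P\<^esub> (p \<otimes>\<^bsub>P\<^esub> a \<otimes>\<^bsub>P\<^esub> inv\<^bsub>P\<^esub> p)"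
      by (simp add: B'(5) m_assoc inv_mult_group)
    also have "p \<otimes>\<^bsub>P\<^esub> a \<otimes>\<^bsub>P\<^esub> inv\<^bsub>P\<^esub> p = a2"
      by (simp add: p_def a_def c_def q3_def m_assoc inv_mult_group)
    also have "a2 \<otimes>\<^bsub>P\<^esub> inv\<^bsub>P\<^esub> b2 \<otimes>\<^bsub>P\<^esub> a2 \<otimes>\<^bsub>P\<^esub> b2 \<otimes>\<^bsub>P\<^esub> inv\<^bsub>P\<^esub> a2 = p"
      by (simp add: p_def c_def q3_def q2_def m_assoc inv_mult_group)
    finally show ?thesis .
  qed
  have B'c: "B' c = c"
    by (simp add: c_def B'q B'q2) (simp add: p_def a_def c_def q3_def m_assoc inv_mult_group)
  have c12: "B (c1 \<otimes>\<^bsub>P\<^esub> c2) = c1 \<otimes>\<^bsub>P\<^esub> c2"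
    unfolding c_eq[symmetric] using B by (simp add: Bc commutator_def)
  have "B \<in> mapping_class_group g"
  proof (rule mcgI[OF B(1,2) B'(1) _ _ _ _ _ _ _ _ _ _ _ _ c12])
    show "B' (B a2) = a2" by (simp add: B(5) B'c B'(4)) (simp add: a_def m_assoc)
    show "B (B' b2) = b2" by (simp add: B'(5) Bp Ba) (simp add: B(6) q3_def m_assoc inv_mult_group)
    show "B' (B b2) = b2" by (simp add: B(6) B'q B'q2) (simp add: B'(5) m_assoc inv_mult_group)
  qed (use B B' in \<open>simp_all add: Ba\<close>)
  moreover have "B \<in> hom SS SS" by (rule hom_into_SS[OF B(1)]) (simp_all add: Bq)
  then have "B ` Sset = Sset"
  proof (rule image_SsetI)
    have "B (inv\<^bsub>P\<^esub> c \<otimes>\<^bsub>P\<^esub> x \<otimes>\<^bsub>P\<^esub> c) = x" if "x \<in> carrier P" "B x = c \<otimes>\<^bsub>P\<^esub> x \<otimes>\<^bsub>P\<^esub> inv\<^bsub>P\<^esub> c" for x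
      using that by (simp add: Bc m_assoc)
    then have eqs: "B (q1) = q1" "B (inv\<^bsub>P\<^esub> c \<otimes>\<^bsub>P\<^esub> q2 \<otimes>\<^bsub>P\<^esub> c) = q2" "B (inv\<^bsub>P\<^esub> c \<otimes>\<^bsub>P\<^esub> q3 \<otimes>\<^bsub>P\<^esub> c) = q3"
      using Bq by simp_all
    show "q1 \<in> B ` Sset" by (subst eqs(1)[symmetric], rule imageI, intro Sset_intros c)
    show "q2 \<in> B ` Sset" by (subst eqs(2)[symmetric], rule imageI, intro Sset_intros c)
    show "q3 \<in> B ` Sset" by (subst eqs(3)[symmetric], rule imageI, intro Sset_intros c)
  qed
  moreover have "B (mm \<otimes>\<^bsub>P\<^esub> q3) = mm \<otimes>\<^bsub>P\<^esub> q3"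
  proof -
    have "mm \<otimes>\<^bsub>P\<^esub> q3 = q1 \<otimes>\<^bsub>P\<^esub> c" by (simp add: mm_def c_def m_assoc)
    then show ?thesis by (simp add: Bq Bc)
  qed
  ultimately have "B \<in> braids" using B by (simp add: braids_def)
  then show thesis using that[of B] B ca by simp
qed

end


section \<open>The doubled derivation is a Johnson image\<close>

lemma (in lcs_group) Ab_hom_exists:
  assumes K: "comm_group K" and f: "f \<in> hom G K"
  obtains v where "v \<in> hom Ab K" "\<And>x. x \<in> carrier G \<Longrightarrow> v (cls 1 x) = f x"
proof -
  interpret K: comm_group K by fact
  interpret f: group_hom G K f using f by unfold_locales
  have K2: "lcs K (Suc (Suc 0)) \<subseteq> {\<one>\<^bsub>K\<^esub>}"
  proof -
    have "commutator K x y = \<one>\<^bsub>K\<^esub>" if "x \<in> carrier K" "y \<in> carrier K" for x y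
      using that K.m_comm[of x y] by (simp add: commutator_def K.m_assoc)
    then have "{commutator K x y |x y. x \<in> carrier K \<and> y \<in> lcs K (Suc 0)} \<subseteq> {\<one>\<^bsub>K\<^esub>}" by auto
    then show ?thesis
      unfolding lcs.simps(3) using K.generate_subgroup_incl K.triv_subgroup by blast
  qed
  have eq: "f x = f y" if "x \<in> carrier G" "y \<in> carrier G" "cls 1 x = cls 1 y" for x y
  proof -
    have "x \<otimes> inv y \<in> lcs G (Suc (Suc 0))" using that cls_eq_iff[of x y "Suc 1"] by simp
    then have "f (x \<otimes> inv y) = \<one>\<^bsub>K\<^esub>" using hom_lcs[OF K.is_group f] K2 by blast
    then show ?thesis using that K.inv_equality by (metis K.inv_inv K.inv_closed f.hom_closed f.hom_inv f.hom_mult inv_closed)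
  qed
  define v where "v h = f (SOME x. x \<in> carrier G \<and> h = cls 1 x)" for h
  have v: "v (cls 1 x) = f x" if "x \<in> carrier G" for x
  proof -
    have "\<exists>y. y \<in> carrier G \<and> cls 1 x = cls 1 y" using that by blast
    then have "(SOME y. y \<in> carrier G \<and> cls 1 x = cls 1 y) \<in> carrier G \<and>
        cls 1 x = cls 1 (SOME y. y \<in> carrier G \<and> cls 1 x = cls 1 y)" by (rule someI_ex)
    then show ?thesis unfolding v_def using eq that by metis
  qed
  have "v \<in> hom Ab K"
  proof (rule homI)
    fix h assume "h \<in> carrier Ab"
    then obtain x where "x \<in> carrier G" "h = cls 1 x" by (rule Ab_cases)
    then show "v h \<in> carrier K" using v by (metis f.hom_closed)
  next
    fix h h' assume "h \<in> carrier Ab" "h' \<in> carrier Ab"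
    then obtain x y where xy: "x \<in> carrier G" "h = cls 1 x" "y \<in> carrier G" "h' = cls 1 y"
      by (metis Ab_cases)
    have "h \<otimes>\<^bsub>Ab\<^esub> h' = cls 1 (x \<otimes> y)"
      unfolding Ab_def xy lcs_quot_sel by (rule cls_mult) (use xy in simp_all)
    then show "v (h \<otimes>\<^bsub>Ab\<^esub> h') = v h \<otimes>\<^bsub>K\<^esub> v h'" using xy v by (metis f.hom_mult m_closed)
  qed
  then show thesis using that v by blast
qed

lemma (in lie_ring) bracket_bracket:
  assumes [simp]: "x \<in> carrier R" "y \<in> carrier R" "z \<in> carrier R"
  shows "bracket R x (bracket R y z) = bracket R (bracket R x y) z \<otimes> bracket R y (bracket R x z)"
proof -
  have "bracket R x (bracket R y z) \<otimes> (bracket R y (bracket R z x) \<otimes> bracket R z (bracket R x y)) = \<one>"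
    by (simp add: bracket_jacobi)
  moreover have "bracket R y (bracket R z x) = inv (bracket R y (bracket R x z))"
    by (simp add: bracket_swap[of x z] bracket_inv_right)
  moreover have "bracket R z (bracket R x y) = inv (bracket R (bracket R x y) z)"
    by (rule bracket_swap) simp_all
  ultimately have "bracket R x (bracket R y z) \<otimes> inv (bracket R (bracket R x y) z \<otimes> bracket R y (bracket R x z)) = \<one>"
    by (simp add: inv_mult m_comm)
  then show ?thesis
    by (metis assms bracket_closed inv_equality inv_inv m_closed inv_closed)
qed

lemma (in free_lie_ring) gen_Ldeg: "x \<in> carrier A \<Longrightarrow> gen x \<in> Ldeg 1"
  unfolding free_lie_gen_def by (intro Ldeg_lc homogeneous.intros) simp

lemma (in free_lie_ring) Ldeg_finprod:
  "(\<And>i. i \<in> I \<Longrightarrow> f i \<in> Ldeg k) \<Longrightarrow> finprod L f I \<in> Ldeg k"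
proof (induction I rule: infinite_finite_induct)
  case (insert i I)
  then have "f i \<in> carrier L" "f \<in> I \<rightarrow> carrier L" using Ldeg_closed[of "f _" k] by auto
  then show ?case using insert by (subst L.finprod_insert) (auto intro: Ldeg_mult)
qed (simp_all add: Ldeg_one)

lemma (in free_lie_ring) comm_group_Ldeg: "comm_group (L\<lparr>carrier := Ldeg k\<rparr>)"
proof -
  have "subgroup (Ldeg k) L"
    by (rule L.subgroupI) (use Ldeg_one in \<open>auto simp: Ldeg_closed Ldeg_inv Ldeg_mult\<close>)
  then show ?thesis
    by (intro group.group_comm_groupI subgroup.subgroup_is_group[OF _ L.is_group])
      (simp_all add: Ldeg_closed L.m_comm)
qed

context surface2
begin

text \<open>The words of \<open>strands\<close> written in \<open>P\<close> without an automorphism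
  \<open>A\<close> in the context; \<open>strands_XY\<close> identifies the two versions.\<close>

fun X where "X 0 = q2" | "X (Suc n) = inv\<^bsub>P\<^esub> (X n) \<otimes>\<^bsub>P\<^esub> mm \<otimes>\<^bsub>P\<^esub> X n \<otimes>\<^bsub>P\<^esub> inv\<^bsub>P\<^esub> mm"
fun Y where "Y 0 = q3" | "Y (Suc n) = inv\<^bsub>P\<^esub> (Y n) \<otimes>\<^bsub>P\<^esub> inv\<^bsub>P\<^esub> mm \<otimes>\<^bsub>P\<^esub> Y n \<otimes>\<^bsub>P\<^esub> mm"
fun Lw where "Lw n 0 = \<one>\<^bsub>P\<^esub>" | "Lw n (Suc r) = Lw n r \<otimes>\<^bsub>P\<^esub> comm (X r) (Y (n - Suc r))"

lemma XY_in_Sset [simp]: "X n \<in> Sset" "Y n \<in> Sset"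
  by (induction n) simp_all

lemma comm_SS [simp]: "x \<in> Sset \<Longrightarrow> y \<in> Sset \<Longrightarrow> commutator SS x y = comm x y"
  by (simp add: commutator_def)

lemma Lw_in_Sset [simp]: "Lw n r \<in> Sset"
  by (induction r) (simp_all add: subgroup.one_closed[OF Sset_subgroup] commutator_def)

lemma braids_Sset: assumes "f \<in> braids" "x \<in> Sset" shows "f x \<in> Sset"
proof -
  have "f ` Sset = Sset" using assms(1) by (simp add: braids_def)
  then show ?thesis using imageI[OF assms(2), of f] by (simp only:)
qed

lemma group_hom_Sset: assumes f: "f \<in> braids" shows "f \<in> hom SS SS"
proof -
  interpret f: group_hom P P f by (rule braids_hom[OF f])
  show ?thesis by (rule homI) (simp_all add: braids_Sset[OF f])
qed

lemma strands_SS: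
  assumes A: "A \<in> braids" "A a1 = mm \<otimes>\<^bsub>P\<^esub> a1 \<otimes>\<^bsub>P\<^esub> inv\<^bsub>P\<^esub> mm" "A a2 = a2" "A b2 = b2 \<otimes>\<^bsub>P\<^esub> inv\<^bsub>P\<^esub> mm"
  shows "strands SS q1 q2 q3 A"
proof -
  interpret A: group_hom P P A by (rule braids_hom[OF A(1)])
  have "generate SS {q1, q2, q3} = Sset"
  proof -
    have "{q1, q2, q3} \<subseteq> Sset" by simp
    from generate_consistent[OF this Sset_subgroup] show ?thesis by (simp only: SS_def Sset_def)
  qed
  moreover have "A q1 = mm \<otimes>\<^bsub>P\<^esub> q1 \<otimes>\<^bsub>P\<^esub> inv\<^bsub>P\<^esub> mm" "A q2 = mm \<otimes>\<^bsub>P\<^esub> q2 \<otimes>\<^bsub>P\<^esub> inv\<^bsub>P\<^esub> mm" "A q3 = q3"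
    using A(2-) by (simp_all add: q1_def q2_def q3_def m_assoc inv_mult_group)
  ultimately show ?thesis
    by unfold_locales (use group_hom_Sset[OF A(1)] in \<open>simp_all add: mm_def[symmetric]\<close>)
qed

lemma strands_XY:
  assumes "strands SS q1 q2 q3 A"
  shows "strands.X SS q1 q2 n = X n" "strands.Y SS q1 q2 q3 n = Y n" "strands.Lw SS q1 q2 q3 n r = Lw n r"
proof -
  interpret B: strands SS q1 q2 q3 A by fact
  have m: "B.m = mm" by (simp add: B.m_def mm_def)
  show X: "B.X n = X n" and Y: "B.Y n = Y n" for n
    by (induction n) (simp_all add: m)
  show "B.Lw n r = Lw n r" by (induction r) (simp_all add: X Y)
qed

text \<open>The conjugators of the three strands describe \<open>f\<close> on both handles:
  \<open>W1\<close> is also the left factor at \<open>b1\<close>, and \<open>V\<close> comes in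
  through q2 = b2^-1 a2 b2. The equations are kept exact in \<open>P\<close>, while the lower
  central estimates are made in \<open>SS\<close>.\<close>

lemma braid_exists:
  "\<exists>f\<in>braids. \<exists>W1 V W3. W1 \<in> lcs SS (Suc n) \<and> V \<in> lcs SS (Suc n) \<and> W3 \<in> lcs SS (Suc n) \<and>
     f a1 = W1 \<otimes>\<^bsub>P\<^esub> a1 \<otimes>\<^bsub>P\<^esub> inv\<^bsub>P\<^esub> W1 \<and> f b1 = W1 \<otimes>\<^bsub>P\<^esub> b1 \<and>
     f a2 = W3 \<otimes>\<^bsub>P\<^esub> a2 \<otimes>\<^bsub>P\<^esub> inv\<^bsub>P\<^esub> W3 \<and> f b2 = W3 \<otimes>\<^bsub>P\<^esub> b2 \<otimes>\<^bsub>P\<^esub> inv\<^bsub>P\<^esub> V \<and>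
     SS.cls (Suc n) W1 = SS.cls (Suc n) (Lw n n) \<and>
     SS.cls (Suc n) V = SS.cls (Suc n) (Lw n n \<otimes>\<^bsub>P\<^esub> Y n) \<and>
     SS.cls (Suc n) W3 = SS.cls (Suc n) (X n)"
proof (induction n)
  case 0
  obtain B where B: "B \<in> braids" "B a1 = a1" "B b1 = b1" "B a2 = q2 \<otimes>\<^bsub>P\<^esub> a2 \<otimes>\<^bsub>P\<^esub> inv\<^bsub>P\<^esub> q2"
    "B b2 = q2 \<otimes>\<^bsub>P\<^esub> b2 \<otimes>\<^bsub>P\<^esub> inv\<^bsub>P\<^esub> (q2 \<otimes>\<^bsub>P\<^esub> q3 \<otimes>\<^bsub>P\<^esub> inv\<^bsub>P\<^esub> q2)"
    by (rule exists_B)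
  have one: "\<one>\<^bsub>P\<^esub> \<in> Sset" by (rule subgroup.one_closed[OF Sset_subgroup])
  have "SS.cls (Suc 0) (q2 \<otimes>\<^bsub>P\<^esub> q3 \<otimes>\<^bsub>P\<^esub> inv\<^bsub>P\<^esub> q2) = SS.cls (Suc 0) q3"
    using SS.cls_conj[of q3 "Suc 0" q2] by simp
  then show ?case using B one
    by (intro bexI[OF _ B(1)] exI[of _ "\<one>\<^bsub>P\<^esub>"] exI[of _ q2] exI[of _ "q2 \<otimes>\<^bsub>P\<^esub> q3 \<otimes>\<^bsub>P\<^esub> inv\<^bsub>P\<^esub> q2"]) simp
next
  case (Suc n)
  then obtain f W1 V W3 where f: "f \<in> braids" and W: "W1 \<in> lcs SS (Suc n)" "V \<in> lcs SS (Suc n)" "W3 \<in> lcs SS (Suc n)"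
    and fa1: "f a1 = W1 \<otimes>\<^bsub>P\<^esub> a1 \<otimes>\<^bsub>P\<^esub> inv\<^bsub>P\<^esub> W1" and fb1: "f b1 = W1 \<otimes>\<^bsub>P\<^esub> b1"
    and fa2: "f a2 = W3 \<otimes>\<^bsub>P\<^esub> a2 \<otimes>\<^bsub>P\<^esub> inv\<^bsub>P\<^esub> W3" and fb2: "f b2 = W3 \<otimes>\<^bsub>P\<^esub> b2 \<otimes>\<^bsub>P\<^esub> inv\<^bsub>P\<^esub> V"
    and cW: "SS.cls (Suc n) W1 = SS.cls (Suc n) (Lw n n)" "SS.cls (Suc n) V = SS.cls (Suc n) (Lw n n \<otimes>\<^bsub>P\<^esub> Y n)"
      "SS.cls (Suc n) W3 = SS.cls (Suc n) (X n)"
    by blast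
  obtain A where A: "A \<in> braids" "A a1 = mm \<otimes>\<^bsub>P\<^esub> a1 \<otimes>\<^bsub>P\<^esub> inv\<^bsub>P\<^esub> mm" "A b1 = mm \<otimes>\<^bsub>P\<^esub> b1" "A a2 = a2"
    "A b2 = b2 \<otimes>\<^bsub>P\<^esub> inv\<^bsub>P\<^esub> mm" by (rule exists_A)
  obtain A' where A': "A' \<in> braids" "\<And>x. x \<in> carrier P \<Longrightarrow> A' (A x) = x"
    "\<And>x. x \<in> carrier P \<Longrightarrow> A (A' x) = x" by (rule braids_inverse[OF A(1)]) (rule that)
  obtain fi where fi: "fi \<in> braids" "\<And>x. x \<in> carrier P \<Longrightarrow> fi (f x) = x"
    "\<And>x. x \<in> carrier P \<Longrightarrow> f (fi x) = x" by (rule braids_inverse[OF f]) (rule that)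
  interpret A: group_hom P P A by (rule braids_hom[OF A(1)])
  interpret f: group_hom P P f by (rule braids_hom[OF f])
  define f' where "f' = compose (carrier P) A (compose (carrier P) f (compose (carrier P) A' fi))"
  have f': "f' \<in> braids" unfolding f'_def by (intro braids_compose A f A' fi)
  interpret f': group_hom P P f' by (rule braids_hom[OF f'])
  have rel: "f' (f (A x)) = A (f x)" if "x \<in> carrier P" for x
    using that by (simp add: f'_def compose_eq fi A')
  have Sin: "W1 \<in> Sset" "V \<in> Sset" "W3 \<in> Sset" using W SS.lcs_closed by fastforce+
  have Wc [simp]: "W1 \<in> carrier P" "V \<in> carrier P" "W3 \<in> carrier P" using Sin by simp_all
  \<comment> \<open>These solve f'(f(A x)) = A(f x) at \<open>b1\<close>, \<open>b2\<close> and
    \<open>a2\<close>, where f'(f mm) = A(f mm) because \<open>A\<close> fixes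
    \<open>mm\<close>.\<close>
  define W1' where "W1' = inv\<^bsub>P\<^esub> (f' W1) \<otimes>\<^bsub>P\<^esub> A (inv\<^bsub>P\<^esub> (f mm) \<otimes>\<^bsub>P\<^esub> W1) \<otimes>\<^bsub>P\<^esub> mm"
  define V' where "V' = inv\<^bsub>P\<^esub> (f' V) \<otimes>\<^bsub>P\<^esub> A (inv\<^bsub>P\<^esub> (f mm) \<otimes>\<^bsub>P\<^esub> V) \<otimes>\<^bsub>P\<^esub> mm"
  define W3' where "W3' = inv\<^bsub>P\<^esub> (f' W3) \<otimes>\<^bsub>P\<^esub> A W3"
  have W'c [simp]: "W1' \<in> carrier P" "V' \<in> carrier P" "W3' \<in> carrier P"
    by (simp_all add: W1'_def V'_def W3'_def)
  interpret B: strands SS q1 q2 q3 A by (rule strands_SS[OF A(1,2,4,5)])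
  have Bm: "B.m = mm" by (simp add: B.m_def mm_def)
  have Am: "A mm = mm" using B.A_m by (simp add: Bm)
  have f'fm: "f' (f mm) = A (f mm)" using rel[of mm] Am by simp
  have solve: "v = inv\<^bsub>P\<^esub> u \<otimes>\<^bsub>P\<^esub> w" if "u \<otimes>\<^bsub>P\<^esub> v = w" "u \<in> carrier P" "v \<in> carrier P" for u v w
    using that by auto
  have solve2: "u = v \<otimes>\<^bsub>P\<^esub> w" if "u \<otimes>\<^bsub>P\<^esub> inv\<^bsub>P\<^esub> w = v" "u \<in> carrier P" "w \<in> carrier P" for u v w
    using that by (auto simp: m_assoc)
  have f'b1: "f' b1 = W1' \<otimes>\<^bsub>P\<^esub> b1"
  proof -
    have "(A (f mm) \<otimes>\<^bsub>P\<^esub> f' W1) \<otimes>\<^bsub>P\<^esub> f' b1 = A W1 \<otimes>\<^bsub>P\<^esub> mm \<otimes>\<^bsub>P\<^esub> b1"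
      using rel[of b1] by (simp add: A fb1 f'fm m_assoc)
    from solve[OF this] show ?thesis by (simp add: W1'_def m_assoc inv_mult_group)
  qed
  have f'a1: "f' a1 = W1' \<otimes>\<^bsub>P\<^esub> a1 \<otimes>\<^bsub>P\<^esub> inv\<^bsub>P\<^esub> W1'"
  proof -
    have "(A (f mm) \<otimes>\<^bsub>P\<^esub> f' W1) \<otimes>\<^bsub>P\<^esub> (f' a1 \<otimes>\<^bsub>P\<^esub> inv\<^bsub>P\<^esub> (A (f mm) \<otimes>\<^bsub>P\<^esub> f' W1)) = A W1 \<otimes>\<^bsub>P\<^esub> mm \<otimes>\<^bsub>P\<^esub> a1 \<otimes>\<^bsub>P\<^esub> inv\<^bsub>P\<^esub> (A W1 \<otimes>\<^bsub>P\<^esub> mm)"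
      using rel[of a1] by (simp add: A fa1 f'fm m_assoc inv_mult_group)
    from solve[OF this] have "f' a1 \<otimes>\<^bsub>P\<^esub> inv\<^bsub>P\<^esub> (A (f mm) \<otimes>\<^bsub>P\<^esub> f' W1) = W1' \<otimes>\<^bsub>P\<^esub> a1 \<otimes>\<^bsub>P\<^esub> inv\<^bsub>P\<^esub> (A W1 \<otimes>\<^bsub>P\<^esub> mm)"
      by (simp add: W1'_def m_assoc inv_mult_group)
    then have "f' a1 = W1' \<otimes>\<^bsub>P\<^esub> a1 \<otimes>\<^bsub>P\<^esub> inv\<^bsub>P\<^esub> (A W1 \<otimes>\<^bsub>P\<^esub> mm) \<otimes>\<^bsub>P\<^esub> (A (f mm) \<otimes>\<^bsub>P\<^esub> f' W1)"
      by (rule solve2) simp_all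
    then show ?thesis by (simp add: W1'_def m_assoc inv_mult_group)
  qed
  have f'a2: "f' a2 = W3' \<otimes>\<^bsub>P\<^esub> a2 \<otimes>\<^bsub>P\<^esub> inv\<^bsub>P\<^esub> W3'"
  proof -
    have "f' W3 \<otimes>\<^bsub>P\<^esub> (f' a2 \<otimes>\<^bsub>P\<^esub> inv\<^bsub>P\<^esub> (f' W3)) = A W3 \<otimes>\<^bsub>P\<^esub> a2 \<otimes>\<^bsub>P\<^esub> inv\<^bsub>P\<^esub> (A W3)"
      using rel[of a2] by (simp add: A fa2 m_assoc)
    from solve[OF this] have "f' a2 \<otimes>\<^bsub>P\<^esub> inv\<^bsub>P\<^esub> (f' W3) = W3' \<otimes>\<^bsub>P\<^esub> a2 \<otimes>\<^bsub>P\<^esub> inv\<^bsub>P\<^esub> (A W3)"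
      by (simp add: W3'_def m_assoc)
    then have "f' a2 = W3' \<otimes>\<^bsub>P\<^esub> a2 \<otimes>\<^bsub>P\<^esub> inv\<^bsub>P\<^esub> (A W3) \<otimes>\<^bsub>P\<^esub> f' W3"
      by (rule solve2) simp_all
    then show ?thesis by (simp add: W3'_def m_assoc inv_mult_group)
  qed
  have f'b2: "f' b2 = W3' \<otimes>\<^bsub>P\<^esub> b2 \<otimes>\<^bsub>P\<^esub> inv\<^bsub>P\<^esub> V'"
  proof -
    have "f' W3 \<otimes>\<^bsub>P\<^esub> (f' b2 \<otimes>\<^bsub>P\<^esub> inv\<^bsub>P\<^esub> (A (f mm) \<otimes>\<^bsub>P\<^esub> f' V)) = A W3 \<otimes>\<^bsub>P\<^esub> b2 \<otimes>\<^bsub>P\<^esub> inv\<^bsub>P\<^esub> (A V \<otimes>\<^bsub>P\<^esub> mm)"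
      using rel[of b2] by (simp add: A fb2 f'fm m_assoc inv_mult_group)
    from solve[OF this] have "f' b2 \<otimes>\<^bsub>P\<^esub> inv\<^bsub>P\<^esub> (A (f mm) \<otimes>\<^bsub>P\<^esub> f' V) = W3' \<otimes>\<^bsub>P\<^esub> b2 \<otimes>\<^bsub>P\<^esub> inv\<^bsub>P\<^esub> (A V \<otimes>\<^bsub>P\<^esub> mm)"
      by (simp add: W3'_def m_assoc)
    then have "f' b2 = W3' \<otimes>\<^bsub>P\<^esub> b2 \<otimes>\<^bsub>P\<^esub> inv\<^bsub>P\<^esub> (A V \<otimes>\<^bsub>P\<^esub> mm) \<otimes>\<^bsub>P\<^esub> (A (f mm) \<otimes>\<^bsub>P\<^esub> f' V)"
      by (rule solve2) simp_all
    then show ?thesis by (simp add: V'_def m_assoc inv_mult_group)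
  qed
  have fS: "f x \<in> Sset" "f' x \<in> Sset" "A x \<in> Sset" if "x \<in> Sset" for x
    using that braids_Sset f f' A(1) by simp_all
  have S': "W1' \<in> Sset" "V' \<in> Sset" "W3' \<in> Sset"
    unfolding W1'_def V'_def W3'_def using fS Sin by (auto intro!: Sset_intros)
  note XY = strands_XY[OF B.strands_axioms]
  have cW': "SS.cls (Suc n) W1 = SS.cls (Suc n) (B.Lw n n)"
    "SS.cls (Suc n) V = SS.cls (Suc n) (B.Lw n n \<otimes>\<^bsub>SS\<^esub> B.Y n)" "SS.cls (Suc n) W3 = SS.cls (Suc n) (B.X n)"
    by (simp_all only: XY SS_sel cW)
  have "W1' \<in> lcs SS (n + 2) \<and> V' \<in> lcs SS (n + 2) \<and> W3' \<in> lcs SS (n + 2) \<and>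
    SS.cls (n + 2) W1' = SS.cls (n + 2) (B.Lw (Suc n) (Suc n)) \<and>
    SS.cls (n + 2) V' = SS.cls (n + 2) (B.Lw (Suc n) (Suc n) \<otimes>\<^bsub>SS\<^esub> B.Y (Suc n)) \<and>
    SS.cls (n + 2) W3' = SS.cls (n + 2) (B.X (Suc n))"
  proof (rule B.step[OF group_hom_Sset[OF f] group_hom_Sset[OF f'] _ _ _ _ _ _ _ _ W cW'])
    show "f q3 = W3 \<otimes>\<^bsub>SS\<^esub> q3 \<otimes>\<^bsub>SS\<^esub> inv\<^bsub>SS\<^esub> W3"
      using Sin by (simp add: q3_def fa2 m_assoc inv_mult_group)
    show "f' q1 = W1' \<otimes>\<^bsub>SS\<^esub> q1 \<otimes>\<^bsub>SS\<^esub> inv\<^bsub>SS\<^esub> W1'"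
      using S' by (simp add: q1_def f'a1 m_assoc inv_mult_group)
    show "f' q3 = W3' \<otimes>\<^bsub>SS\<^esub> q3 \<otimes>\<^bsub>SS\<^esub> inv\<^bsub>SS\<^esub> W3'"
      using S' by (simp add: q3_def f'a2 m_assoc inv_mult_group)
    show "f' q2 = V' \<otimes>\<^bsub>SS\<^esub> q2 \<otimes>\<^bsub>SS\<^esub> inv\<^bsub>SS\<^esub> V'"
      using S' by (simp add: q2_def f'a2 f'b2 m_assoc inv_mult_group)
    show "f (B.m \<otimes>\<^bsub>SS\<^esub> q3) = B.m \<otimes>\<^bsub>SS\<^esub> q3" using f by (simp add: Bm braids_def)
  qed (use Sin fS in \<open>simp_all add: Bm W1'_def V'_def W3'_def del: X.simps Y.simps Lw.simps\<close>)
  then show ?case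
    using f'a1 f'b1 f'a2 f'b2 unfolding XY SS_sel
    by (intro bexI[OF _ f'] exI[of _ W1'] exI[of _ V'] exI[of _ W3']) (simp del: X.simps Y.simps Lw.simps)
qed

section \<open>The Lie elements y, z and the symplectic derivation built from them\<close>

abbreviation "brk \<equiv> bracket FL.L"

definition e where "e = inv\<^bsub>FL.L\<^esub> (hgen a1) \<otimes>\<^bsub>FL.L\<^esub> hgen a2"

primrec y where "y 0 = hgen a2" | "y (Suc n) = brk e (y n)"

definition sg where "sg j u = (if even (j::nat) then u else inv\<^bsub>FL.L\<^esub> u)"
definition t where "t n j = sg j (brk (y j) (y (n - Suc j)))"
definition z where "z k = finprod FL.L (t (2 * k)) {..<k}"

lemma hgen_Ldeg: "x \<in> carrier P \<Longrightarrow> hgen x \<in> FL.Ldeg 1"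
  unfolding hgen_def by (intro FL.gen_Ldeg cls_in_Ab)

lemma e_Ldeg: "e \<in> FL.Ldeg 1"
  unfolding e_def by (intro FL.Ldeg_mult FL.Ldeg_inv hgen_Ldeg) simp_all

lemma y_Ldeg: "y n \<in> FL.Ldeg (Suc n)"
proof (induction n)
  case 0
  then show ?case using hgen_Ldeg[of a2] by simp
next
  case (Suc n)
  then show ?case using FL.Ldeg_bracket[OF e_Ldeg, of "y n" "Suc n"] by simp
qed

lemma sg_Ldeg: "u \<in> FL.Ldeg n \<Longrightarrow> sg j u \<in> FL.Ldeg n"
  by (simp add: sg_def FL.Ldeg_inv)

lemma t_Ldeg: "j < n \<Longrightarrow> t n j \<in> FL.Ldeg (Suc n)"
  using FL.Ldeg_bracket[OF y_Ldeg[of j] y_Ldeg[of "n - Suc j"]] by (simp add: t_def sg_Ldeg)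

lemma z_Ldeg: "z k \<in> FL.Ldeg (Suc (2 * k))"
  unfolding z_def by (rule FL.Ldeg_finprod) (auto intro: t_Ldeg)

lemma e_closed [simp]: "e \<in> carrier FL.L" and y_closed [simp]: "y n \<in> carrier FL.L"
  and z_closed [simp]: "z k \<in> carrier FL.L"
  by (rule FL.Ldeg_closed, rule e_Ldeg y_Ldeg z_Ldeg)+

lemma sg_closed [simp]: "u \<in> carrier FL.L \<Longrightarrow> sg j u \<in> carrier FL.L"
  by (simp add: sg_def)

lemma t_closed [simp]: "t n j \<in> carrier FL.L"
  by (simp add: t_def)

lemma brk_e_sg: "u \<in> carrier FL.L \<Longrightarrow> v \<in> carrier FL.L \<Longrightarrow> brk u (sg j v) = sg j (brk u v)"
  by (simp add: sg_def FL.L.bracket_inv_right)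

text \<open>Bracketing with e is a derivation, so it sends the j-th term to (-1)^j
  ([y_(j+1), y_(n-1-j)] + [y_j, y_(n-j)]), and the first half of each image cancels against the
  second half of the next.\<close>

lemma e_telescope:
  "r \<le> n \<Longrightarrow> brk e (finprod FL.L (t n) {..<r}) \<otimes>\<^bsub>FL.L\<^esub> sg r (brk (y r) (y (n - r))) = brk (y 0) (y n)"
proof (induction r)
  case 0
  then show ?case by (simp add: sg_def)
next
  case (Suc r)
  define F where "F = finprod FL.L (t n) {..<r}"
  have F [simp]: "F \<in> carrier FL.L" by (simp add: F_def)
  have n: "n - r = Suc (n - Suc r)" using Suc.prems by simp
  have "finprod FL.L (t n) {..<Suc r} = t n r \<otimes>\<^bsub>FL.L\<^esub> F"
    unfolding lessThan_Suc F_def by (rule FL.L.finprod_insert) auto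
  moreover have "brk e (t n r) = sg r (brk (y (Suc r)) (y (n - Suc r)) \<otimes>\<^bsub>FL.L\<^esub> brk (y r) (y (n - r)))"
    unfolding t_def n by (simp add: brk_e_sg FL.L.bracket_bracket[of e "y r" "y (n - Suc r)"])
  moreover have "sg r (brk (y (Suc r)) (y (n - Suc r)) \<otimes>\<^bsub>FL.L\<^esub> brk (y r) (y (n - r))) \<otimes>\<^bsub>FL.L\<^esub> sg (Suc r) (brk (y (Suc r)) (y (n - Suc r))) = sg r (brk (y r) (y (n - r)))"
  proof -
    have "p \<otimes>\<^bsub>FL.L\<^esub> q \<otimes>\<^bsub>FL.L\<^esub> inv\<^bsub>FL.L\<^esub> p = q" "inv\<^bsub>FL.L\<^esub> (p \<otimes>\<^bsub>FL.L\<^esub> q) \<otimes>\<^bsub>FL.L\<^esub> p = inv\<^bsub>FL.L\<^esub> q"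
      if "p \<in> carrier FL.L" "q \<in> carrier FL.L" for p q
      using that by (simp add: FL.L.m_comm[of p q] FL.L.m_assoc, simp add: FL.L.m_assoc FL.L.inv_mult_group)
    then show ?thesis by (simp add: sg_def del: y.simps)
  qed
  ultimately have "brk e (finprod FL.L (t n) {..<Suc r}) \<otimes>\<^bsub>FL.L\<^esub> sg (Suc r) (brk (y (Suc r)) (y (n - Suc r))) =
      brk e F \<otimes>\<^bsub>FL.L\<^esub> sg r (brk (y r) (y (n - r)))"
    by (simp add: FL.L.bracket_mult_right FL.L.m_ac del: y.simps)
  then show ?case using Suc by (simp add: F_def del: y.simps)
qed

text \<open>Stopping halfway leaves the boundary term [y_k, y_k] = 0. This is where the evenness of
  2k enters.\<close>

lemma brk_e_z: "brk e (z k) = brk (y 0) (y (2 * k))"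
  using e_telescope[of k "2 * k"] by (cases "even k") (simp_all add: z_def[symmetric] sg_def FL.L.inv_one)

text \<open>The reflection j -> 2k-1-j swaps the two bracket entries and flips the parity of j; the
  two signs cancel, so both halves of the full sum equal z.\<close>

lemma t_sum: "finprod FL.L (t (2 * k)) {..<2 * k} = z k \<otimes>\<^bsub>FL.L\<^esub> z k"
proof -
  have sym: "t (2 * k) (2 * k - Suc j) = t (2 * k) j" if "j < k" for j
  proof -
    have "even (2 * k - Suc j) \<longleftrightarrow> odd j" using that by simp
    moreover have "2 * k - Suc (2 * k - Suc j) = j" using that by simp
    ultimately show ?thesis
      using FL.L.bracket_swap[of "y j" "y (2 * k - Suc j)"] by (simp add: t_def sg_def)
  qed
  have inj: "inj_on (\<lambda>j. 2 * k - Suc j) {..<k}" by (rule inj_onI) auto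
  have img: "(\<lambda>j. 2 * k - Suc j) ` {..<k} = {k..<2 * k}"
  proof
    show "{k..<2 * k} \<subseteq> (\<lambda>j. 2 * k - Suc j) ` {..<k}"
    proof
      fix i assume "i \<in> {k..<2 * k}"
      then show "i \<in> (\<lambda>j. 2 * k - Suc j) ` {..<k}"
        by (intro image_eqI[of _ _ "2 * k - Suc i"]) auto
    qed
  qed auto
  have "finprod FL.L (t (2 * k)) {k..<2 * k} = finprod FL.L (\<lambda>j. t (2 * k) (2 * k - Suc j)) {..<k}"
    unfolding img[symmetric] by (rule FL.L.finprod_reindex[OF _ inj]) auto
  also have "\<dots> = z k" unfolding z_def by (rule FL.L.finprod_cong') (auto simp: sym)
  finally have "finprod FL.L (t (2 * k)) {k..<2 * k} = z k" .
  moreover have "{..<2 * k} = {..<k} \<union> {k..<2 * k}" by auto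
  ultimately show ?thesis
    using FL.L.finprod_Un_disjoint[of "{..<k}" "{k..<2 * k}" "t (2 * k)"] by (simp add: z_def ivl_disj_int)
qed

lemma derivation_exists:
  assumes "k \<ge> 1"
  obtains d \<phi> where "d \<in> carrier (SD (2 * k))" "\<phi> \<in> hom P FL.L"
    "\<And>x. x \<in> carrier P \<Longrightarrow> d (hgen x) = \<phi> x"
    "\<phi> b1 = z k" "\<phi> b2 = y (2 * k) \<otimes>\<^bsub>FL.L\<^esub> inv\<^bsub>FL.L\<^esub> (z k)"
    "\<And>i. i \<in> {1..g} \<Longrightarrow> \<phi> (alpha i) = \<one>\<^bsub>FL.L\<^esub>" "\<And>i. i \<in> {3..g} \<Longrightarrow> \<phi> (beta i) = \<one>\<^bsub>FL.L\<^esub>"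
proof -
  let ?n = "Suc (2 * k)" and ?u = "y (2 * k) \<otimes>\<^bsub>FL.L\<^esub> inv\<^bsub>FL.L\<^esub> (z k)"
  \<comment> \<open>With only the homogeneous part as target, the values of \<phi> are automatically
    homogeneous of degree 2k+1.\<close>
  let ?K = "FL.L\<lparr>carrier := FL.Ldeg ?n\<rparr>"
  interpret K: comm_group ?K by (rule FL.comm_group_Ldeg)
  have u: "?u \<in> FL.Ldeg ?n" by (intro FL.Ldeg_mult FL.Ldeg_inv y_Ldeg z_Ldeg)
  let ?b = "\<lambda>i. if i = 1 then z k else if i = 2 then ?u else \<one>\<^bsub>FL.L\<^esub>"
  obtain \<phi> where \<phi>: "\<phi> \<in> hom P ?K"
    "\<And>i. i \<in> {1..g} \<Longrightarrow> \<phi> (alpha i) = \<one>\<^bsub>FL.L\<^esub>" "\<And>i. i \<in> {1..g} \<Longrightarrow> \<phi> (beta i) = ?b i"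
    by (rule surface_hom_exists[OF K.is_group, of "\<lambda>i. \<one>\<^bsub>FL.L\<^esub>" ?b]) (use z_Ldeg u FL.Ldeg_one in auto)
  have \<phi>_deg: "\<phi> x \<in> FL.Ldeg ?n" if "x \<in> carrier P" for x using \<phi>(1) that by (auto simp: hom_def)
  have \<phi>L: "\<phi> \<in> hom P FL.L" using \<phi>(1) FL.Ldeg_closed by (auto simp: hom_def Pi_def)
  obtain v where v: "v \<in> hom Ab FL.L" "\<And>x. x \<in> carrier P \<Longrightarrow> v (cls 1 x) = \<phi> x"
    using Ab_hom_exists[OF FL.L.comm_group_axioms \<phi>L] by blast
  have "v h \<in> FL.Ldeg ?n" if "h \<in> carrier Ab" for h using that v(2) \<phi>_deg by (metis Ab_cases)
  then obtain d where d: "d \<in> carrier (FL.Der (2 * k))" "\<And>h. h \<in> carrier Ab \<Longrightarrow> d (FL.gen h) = v h"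
    using FL.exists_derivation[OF v(1)] by blast
  have dh: "d (hgen x) = \<phi> x" if "x \<in> carrier P" for x
    using d(2)[OF cls_in_Ab[OF that]] v(2)[OF that] by (simp only: hgen_def)
  have \<phi>12: "\<phi> a1 = \<one>\<^bsub>FL.L\<^esub>" "\<phi> a2 = \<one>\<^bsub>FL.L\<^esub>" "\<phi> b1 = z k" "\<phi> b2 = ?u"
    using \<phi>(2,3)[of 1] \<phi>(2,3)[of 2] g by (simp_all add: a1_def a2_def b1_def b2_def)
  have \<phi>c: "\<phi> x \<in> carrier FL.L" if "x \<in> carrier P" for x using \<phi>_deg[OF that] FL.Ldeg_closed by blast
  have d_one: "d \<one>\<^bsub>FL.L\<^esub> = \<one>\<^bsub>FL.L\<^esub>"
    using FL.Der_add[OF d(1), of "\<one>\<^bsub>FL.L\<^esub>" "\<one>\<^bsub>FL.L\<^esub>"] FL.Der_closed[OF d(1), of "\<one>\<^bsub>FL.L\<^esub>"]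
    by (metis FL.L.l_one FL.L.one_closed FL.L.r_cancel_one')
  have d_finprod: "d (finprod FL.L f I) = finprod FL.L (\<lambda>i. d (f i)) I"
    if "finite I" "\<And>i. i \<in> I \<Longrightarrow> f i \<in> carrier FL.L" for f and I :: "nat set"
    using that
  proof (induction I)
    case empty
    then show ?case by (simp add: d_one)
  next
    case (insert i I)
    then have "d (f i \<otimes>\<^bsub>FL.L\<^esub> finprod FL.L f I) = d (f i) \<otimes>\<^bsub>FL.L\<^esub> finprod FL.L (\<lambda>i. d (f i)) I"
      using FL.Der_add[OF d(1), of "f i" "finprod FL.L f I"] by (simp add: FL.L.finprod_closed Pi_def)
    moreover have "finprod FL.L f (insert i I) = f i \<otimes>\<^bsub>FL.L\<^esub> finprod FL.L f I"
      using insert by (intro FL.L.finprod_insert) auto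
    moreover have "finprod FL.L (\<lambda>i. d (f i)) (insert i I) = d (f i) \<otimes>\<^bsub>FL.L\<^esub> finprod FL.L (\<lambda>i. d (f i)) I"
      using insert FL.Der_closed[OF d(1)] by (intro FL.L.finprod_insert) auto
    ultimately show ?case by simp
  qed
  let ?F = "\<lambda>i. brk (hgen (alpha i)) (\<phi> (beta i))"
  have dF: "d (brk (hgen (alpha i)) (hgen (beta i))) = ?F i" if "i \<in> {1..g}" for i
    using that FL.Der_bracket[OF d(1), of "hgen (alpha i)" "hgen (beta i)"] \<phi>(2)[OF that] \<phi>c[of "beta i"]
    by (simp add: dh)
  have Fc: "?F \<in> {1..g} \<rightarrow> carrier FL.L"
  proof
    fix i assume "i \<in> {1..g}"
    from alpha_beta_closed[OF this] show "?F i \<in> carrier FL.L" using \<phi>c by simp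
  qed
  \<comment> \<open>Since a2 = a1 + e in H, the left side is [a2, y_(2k)] - [e, z], which is zero by
    \<open>brk_e_z\<close>.\<close>
  have F2: "brk (hgen a1) (z k) \<otimes>\<^bsub>FL.L\<^esub> brk (hgen a2) ?u = \<one>\<^bsub>FL.L\<^esub>"
  proof -
    have h1: "hgen a2 = hgen a1 \<otimes>\<^bsub>FL.L\<^esub> e" by (simp add: e_def FL.L.m_assoc[symmetric])
    have "brk (hgen a2) ?u = brk (hgen a2) (y (2 * k)) \<otimes>\<^bsub>FL.L\<^esub> inv\<^bsub>FL.L\<^esub> (brk (hgen a2) (z k))"
      by (simp add: FL.L.bracket_mult_right FL.L.bracket_inv_right)
    also have "brk (hgen a2) (z k) = brk (hgen a1) (z k) \<otimes>\<^bsub>FL.L\<^esub> brk (hgen a2) (y (2 * k))"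
      using brk_e_z[of k] FL.L.bracket_mult_left[of "hgen a1" e "z k"] by (simp flip: h1)
    finally have *: "brk (hgen a2) ?u = brk (hgen a2) (y (2 * k)) \<otimes>\<^bsub>FL.L\<^esub>
        inv\<^bsub>FL.L\<^esub> (brk (hgen a1) (z k) \<otimes>\<^bsub>FL.L\<^esub> brk (hgen a2) (y (2 * k)))" .
    show ?thesis unfolding * by (simp add: FL.L.m_assoc[symmetric])
  qed
  have "d (omega g) = finprod FL.L (\<lambda>i. d (brk (hgen (alpha i)) (hgen (beta i)))) {1..g}"
    unfolding omega_eq by (rule d_finprod) auto
  also have "\<dots> = finprod FL.L ?F {1..g}"
    by (rule FL.L.finprod_cong'[OF HOL.refl Fc dF])
  also have "\<dots> = finprod FL.L ?F {1, 2}"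
  proof (rule FL.L.finprod_mono_neutral_cong_right)
    show "?F i = \<one>\<^bsub>FL.L\<^esub>" if "i \<in> {1..g} - {1, 2}" for i using that \<phi>(3)[of i] by auto
  qed (use g Fc in auto)
  also have "\<dots> = ?F 1 \<otimes>\<^bsub>FL.L\<^esub> ?F 2"
  proof -
    have c: "?F 1 \<in> carrier FL.L" "?F 2 \<in> carrier FL.L"
      using \<phi>c[of "beta 1"] \<phi>c[of "beta 2"] g by auto
    then have "finprod FL.L ?F {2} = ?F 2" by (subst FL.L.finprod_insert) auto
    then show ?thesis using c by (subst FL.L.finprod_insert) auto
  qed
  also have "\<dots> = \<one>\<^bsub>FL.L\<^esub>"
    unfolding a1_def[symmetric] a2_def[symmetric] b1_def[symmetric] b2_def[symmetric] \<phi>12 by (rule F2)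
  finally have "d \<in> carrier (SD (2 * k))" using d(1) by (simp add: SD_eq)
  moreover have "\<phi> (beta i) = \<one>\<^bsub>FL.L\<^esub>" if "i \<in> {3..g}" for i using \<phi>(3)[of i] that by simp
  ultimately show thesis using that \<phi>L dh \<phi>12(3,4) \<phi>(2) by blast
qed

section \<open>Leading terms of the strand words in the graded Lie ring\<close>

lemma lcs_iso_mult:
  "u \<in> carrier FL.L \<Longrightarrow> v \<in> carrier FL.L \<Longrightarrow> lcs_iso P (u \<otimes>\<^bsub>FL.L\<^esub> v) = lcs_iso P u \<otimes>\<^bsub>S\<^esub> lcs_iso P v"
  using hom_mult[OF lcs_iso_hom] .

lemma lcs_iso_inv: "u \<in> carrier FL.L \<Longrightarrow> lcs_iso P (inv\<^bsub>FL.L\<^esub> u) = inv\<^bsub>S\<^esub> (lcs_iso P u)"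
  using group_hom.hom_inv[of FL.L S "lcs_iso P" u] lcs_iso_hom comm_group.axioms(2)[OF comm_group_lcs_graded]
  by (simp add: group_hom_def group_hom_axioms_def FL.L.is_group)

lemma Sset_lcs: "x \<in> lcs SS n \<Longrightarrow> x \<in> lcs P n"
  by (rule SS.hom_lcs[OF is_group, of "\<lambda>x. x"]) (simp_all add: hom_def)

lemma SS_cls_eq:
  assumes "SS.cls n u = SS.cls n v" "u \<in> Sset" "v \<in> Sset"
  shows "cls n u = cls n v"
proof -
  have "u \<otimes>\<^bsub>SS\<^esub> inv\<^bsub>SS\<^esub> v \<in> lcs SS (Suc n)" using assms SS.cls_eq_iff[of u v "Suc n"] by simp
  then have "u \<otimes>\<^bsub>P\<^esub> inv\<^bsub>P\<^esub> v \<in> lcs P (Suc n)" using assms Sset_lcs by simp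
  then show ?thesis using assms by (simp add: cls_eq_iff)
qed

lemma gr_cong: "cls n u = cls n v \<Longrightarrow> gr n u = gr n v"
  unfolding gr_def by (intro restrict_ext) simp

lemma X_eq: "X (Suc n) = comm (inv\<^bsub>P\<^esub> (X n)) mm" and Y_eq: "Y (Suc n) = comm (inv\<^bsub>P\<^esub> (Y n)) (inv\<^bsub>P\<^esub> mm)"
  by (simp_all add: commutator_def)

lemma X_lcs: "X n \<in> lcs P (Suc n)"
proof (induction n)
  case (Suc n)
  then show ?case unfolding X_eq by (intro commutator_in_lcs_Suc') auto
qed simp

lemma Y_lcs: "Y n \<in> lcs P (Suc n)"
proof (induction n)
  case (Suc n)
  then show ?case unfolding Y_eq by (intro commutator_in_lcs_Suc') auto
qed simp

lemma gr_mm: "gr 1 mm = lcs_iso P e"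
proof -
  have "cls 1 q2 = cls 1 a2" using cls_conj[of a2 1 "inv\<^bsub>P\<^esub> b2"] by (simp add: q2_def)
  then have "gr 1 q2 = gr 1 a2" by (rule gr_cong)
  moreover have "gr 1 mm = gr 1 q1 \<otimes>\<^bsub>S\<^esub> gr 1 q2" using gr_mult[of q1 1 q2] by (simp add: mm_def)
  moreover have "gr 1 q1 = inv\<^bsub>S\<^esub> (gr 1 a1)" using gr_inv[of a1 1] by (simp add: q1_def)
  ultimately show ?thesis by (simp add: e_def lcs_iso_mult lcs_iso_inv lcs_iso_hgen)
qed

text \<open>In \<open>P\<close> the loop \<open>q2\<close> is conjugate to \<open>a2\<close>, hence
  has its class, and each commutator step applies ad(e).\<close>

lemma gr_X: "gr (Suc n) (X n) = lcs_iso P (y n)"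
proof (induction n)
  case 0
  have "cls 1 q2 = cls 1 a2" using cls_conj[of a2 1 "inv\<^bsub>P\<^esub> b2"] by (simp add: q2_def)
  then show ?case using gr_cong[of 1 q2 a2] lcs_iso_hgen[of a2] by simp
next
  case (Suc n)
  interpret S: lie_ring S by (rule lie_ring_lcs_graded)
  have mm: "mm \<in> lcs P 1" by simp
  have "gr (Suc (Suc n)) (X (Suc n)) = bracket S (inv\<^bsub>S\<^esub> (gr (Suc n) (X n))) (gr 1 mm)"
    using gr_bracket[OF lcs_intros(3)[OF X_lcs[of n]] mm] gr_inv[OF X_lcs[of n]] by (simp add: X_eq del: X.simps)
  also have "\<dots> = bracket S (gr 1 mm) (gr (Suc n) (X n))"
    using X_lcs[of n] mm S.bracket_swap[of "gr (Suc n) (X n)" "gr 1 mm"] by (simp add: S.bracket_inv_left del: X.simps)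
  also have "\<dots> = lcs_iso P (y (Suc n))" unfolding gr_mm Suc by (simp add: lcs_iso_bracket)
  finally show ?case .
qed

text \<open>The sign is (-1)^(n+1): one factor from q3 = a2^-1 and one from each commutator
  step.\<close>

lemma gr_Y: "gr (Suc n) (Y n) = lcs_iso P (if even n then inv\<^bsub>FL.L\<^esub> (y n) else y n)"
proof (induction n)
  case 0
  show ?case using gr_inv[of a2 1] by (simp add: q3_def lcs_iso_inv lcs_iso_hgen)
next
  case (Suc n)
  interpret S: lie_ring S by (rule lie_ring_lcs_graded)
  have mm: "mm \<in> lcs P 1" by simp
  have "gr (Suc (Suc n)) (Y (Suc n)) = bracket S (inv\<^bsub>S\<^esub> (gr (Suc n) (Y n))) (inv\<^bsub>S\<^esub> (gr 1 mm))"
    using gr_bracket[OF lcs_intros(3)[OF Y_lcs[of n]] lcs_intros(3)[OF mm]] gr_inv[OF Y_lcs[of n]] gr_inv[OF mm]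
    by (simp add: Y_eq del: Y.simps)
  also have "\<dots> = inv\<^bsub>S\<^esub> (bracket S (gr 1 mm) (gr (Suc n) (Y n)))"
    using Y_lcs[of n] mm S.bracket_swap[of "gr 1 mm" "gr (Suc n) (Y n)"]
    by (simp add: S.bracket_inv_left S.bracket_inv_right del: Y.simps)
  also have "\<dots> = lcs_iso P (if even (Suc n) then inv\<^bsub>FL.L\<^esub> (y (Suc n)) else y (Suc n))"
    unfolding gr_mm Suc by (simp add: lcs_iso_bracket[symmetric] lcs_iso_inv[symmetric] FL.L.bracket_inv_right)
  finally show ?case .
qed

lemma XY_lcs: "j < n \<Longrightarrow> comm (X j) (Y (n - Suc j)) \<in> lcs P (Suc n)"
  using commutator_in_lcs[OF X_lcs[of j] Y_lcs[of "n - Suc j"]] by simp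

lemma Lw_lcs: "r \<le> n \<Longrightarrow> Lw n r \<in> lcs P (Suc n)"
  by (induction r) (auto simp: XY_lcs)

lemma gr_Lw: "r \<le> 2 * k \<Longrightarrow> gr (Suc (2 * k)) (Lw (2 * k) r) = lcs_iso P (finprod FL.L (t (2 * k)) {..<r})"
proof (induction r)
  case 0
  then show ?case by (simp add: gr_one lcs_iso_one)
next
  case (Suc r)
  interpret S: lie_ring S by (rule lie_ring_lcs_graded)
  let ?i = "2 * k - Suc r"
  have n: "Suc r + Suc ?i = Suc (2 * k)" using Suc.prems by simp
  \<comment> \<open>So the sign of \<open>Y (2 * k - Suc r)\<close> is the sign (-1)^r built into
    \<open>t (2 * k) r\<close>.\<close>
  have par: "even ?i \<longleftrightarrow> odd r" using Suc.prems by simp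
  have "gr (Suc (2 * k)) (comm (X r) (Y ?i)) = bracket S (gr (Suc r) (X r)) (gr (Suc ?i) (Y ?i))"
    using gr_bracket[OF X_lcs Y_lcs, of r ?i] unfolding n by simp
  also have "\<dots> = lcs_iso P (t (2 * k) r)"
    unfolding gr_X gr_Y par t_def sg_def
    by (simp add: lcs_iso_bracket[symmetric] FL.L.bracket_inv_right)
  finally have "gr (Suc (2 * k)) (comm (X r) (Y ?i)) = lcs_iso P (t (2 * k) r)" .
  moreover have "gr (Suc (2 * k)) (Lw (2 * k) (Suc r)) =
      gr (Suc (2 * k)) (Lw (2 * k) r) \<otimes>\<^bsub>S\<^esub> gr (Suc (2 * k)) (comm (X r) (Y ?i))"
    using gr_mult[OF Lw_lcs[of r "2 * k"] XY_lcs[of r "2 * k"]] Suc.prems by simp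
  moreover have "finprod FL.L (t (2 * k)) {..<Suc r} = finprod FL.L (t (2 * k)) {..<r} \<otimes>\<^bsub>FL.L\<^esub> t (2 * k) r"
    unfolding lessThan_Suc using FL.L.m_comm[of "t (2 * k) r"] by (subst FL.L.finprod_insert) auto
  ultimately show ?case using Suc by (simp add: lcs_iso_mult)
qed

lemma gr_apply: "gr (Suc n) x (Suc n) = cls (Suc n) x"
  by (simp add: gr_def)

text \<open>For the braid of level 2k the leading terms of \<open>W1\<close>, \<open>V\<close>,
  \<open>W3\<close> are 2z, 2z - y_(2k) and y_(2k). Hence b1 moves by 2z and b2 by y_(2k) - (2z -
  y_(2k)) = 2 (y_(2k) - z), while a1 and a2 move by commutators one degree deeper.\<close>

lemma double_in_johnson_image:
  assumes k: "k \<ge> 1" and d: "d \<in> carrier (SD (2 * k))" and \<phi>: "\<phi> \<in> hom P FL.L"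
    and d\<phi>: "\<And>x. x \<in> carrier P \<Longrightarrow> d (hgen x) = \<phi> x"
    and b12: "\<phi> b1 = z k" "\<phi> b2 = y (2 * k) \<otimes>\<^bsub>FL.L\<^esub> inv\<^bsub>FL.L\<^esub> (z k)"
    and rest: "\<And>i. i \<in> {1..g} \<Longrightarrow> \<phi> (alpha i) = \<one>\<^bsub>FL.L\<^esub>" "\<And>i. i \<in> {3..g} \<Longrightarrow> \<phi> (beta i) = \<one>\<^bsub>FL.L\<^esub>"
  shows "d \<otimes>\<^bsub>SD (2 * k)\<^esub> d \<in> johnson_image g (2 * k)"
proof -
  note [simp del] = X.simps Y.simps Lw.simps y.simps
  let ?n = "Suc (2 * k)"
  interpret S: lie_ring S by (rule lie_ring_lcs_graded)
  interpret QN: comm_group "lcs_quot P ?n" by (rule comm_group_lcs_quot) simp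
  interpret \<phi>: group_hom P FL.L \<phi> using \<phi> by unfold_locales
  obtain f W1 V W3 where f: "f \<in> braids" and W: "W1 \<in> lcs SS ?n" "V \<in> lcs SS ?n" "W3 \<in> lcs SS ?n"
    and fa1: "f a1 = W1 \<otimes>\<^bsub>P\<^esub> a1 \<otimes>\<^bsub>P\<^esub> inv\<^bsub>P\<^esub> W1" and fb1: "f b1 = W1 \<otimes>\<^bsub>P\<^esub> b1"
    and fa2: "f a2 = W3 \<otimes>\<^bsub>P\<^esub> a2 \<otimes>\<^bsub>P\<^esub> inv\<^bsub>P\<^esub> W3" and fb2: "f b2 = W3 \<otimes>\<^bsub>P\<^esub> b2 \<otimes>\<^bsub>P\<^esub> inv\<^bsub>P\<^esub> V"
    and cW: "SS.cls ?n W1 = SS.cls ?n (Lw (2 * k) (2 * k))" "SS.cls ?n V = SS.cls ?n (Lw (2 * k) (2 * k) \<otimes>\<^bsub>P\<^esub> Y (2 * k))"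
      "SS.cls ?n W3 = SS.cls ?n (X (2 * k))"
    using braid_exists[of "2 * k"] by blast
  interpret f: group_hom P P f by (rule braids_hom[OF f])
  have WP: "W1 \<in> lcs P ?n" "V \<in> lcs P ?n" "W3 \<in> lcs P ?n" using W Sset_lcs by blast+
  have WS: "W1 \<in> Sset" "V \<in> Sset" "W3 \<in> Sset" using W[THEN SS.lcs_closed] by simp_all
  have Wc [simp]: "W1 \<in> carrier P" "V \<in> carrier P" "W3 \<in> carrier P" using WS by simp_all
  have cP: "cls ?n W1 = cls ?n (Lw (2 * k) (2 * k))" "cls ?n V = cls ?n (Lw (2 * k) (2 * k) \<otimes>\<^bsub>P\<^esub> Y (2 * k))"
      "cls ?n W3 = cls ?n (X (2 * k))"
    using cW[THEN SS_cls_eq] WS by simp_all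
  have LY: "Lw (2 * k) (2 * k) \<in> lcs P ?n" "Y (2 * k) \<in> lcs P ?n" "X (2 * k) \<in> lcs P ?n"
    by (rule Lw_lcs Y_lcs X_lcs; simp)+
  have gL: "gr ?n (Lw (2 * k) (2 * k)) = lcs_iso P (z k \<otimes>\<^bsub>FL.L\<^esub> z k)"
    using gr_Lw[of "2 * k" k] by (simp add: t_sum)
  have gY: "gr ?n (Y (2 * k)) = lcs_iso P (inv\<^bsub>FL.L\<^esub> (y (2 * k)))" using gr_Y[of "2 * k"] by simp
  have gW1: "gr ?n W1 = lcs_iso P (z k \<otimes>\<^bsub>FL.L\<^esub> z k)" using gr_cong[OF cP(1)] gL by simp
  have gV: "gr ?n V = lcs_iso P ((z k \<otimes>\<^bsub>FL.L\<^esub> z k) \<otimes>\<^bsub>FL.L\<^esub> inv\<^bsub>FL.L\<^esub> (y (2 * k)))"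
    using gr_cong[OF cP(2)] gr_mult[OF LY(1,2)] gL gY by (simp add: lcs_iso_mult)
  have gW3: "gr ?n W3 = lcs_iso P (y (2 * k))" using gr_cong[OF cP(3)] gr_X[of "2 * k"] by simp
  define q where "q x = f x \<otimes>\<^bsub>P\<^esub> inv\<^bsub>P\<^esub> x" for x
  have higher: "f (alpha i) = alpha i" "f (beta i) = beta i" if "i \<in> {3..g}" for i
    using f that by (auto simp: braids_def)
  have qc: "q x \<in> carrier P" if "x \<in> carrier P" for x using that by (simp add: q_def)
  have q_mult: "q (x \<otimes>\<^bsub>P\<^esub> x') = q x \<otimes>\<^bsub>P\<^esub> (x \<otimes>\<^bsub>P\<^esub> q x' \<otimes>\<^bsub>P\<^esub> inv\<^bsub>P\<^esub> x)" if "x \<in> carrier P" "x' \<in> carrier P" for x x'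
    using that by (simp add: q_def m_assoc inv_mult_group)
  have q_a: "q a1 = comm W1 a1" "q a2 = comm W3 a2" by (simp_all add: q_def fa1 fa2 commutator_def)
  have q_b1: "q b1 = W1" by (simp add: q_def fb1 m_assoc)
  have q_b2: "q b2 = W3 \<otimes>\<^bsub>P\<^esub> (b2 \<otimes>\<^bsub>P\<^esub> inv\<^bsub>P\<^esub> V \<otimes>\<^bsub>P\<^esub> inv\<^bsub>P\<^esub> b2)" by (simp add: q_def fb2 m_assoc)
  have q_gens: "q (alpha i) \<in> lcs P (Suc ?n) \<and> q (beta i) \<in> lcs P ?n" if "i \<in> {1..g}" for i
    using that
  proof (cases rule: index_cases)
    case 1
    then show ?thesis using commutator_in_lcs_Suc'[OF WP(1), of a1] WP by (simp add: q_a q_b1)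
  next
    case 2
    have "q b2 \<in> lcs P ?n" unfolding q_b2 by (rule lcs_intros(2)[OF WP(3) lcs_intros(4)[OF lcs_intros(3)[OF WP(2)]]]) simp
    then show ?thesis using 2 commutator_in_lcs_Suc'[OF WP(3), of a2] by (simp add: q_a)
  next
    case 3
    then show ?thesis using higher[OF 3] alpha_beta_closed[OF that] by (simp add: q_def)
  qed
  have q_lcs: "q x \<in> lcs P ?n" if x: "x \<in> carrier P" for x
  proof -
    interpret N: normal "lcs P ?n" P by (rule normal_lcs)
    interpret M: group "P Mod lcs P ?n" by (rule N.factorgroup_is_group)
    have h: "(\<lambda>x. lcs P ?n #>\<^bsub>P\<^esub> x) \<in> hom P (P Mod lcs P ?n)" by (rule N.r_coset_hom_Mod)
    have "lcs P ?n #>\<^bsub>P\<^esub> f x = lcs P ?n #>\<^bsub>P\<^esub> x"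
    proof (rule surface_hom_eqI[OF M.is_group _ h _ _ x])
      show "(\<lambda>x. lcs P ?n #>\<^bsub>P\<^esub> f x) \<in> hom P (P Mod lcs P ?n)"
        using h f.homh by (auto simp: hom_def)
      fix i assume i: "i \<in> {1..g}"
      show "lcs P ?n #>\<^bsub>P\<^esub> f (alpha i) = lcs P ?n #>\<^bsub>P\<^esub> alpha i" "lcs P ?n #>\<^bsub>P\<^esub> f (beta i) = lcs P ?n #>\<^bsub>P\<^esub> beta i"
        using q_gens[OF i] alpha_beta_closed[OF i] lcs_Suc_subset[of ?n]
        by (auto simp: cls_eq_iff q_def)
    qed
    then show ?thesis using x by (simp add: cls_eq_iff q_def)
  qed
  have fJ: "f \<in> johnson_filtration g (2 * k)"
    using f q_lcs by (auto simp: johnson_filtration_iff braids_def cls_eq_iff q_def)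
  let ?D = "d \<otimes>\<^bsub>SD (2 * k)\<^esub> d"
  have D: "?D \<in> carrier (SD (2 * k))"
    using comm_group.axioms(2)[OF comm_group_SD] d by (simp add: group.is_monoid monoid.m_closed del: SD_sel)
  have Dh: "?D (hgen x) = \<phi> x \<otimes>\<^bsub>FL.L\<^esub> \<phi> x" if "x \<in> carrier P" for x
    using that by (simp add: FL.Der_mult d\<phi>)
  have "lcs_iso P (\<phi> x \<otimes>\<^bsub>FL.L\<^esub> \<phi> x) ?n = cls ?n (q x)" if x: "x \<in> carrier P" for x
  proof (rule surface_hom_eqI[OF QN.is_group _ _ _ _ x])
    have comp: "lcs_iso P u ?n \<in> carrier (lcs_quot P ?n)" if "u \<in> carrier FL.L" for u
      using that lcs_iso_hom by (intro lcs_graded_comp) (auto simp: hom_def)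
    show "(\<lambda>x. lcs_iso P (\<phi> x \<otimes>\<^bsub>FL.L\<^esub> \<phi> x) ?n) \<in> hom P (lcs_quot P ?n)"
    proof (rule homI)
      fix x x' assume x: "x \<in> carrier P" "x' \<in> carrier P"
      have "\<phi> (x \<otimes>\<^bsub>P\<^esub> x') \<otimes>\<^bsub>FL.L\<^esub> \<phi> (x \<otimes>\<^bsub>P\<^esub> x') = (\<phi> x \<otimes>\<^bsub>FL.L\<^esub> \<phi> x) \<otimes>\<^bsub>FL.L\<^esub> (\<phi> x' \<otimes>\<^bsub>FL.L\<^esub> \<phi> x')"
        using x by (simp add: FL.L.m_ac)
      then have "lcs_iso P (\<phi> (x \<otimes>\<^bsub>P\<^esub> x') \<otimes>\<^bsub>FL.L\<^esub> \<phi> (x \<otimes>\<^bsub>P\<^esub> x')) =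
          lcs_iso P (\<phi> x \<otimes>\<^bsub>FL.L\<^esub> \<phi> x) \<otimes>\<^bsub>S\<^esub> lcs_iso P (\<phi> x' \<otimes>\<^bsub>FL.L\<^esub> \<phi> x')"
        using x by (simp only: lcs_iso_mult FL.L.m_closed \<phi>.hom_closed)
      then show "lcs_iso P (\<phi> (x \<otimes>\<^bsub>P\<^esub> x') \<otimes>\<^bsub>FL.L\<^esub> \<phi> (x \<otimes>\<^bsub>P\<^esub> x')) ?n =
          lcs_iso P (\<phi> x \<otimes>\<^bsub>FL.L\<^esub> \<phi> x) ?n \<otimes>\<^bsub>lcs_quot P ?n\<^esub> lcs_iso P (\<phi> x' \<otimes>\<^bsub>FL.L\<^esub> \<phi> x') ?n"
        by (simp only: lcs_graded_mult lcs_quot_sel) simp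
    qed (use comp in simp)
    show "(\<lambda>x. cls ?n (q x)) \<in> hom P (lcs_quot P ?n)"
    proof (rule homI)
      fix x x' assume x: "x \<in> carrier P" "x' \<in> carrier P"
      have "cls ?n (q (x \<otimes>\<^bsub>P\<^esub> x')) = cls ?n (q x) <#>\<^bsub>P\<^esub> cls ?n (x \<otimes>\<^bsub>P\<^esub> q x' \<otimes>\<^bsub>P\<^esub> inv\<^bsub>P\<^esub> x)"
        using x qc by (simp add: q_mult cls_mult)
      also have "cls ?n (x \<otimes>\<^bsub>P\<^esub> q x' \<otimes>\<^bsub>P\<^esub> inv\<^bsub>P\<^esub> x) = cls ?n (q x')"
        by (rule cls_conj[OF q_lcs]) (use x in simp_all)
      finally show "cls ?n (q (x \<otimes>\<^bsub>P\<^esub> x')) = cls ?n (q x) \<otimes>\<^bsub>lcs_quot P ?n\<^esub> cls ?n (q x')"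
        by (simp only: lcs_quot_sel)
    qed (use q_lcs in blast)
    have one: "lcs_iso P (\<one>\<^bsub>FL.L\<^esub> \<otimes>\<^bsub>FL.L\<^esub> \<one>\<^bsub>FL.L\<^esub>) ?n = lcs P (Suc ?n)"
      by (simp add: lcs_iso_one lcs_graded_one)
    fix i assume i: "i \<in> {1..g}"
    show "lcs_iso P (\<phi> (alpha i) \<otimes>\<^bsub>FL.L\<^esub> \<phi> (alpha i)) ?n = cls ?n (q (alpha i))"
      unfolding rest(1)[OF i] one using q_gens[OF i] by (simp only: cls_eq_oneI)
    show "lcs_iso P (\<phi> (beta i) \<otimes>\<^bsub>FL.L\<^esub> \<phi> (beta i)) ?n = cls ?n (q (beta i))"
      using i
    proof (cases rule: index_cases)
      case 1
      show ?thesis unfolding 1(3) b12 q_b1 gW1[symmetric] by (rule gr_apply)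
    next
      case 2
      have cV: "cls ?n (b2 \<otimes>\<^bsub>P\<^esub> inv\<^bsub>P\<^esub> V \<otimes>\<^bsub>P\<^esub> inv\<^bsub>P\<^esub> b2) = cls ?n (inv\<^bsub>P\<^esub> V)"
        by (rule cls_conj[OF lcs_intros(3)[OF WP(2)]]) simp_all
      have "cls ?n (q b2) = cls ?n (W3 \<otimes>\<^bsub>P\<^esub> inv\<^bsub>P\<^esub> V)"
        unfolding q_b2 by (rule cls_mult_cong[OF HOL.refl cV]) simp_all
      then have "gr ?n (q b2) = gr ?n W3 \<otimes>\<^bsub>S\<^esub> inv\<^bsub>S\<^esub> (gr ?n V)"
        using gr_cong[of ?n "q b2"] gr_mult[OF WP(3) lcs_intros(3)[OF WP(2)]] gr_inv[OF WP(2)] by simp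
      also have "\<dots> = lcs_iso P (y (2 * k) \<otimes>\<^bsub>FL.L\<^esub> inv\<^bsub>FL.L\<^esub> ((z k \<otimes>\<^bsub>FL.L\<^esub> z k) \<otimes>\<^bsub>FL.L\<^esub> inv\<^bsub>FL.L\<^esub> (y (2 * k))))"
        unfolding gW3 gV by (simp add: lcs_iso_mult lcs_iso_inv)
      also have "y (2 * k) \<otimes>\<^bsub>FL.L\<^esub> inv\<^bsub>FL.L\<^esub> ((z k \<otimes>\<^bsub>FL.L\<^esub> z k) \<otimes>\<^bsub>FL.L\<^esub> inv\<^bsub>FL.L\<^esub> (y (2 * k))) = \<phi> b2 \<otimes>\<^bsub>FL.L\<^esub> \<phi> b2"
        unfolding b12 by (simp add: FL.L.inv_mult FL.L.m_ac)
      finally show ?thesis unfolding 2(3) using gr_apply[of "2 * k" "q b2"] by metis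
    next
      case 3
      show ?thesis unfolding rest(2)[OF 3] one
        using higher[OF 3] alpha_beta_closed[OF i] by (simp add: q_def cls_one)
    qed
  qed
  then have "is_johnson_image g (2 * k) f ?D"
    unfolding is_johnson_image_iff using Dh by (simp add: q_def del: SD_sel)
  then show ?thesis using fJ D unfolding johnson_image_def by blast
qed

end


section \<open>Units of a localized polynomial ring and determinants near the identity\<close>

lemma fps_X_power_dvd_iff: "fps_X ^ m dvd (r :: 'a::comm_ring_1 fps) \<longleftrightarrow> (\<forall>i<m. fps_nth r i = 0)"
proof
  assume "fps_X ^ m dvd r"
  then show "\<forall>i<m. fps_nth r i = 0" by (auto simp: fps_X_power_mult_nth)
next
  assume *: "\<forall>i<m. fps_nth r i = 0"
  have "r = fps_X ^ m * fps_shift m r"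
    by (rule fps_ext) (use * in \<open>auto simp: fps_X_power_mult_nth\<close>)
  then show "fps_X ^ m dvd r" by (rule dvdI)
qed

locale two_units =
  fixes b :: "'k::field"
  assumes char2: "(1 :: 'k) + 1 = 0" and b0: "b \<noteq> 0" and b1: "b \<noteq> 1"
begin

abbreviation s :: "'k fps" where "s \<equiv> 1 + fps_X"
abbreviation t :: "'k fps" where "t \<equiv> 1 + fps_const b * fps_X"
abbreviation sp :: "'k poly" where "sp \<equiv> [:1, 1:]"
abbreviation tp :: "'k poly" where "tp \<equiv> [:1, b:]"

lemma s_poly: "s = fps_of_poly sp" and t_poly: "t = fps_of_poly tp"
  by (simp_all add: fps_of_poly_pCons)

text \<open>The polynomial ring localized at \<open>s\<close> and \<open>t\<close>, inside the power
  series ring; a power of s t clears denominators.\<close>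

definition laurent :: "'k fps set" where
  "laurent = {r. \<exists>n p. (s * t) ^ n * r = fps_of_poly p}"

lemma laurent_add: assumes "x \<in> laurent" "y \<in> laurent" shows "x + y \<in> laurent"
proof -
  obtain m p n q where pq: "(s * t) ^ m * x = fps_of_poly p" "(s * t) ^ n * y = fps_of_poly q"
    using assms unfolding laurent_def by blast
  have "(s * t) ^ (m + n) * (x + y) = (s * t) ^ n * ((s * t) ^ m * x) + (s * t) ^ m * ((s * t) ^ n * y)"
    by (simp add: power_add algebra_simps)
  also have "\<dots> = (s * t) ^ n * fps_of_poly p + (s * t) ^ m * fps_of_poly q" by (simp only: pq)
  also have "\<dots> = fps_of_poly ((sp * tp) ^ n * p + (sp * tp) ^ m * q)"
    unfolding s_poly t_poly by (simp only: fps_of_poly_add fps_of_poly_mult fps_of_poly_power)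
  finally show ?thesis unfolding laurent_def by blast
qed

lemma laurent_mult: assumes "x \<in> laurent" "y \<in> laurent" shows "x * y \<in> laurent"
proof -
  obtain m p n q where pq: "(s * t) ^ m * x = fps_of_poly p" "(s * t) ^ n * y = fps_of_poly q"
    using assms unfolding laurent_def by blast
  have "(s * t) ^ (m + n) * (x * y) = ((s * t) ^ m * x) * ((s * t) ^ n * y)"
    by (simp add: power_add algebra_simps)
  also have "\<dots> = fps_of_poly (p * q)" unfolding pq by (simp only: fps_of_poly_mult)
  finally show ?thesis unfolding laurent_def by blast
qed

lemma laurent_poly: "fps_of_poly p \<in> laurent"
  unfolding laurent_def by (intro CollectI exI[of _ 0] exI[of _ p]) simp

lemma laurent_01: "0 \<in> laurent" "1 \<in> laurent" "-1 \<in> laurent"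
  using laurent_poly[of 0] laurent_poly[of 1] laurent_poly[of "-1"] by (simp_all add: fps_of_poly_uminus)

lemma laurent_minus: "x \<in> laurent \<Longrightarrow> - x \<in> laurent"
  using laurent_mult[OF laurent_01(3), of x] by simp

lemma laurent_units: "s \<in> laurent" "t \<in> laurent" "inverse s \<in> laurent" "inverse t \<in> laurent"
proof -
  show "s \<in> laurent" "t \<in> laurent" unfolding s_poly t_poly by (rule laurent_poly)+
  have inv: "inverse s * s = 1" "inverse t * t = 1" by (rule inverse_mult_eq_1, simp)+
  have "(s * t) ^ 1 * inverse s = (inverse s * s) * t" "(s * t) ^ 1 * inverse t = (inverse t * t) * s"
    by (simp_all only: power_one_right ac_simps)
  then have *: "(s * t) ^ 1 * inverse s = t" "(s * t) ^ 1 * inverse t = s"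
    by (simp_all only: inv mult_1_left)
  have "(s * t) ^ 1 * inverse s = fps_of_poly tp" "(s * t) ^ 1 * inverse t = fps_of_poly sp"
    by (rule HOL.trans[OF *(1) t_poly], rule HOL.trans[OF *(2) s_poly])
  then show "inverse s \<in> laurent" "inverse t \<in> laurent" unfolding laurent_def by blast+
qed

lemma laurent_sum: "(\<And>i. i \<in> I \<Longrightarrow> f i \<in> laurent) \<Longrightarrow> sum f I \<in> laurent"
  by (induction I rule: infinite_finite_induct) (auto simp: laurent_01 intro: laurent_add)

lemma laurent_prod: "(\<And>i. i \<in> I \<Longrightarrow> f i \<in> laurent) \<Longrightarrow> prod f I \<in> laurent"
  by (induction I rule: infinite_finite_induct) (auto simp: laurent_01 intro: laurent_mult)

lemma laurent_det:
  assumes A: "A \<in> carrier_mat n n" and "\<And>i j. i < n \<Longrightarrow> j < n \<Longrightarrow> A $$ (i, j) \<in> laurent"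
  shows "det A \<in> laurent"
  unfolding det_def'[OF A]
proof (intro laurent_sum laurent_mult laurent_prod)
  fix p assume "p \<in> {p. p permutes {0..<n}}"
  then show "A $$ (i, p i) \<in> laurent" if "i \<in> {0..<n}" for i
    using assms(2)[of i "p i"] that permutes_in_image[of p "{0..<n}" i] by auto
  show "(signof p :: 'k fps) \<in> laurent" by (auto simp: sign_def laurent_01)
qed

text \<open>The linear polynomials \<open>sp\<close> and \<open>tp\<close> are prime, so each of
  them divides p or q and can be cancelled there, one at a time, until p is left with a
  constant.\<close>

lemma poly_factor:
  "p * q = sp ^ m * tp ^ n \<Longrightarrow> \<exists>c i j. p = smult c (sp ^ i * tp ^ j)"
proof (induction "m + n" arbitrary: m n p q)
  case 0
  then have "p * q = 1" by simp
  then have "p dvd 1" by (metis dvd_triv_left)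
  then obtain c where "p = [:c:]" by (auto elim: is_unit_polyE)
  then show ?case by (intro exI[of _ c] exI[of _ 0]) simp
next
  case (Suc k)
  have step: "\<exists>c i j. p = smult c (sp ^ i * tp ^ j)"
    if l: "l dvd sp ^ m * tp ^ n" "prime_elem l" "l = sp \<and> m = Suc m' \<and> n' = n \<or> l = tp \<and> n = Suc n' \<and> m' = m" for l m' n'
  proof -
    have l0: "l \<noteq> 0" using l(3) by auto
    have fact: "sp ^ m * tp ^ n = l * (sp ^ m' * tp ^ n')"
      using l(3) by (elim disjE conjE) (simp_all only: power_Suc ac_simps)
    have k: "k = m' + n'" using Suc.hyps(2) l(3) by auto
    have "l dvd p * q" using l(1) Suc.prems by simp
    then consider p' where "p = l * p'" | q' where "q = l * q'"
      using l(2) prime_elem_dvd_mult_iff by (metis dvdE)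
    then show ?thesis
    proof cases
      case 1
      then have "p' * q = sp ^ m' * tp ^ n'" using Suc.prems l0 unfolding fact by (simp add: mult.assoc)
      then obtain c i j where "p' = smult c (sp ^ i * tp ^ j)" using Suc.hyps(1)[OF k] by blast
      then have "p = smult c (l * (sp ^ i * tp ^ j))" using 1 by simp
      then show ?thesis using l(3) by (metis mult.assoc mult.left_commute power_Suc)
    next
      case 2
      then have "p * q' = sp ^ m' * tp ^ n'" using Suc.prems l0 unfolding fact by (simp add: mult.left_commute)
      then show ?thesis using Suc.hyps(1)[OF k] by blast
    qed
  qed
  have pr: "prime_elem sp" "prime_elem tp"
    using b0 by (simp_all add: prime_elem_linear_field_poly)
  consider m' where "m = Suc m'" | n' where "n = Suc n'" using Suc.hyps(2) by (cases m; cases n) auto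
  then show ?case
  proof cases
    case 1
    have "sp dvd sp ^ m * tp ^ n" unfolding 1 power_Suc mult.assoc by (rule dvd_triv_left)
    then show ?thesis using step[of sp m' n] pr(1) 1 by blast
  next
    case 2
    have "tp dvd sp ^ m * tp ^ n" unfolding 2 power_Suc mult.left_commute[of _ tp] by (rule dvd_triv_left)
    then show ?thesis using step[of tp m n'] pr(2) 2 by blast
  qed
qed

lemma of_nat_char2: "of_nat n \<in> {0, 1 :: 'k}"
  by (induction n) (use char2 in auto)

lemma diff_char2: "x \<in> {0, 1 :: 'k} \<Longrightarrow> y \<in> {0, 1} \<Longrightarrow> x - y \<in> {0, 1}"
  using char2 by (auto simp: eq_neg_iff_add_eq_0)

text \<open>With u = c s^(i-n) t^(j-n) the logarithmic derivative gives s t u' = (x t + y b s) u,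
  where x and y are the exponents modulo 2. The constant term yields x + y b = 0, and b outside {0,
  1} forces x = y = 0. So u' = 0, and every odd coefficient of u vanishes.\<close>

lemma laurent_unit_coeff:
  assumes u: "u \<in> laurent" "u' \<in> laurent" "u * u' = 1" and k: "k \<ge> 1"
    and low: "\<And>i. 1 \<le> i \<Longrightarrow> i \<le> 2 * k \<Longrightarrow> fps_nth u i = 0"
  shows "fps_nth u (2 * k + 1) = 0"
proof -
  obtain n p n' p' where p: "(s * t) ^ n * u = fps_of_poly p" "(s * t) ^ n' * u' = fps_of_poly p'"
    using u unfolding laurent_def by blast
  have "fps_of_poly (p * p') = (s * t) ^ n * (s * t) ^ n' * (u * u')"
    unfolding fps_of_poly_mult p[symmetric] by (simp only: ac_simps)
  also have "\<dots> = fps_of_poly (sp ^ (n + n') * tp ^ (n + n'))"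
    unfolding u(3) s_poly t_poly
    by (simp only: fps_of_poly_mult fps_of_poly_power power_add power_mult_distrib mult_1_right)
      (simp only: ac_simps)
  finally have "p * p' = sp ^ (n + n') * tp ^ (n + n')" by (simp only: fps_of_poly_eq_iff)
  then obtain c i j where pij: "p = smult c (sp ^ i * tp ^ j)" using poly_factor by blast
  note p(1)
  also have "fps_of_poly p = fps_const c * (fps_of_poly sp ^ i * fps_of_poly tp ^ j)"
    unfolding pij by (simp only: fps_of_poly_smult fps_of_poly_mult fps_of_poly_power)
  also have "\<dots> = fps_const c * (s ^ i * t ^ j)" unfolding s_poly t_poly ..
  finally have eq: "(s * t) ^ n * u = fps_const c * (s ^ i * t ^ j)" .
  have ds: "fps_deriv s = 1" "fps_deriv t = fps_const b" by simp_all
  have gen: "a * fps_deriv (a ^ l) = of_nat l * fps_deriv a * a ^ l" for a :: "'k fps" and l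
  proof (cases l)
    case (Suc m)
    show ?thesis unfolding fps_deriv_power fps_of_nat by (simp only: Suc power_Suc diff_Suc_1 ac_simps)
  qed simp
  have dpow: "s * fps_deriv (s ^ l) = of_nat l * s ^ l" "t * fps_deriv (t ^ l) = of_nat l * fps_const b * t ^ l" for l
    unfolding gen ds by simp_all
  \<comment> \<open>Negative exponents are avoided: the product rule is applied to W u and to W, and
    W is cancelled afterwards.\<close>
  define W where "W = (s * t) ^ n"
  have W0: "W \<noteq> 0"
  proof
    assume "W = 0"
    moreover have "fps_nth W 0 = 1" by (simp add: W_def fps_nth_power_0)
    ultimately show False by simp
  qed
  have D: "s * t * fps_deriv (s ^ i * t ^ j) = (of_nat i * t + of_nat j * fps_const b * s) * (s ^ i * t ^ j)" for i j
  proof -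
    have "s * t * fps_deriv (s ^ i * t ^ j) = t * (s * fps_deriv (s ^ i)) * t ^ j + s * s ^ i * (t * fps_deriv (t ^ j))"
      by (simp only: fps_deriv_mult) (simp only: algebra_simps)
    also have "\<dots> = (of_nat i * t + of_nat j * fps_const b * s) * (s ^ i * t ^ j)"
      unfolding dpow by (simp only: algebra_simps)
    finally show ?thesis .
  qed
  have DW: "s * t * fps_deriv W = (of_nat n * t + of_nat n * fps_const b * s) * W"
    unfolding W_def power_mult_distrib by (rule D)
  have "s * t * fps_deriv (W * u) = fps_const c * (s * t * fps_deriv (s ^ i * t ^ j))"
    unfolding W_def eq by (simp only: fps_deriv_mult fps_deriv_const) (simp only: algebra_simps mult_zero_left mult_zero_right add_0_right add_0_left)
  also have "\<dots> = (of_nat i * t + of_nat j * fps_const b * s) * (W * u)"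
    unfolding D W_def eq by (simp only: ac_simps)
  finally have DWu: "s * t * (W * fps_deriv u + fps_deriv W * u) = (of_nat i * t + of_nat j * fps_const b * s) * (W * u)"
    by (simp only: fps_deriv_mult)
  have ring: "w * (r * du) = w * (x * u - y * u)" if "r * (w * du + dw * u) = x * (w * u)" "r * dw = y * w"
    for r w u du dw x y :: "'k fps"
  proof -
    have "w * (r * du) = r * (w * du + dw * u) - (r * dw) * u" by (simp add: algebra_simps)
    then show ?thesis unfolding that by (simp add: algebra_simps)
  qed
  note ring[OF DWu DW]
  then have key: "s * t * fps_deriv u = (of_nat i * t + of_nat j * fps_const b * s) * u - (of_nat n * t + of_nat n * fps_const b * s) * u"
    using W0 by (simp only: mult_cancel_left) blast
  define x y where "x = of_nat i - (of_nat n :: 'k)" and "y = of_nat j - (of_nat n :: 'k)"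
  have key': "s * t * fps_deriv u = (fps_const x * t + fps_const (y * b) * s) * u"
    unfolding key x_def y_def by (simp add: algebra_simps fps_of_nat[symmetric] flip: fps_const_mult fps_const_sub)
  have "fps_nth u 0 * fps_nth u' 0 = 1" using arg_cong[OF u(3), of "\<lambda>f. fps_nth f 0"] by simp
  then have u0: "fps_nth u 0 \<noteq> 0" by auto
  have "fps_nth (s * t * fps_deriv u) 0 = 0" using low[of 1] k by simp
  then have xy: "x + y * b = 0" unfolding key' using u0 by simp
  have "1 + b \<noteq> 0" using b1 char2 by (metis add_left_cancel)
  moreover have "x \<in> {0, 1}" "y \<in> {0, 1}" unfolding x_def y_def using of_nat_char2 diff_char2 by blast+
  ultimately have "x = 0 \<and> y = 0" using xy b0 by auto
  then have "s * t * fps_deriv u = 0" unfolding key' by simp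
  moreover have "s \<noteq> 0" "t \<noteq> 0"
    by (rule notI, drule arg_cong[of _ _ "\<lambda>f. fps_nth f 0"], simp)+
  ultimately have "fps_deriv u = 0" by simp
  then have "fps_nth (fps_deriv u) (2 * k) = 0" by simp
  \<comment> \<open>The coefficient of the derivative is 2k+1 times the wanted one, and 2k+1 equals
    1 in this field.\<close>
  moreover have "(2 :: 'k) = 0" using char2 by simp
  ultimately show ?thesis by (simp add: fps_deriv_nth)
qed

end

section \<open>Determinants near the identity matrix\<close>

lemma prod_one_plus_dvd:
  fixes f :: "nat \<Rightarrow> 'a::comm_ring_1"
  assumes "finite I" "\<And>i. i \<in> I \<Longrightarrow> e dvd f i"
  shows "e * e dvd (\<Prod>i\<in>I. 1 + f i) - 1 - sum f I \<and> e dvd sum f I"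
  using assms
proof (induction I)
  case (insert i I)
  then have IH: "e * e dvd (\<Prod>i\<in>I. 1 + f i) - 1 - sum f I" "e dvd sum f I" "e dvd f i" by auto
  have "(\<Prod>i\<in>insert i I. 1 + f i) - 1 - sum f (insert i I) =
      (1 + f i) * ((\<Prod>i\<in>I. 1 + f i) - 1 - sum f I) + f i * sum f I"
    using insert by (simp add: algebra_simps)
  moreover have "e * e dvd f i * sum f I" using IH by (intro mult_dvd_mono)
  ultimately show ?case using IH insert by (simp add: dvd_add dvd_mult)
qed simp

text \<open>A permutation other than the identity moves some i and also its image p i, so its
  product has two off-diagonal entries and is divisible by e^2. The identity contributes 1 plus the
  trace up to e^2.\<close>

lemma det_one_plus:
  fixes X :: "'a::comm_ring_1 mat"
  assumes X: "X \<in> carrier_mat n n" and e: "\<And>i j. i < n \<Longrightarrow> j < n \<Longrightarrow> e dvd X $$ (i, j)"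
  shows "e * e dvd det (1\<^sub>m n + X) - 1 - (\<Sum>i<n. X $$ (i, i))"
proof -
  let ?A = "1\<^sub>m n + X"
  let ?P = "{p. p permutes {0..<n}}"
  let ?F = "\<lambda>p. signof p * (\<Prod>i = 0..<n. ?A $$ (i, p i))"
  have A: "?A \<in> carrier_mat n n" using X by simp
  have fin: "finite ?P" by (simp add: finite_permutations)
  have id: "id \<in> ?P" by (simp add: permutes_id)
  have "e * e dvd ?F p" if p: "p \<in> ?P - {id}" for p
  proof -
    have pp: "p permutes {0..<n}" using p by simp
    obtain i where i: "p i \<noteq> i" using p by (auto simp: fun_eq_iff)
    then have "i \<in> {0..<n}" using permutes_not_in[OF pp] by blast
    then have in': "i < n" "p i < n" using permutes_in_image[OF pp, of i] by auto
    have ppi: "p (p i) \<noteq> p i" using i permutes_inj[OF pp] by (auto dest: injD)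
    have ppn: "p (p i) < n" using permutes_in_image[OF pp, of "p i"] in' by auto
    let ?g = "\<lambda>i. ?A $$ (i, p i)"
    have "(\<Prod>i = 0..<n. ?g i) = ?g i * (?g (p i) * prod ?g ({0..<n} - {i} - {p i}))"
      using in' i by (subst prod.remove[of _ i], simp, simp, subst prod.remove[of _ "p i"]) auto
    also have "\<dots> = (?g i * ?g (p i)) * prod ?g ({0..<n} - {i} - {p i})" by (simp only: mult.assoc)
    finally have eq: "(\<Prod>i = 0..<n. ?g i) = \<dots>" .
    have "?g i = X $$ (i, p i)" "?g (p i) = X $$ (p i, p (p i))" using in' ppn i ppi X by auto
    then have "e * e dvd ?g i * ?g (p i)" using e[of i "p i"] e[of "p i" "p (p i)"] in' ppn by (simp add: mult_dvd_mono)
    then show ?thesis unfolding eq by (rule dvd_mult[OF dvd_mult2])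
  qed
  then have rest: "e * e dvd (\<Sum>p\<in>?P - {id}. ?F p)" by (rule dvd_sum)
  have "?F id = (\<Prod>i\<in>{0..<n}. 1 + X $$ (i, i))"
    using X by (simp add: sign_id)
  then have main: "e * e dvd ?F id - 1 - (\<Sum>i\<in>{0..<n}. X $$ (i, i))"
    using prod_one_plus_dvd[of "{0..<n}" e "\<lambda>i. X $$ (i, i)"] e by simp
  have "det ?A = ?F id + (\<Sum>p\<in>?P - {id}. ?F p)"
    unfolding det_def'[OF A] by (rule sum.remove[OF fin id])
  then have "det ?A - 1 - (\<Sum>i<n. X $$ (i, i)) = (?F id - 1 - (\<Sum>i\<in>{0..<n}. X $$ (i, i))) + (\<Sum>p\<in>?P - {id}. ?F p)"
    by (simp add: atLeast0LessThan)
  then show ?thesis using main rest by (simp only: dvd_add)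
qed


section \<open>Fox calculus\<close>

text \<open>The functions \<open>c\<close> and \<open>c'\<close> give the images of the generators and of their inverses in the
  coefficient ring. Swapping them inverts the character. \<open>fox2 c c' i j\<close> is the second derivative:
  the right Fox derivative by \<open>i\<close> of the left Fox derivative by \<open>j\<close>, normalised by \<open>c i\<close>.\<close>

primrec char :: "('a \<Rightarrow> 'r) \<Rightarrow> ('a \<Rightarrow> 'r) \<Rightarrow> 'a letter list \<Rightarrow> 'r::comm_ring_1" where
  "char c c' [] = 1"
| "char c c' (l # w) = (if snd l then c' (fst l) else c (fst l)) * char c c' w"

definition fox_letter :: "('a \<Rightarrow> 'r) \<Rightarrow> 'a \<Rightarrow> 'a letter \<Rightarrow> 'r::comm_ring_1" where
  "fox_letter c' j l = (if fst l = j then (if snd l then - c' j else 1) else 0)"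

primrec fox :: "('a \<Rightarrow> 'r) \<Rightarrow> ('a \<Rightarrow> 'r) \<Rightarrow> 'a \<Rightarrow> 'a letter list \<Rightarrow> 'r::comm_ring_1" where
  "fox c c' j [] = 0"
| "fox c c' j (l # w) = fox_letter c' j l + (if snd l then c' (fst l) else c (fst l)) * fox c c' j w"

primrec fox2 :: "('a \<Rightarrow> 'r) \<Rightarrow> ('a \<Rightarrow> 'r) \<Rightarrow> 'a \<Rightarrow> 'a \<Rightarrow> 'a letter list \<Rightarrow> 'r::comm_ring_1" where
  "fox2 c c' i j [] = 0"
| "fox2 c c' i j (l # w) = (if snd l \<and> fst l = i \<and> fst l = j then 1 else 0) + fox2 c c' i j w +
     (if snd l then c' (fst l) else c (fst l)) * fox_letter c i l * fox c c' j w"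

locale fox_calculus =
  fixes c c' :: "'a \<Rightarrow> 'r::comm_ring_1"
  assumes char_inverse: "c a * c' a = 1"
begin

abbreviation "\<chi> \<equiv> char c c'"
abbreviation "\<chi>' \<equiv> char c' c"
abbreviation "D \<equiv> fox c c'"
abbreviation "D' \<equiv> fox c' c"
abbreviation "D2 \<equiv> fox2 c c'"

lemma char_inverse': "c' a * c a = 1" using char_inverse[of a] by (simp add: mult.commute)

lemma cancel: "c a * (c' a * x) = x" "c' a * (c a * x) = x"
  using char_inverse[of a] char_inverse'[of a] by (simp_all flip: mult.assoc)

lemma push_inv: "push_letter l w \<noteq> l # w \<Longrightarrow> \<exists>ys. w = letter_inv l # ys \<and> push_letter l w = ys"
  by (cases w) (auto split: if_splits)

text \<open>Well-definedness on the free group: the recursions run along arbitrary words, and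
  invariance under a single cancellation carries them over to products of reduced words.\<close>

lemma push:
  "\<chi> (push_letter l w) = \<chi> (l # w)" "\<chi>' (push_letter l w) = \<chi>' (l # w)"
  "D j (push_letter l w) = D j (l # w)" "D' j (push_letter l w) = D' j (l # w)"
  "D2 i j (push_letter l w) = D2 i j (l # w)"
proof -
  have "\<chi> (push_letter l w) = \<chi> (l # w) \<and> \<chi>' (push_letter l w) = \<chi>' (l # w) \<and>
    D j (push_letter l w) = D j (l # w) \<and> D' j (push_letter l w) = D' j (l # w) \<and>
    D2 i j (push_letter l w) = D2 i j (l # w)"
  proof (cases "push_letter l w = l # w")
    case False
    then obtain ys where "w = letter_inv l # ys" "push_letter l w = ys" using push_inv by blast
    then show ?thesis
      by (cases l) (auto simp: letter_inv_def fox_letter_def cancel char_inverse char_inverse' algebra_simps)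
  qed simp
  then show "\<chi> (push_letter l w) = \<chi> (l # w)" "\<chi>' (push_letter l w) = \<chi>' (l # w)"
    "D j (push_letter l w) = D j (l # w)" "D' j (push_letter l w) = D' j (l # w)"
    "D2 i j (push_letter l w) = D2 i j (l # w)" by blast+
qed

lemma char_mult: "\<chi> (foldr push_letter u v) = \<chi> u * \<chi> v" "\<chi>' (foldr push_letter u v) = \<chi>' u * \<chi>' v"
  by (induction u) (simp_all add: push mult.assoc)

lemma fox_mult: "D j (foldr push_letter u v) = D j u + \<chi> u * D j v"
    "D' j (foldr push_letter u v) = D' j u + \<chi>' u * D' j v"
  by (induction u) (simp_all add: push algebra_simps)

text \<open>The deviation from additivity is a product of first derivatives, the left one for the
  inverted character. First derivatives obey a chain rule, which is what gives the second one a
  transformation law under endomorphisms.\<close>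

lemma fox2_mult: "D2 i j (foldr push_letter u v) = D2 i j u + D2 i j v + \<chi> u * D' i u * D j v"
proof (induction u)
  case (Cons l u)
  then show ?case by (simp add: push fox_mult cancel algebra_simps)
qed simp

lemma char_char': "\<chi> w * \<chi>' w = 1"
  by (induction w) (simp_all add: mult.assoc mult.left_commute[of "char c c' _"] cancel char_inverse char_inverse')

end


lemma fps_X_dvd_le: "fps_X ^ i dvd a \<Longrightarrow> n \<le> i \<Longrightarrow> fps_X ^ n dvd (a :: 'a::comm_ring_1 fps)"
  by (rule dvd_trans[OF le_imp_power_dvd])

lemma fps_X_dvd_mult:
  assumes "fps_X ^ i dvd a" "fps_X ^ j dvd b" "n \<le> i + j"
  shows "fps_X ^ n dvd (a * b :: 'a::comm_ring_1 fps)"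
  using mult_dvd_mono[OF assms(1,2)] assms(3) by (simp add: fps_X_dvd_le flip: power_add)

context fox_calculus
begin

lemma fox_calculus_swap: "fox_calculus c' c"
  by unfold_locales (rule char_inverse')

lemma free_char:
  assumes "u \<in> carrier (free_group T)"
  shows "\<chi> (inv\<^bsub>free_group T\<^esub> u) = \<chi>' u" "D j (inv\<^bsub>free_group T\<^esub> u) = - (\<chi>' u * D j u)"
proof -
  interpret G: group "free_group T" by (rule group_free_group)
  have "foldr push_letter (inv\<^bsub>free_group T\<^esub> u) u = []"
    using G.l_inv[OF assms] by simp
  then have *: "\<chi> (inv\<^bsub>free_group T\<^esub> u) * \<chi> u = 1" "D j (inv\<^bsub>free_group T\<^esub> u) + \<chi> (inv\<^bsub>free_group T\<^esub> u) * D j u = 0"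
    using char_mult(1)[of "inv\<^bsub>free_group T\<^esub> u" u] fox_mult(1)[of j "inv\<^bsub>free_group T\<^esub> u" u] by simp_all
  have "\<chi> (inv\<^bsub>free_group T\<^esub> u) = \<chi> (inv\<^bsub>free_group T\<^esub> u) * (\<chi> u * \<chi>' u)" by (simp add: char_char')
  also have "\<dots> = \<chi>' u" using * by (simp flip: mult.assoc)
  finally show a: "\<chi> (inv\<^bsub>free_group T\<^esub> u) = \<chi>' u" .
  show "D j (inv\<^bsub>free_group T\<^esub> u) = - (\<chi>' u * D j u)"
    using *(2) unfolding a by (simp add: eq_neg_iff_add_eq_0)
qed

lemma free_comm:
  assumes u: "u \<in> carrier (free_group T)" and v: "v \<in> carrier (free_group T)"
  shows "\<chi> (commutator (free_group T) u v) = 1"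
    "D j (commutator (free_group T) u v) = (1 - \<chi> v) * D j u + (\<chi> u - 1) * D j v"
proof -
  interpret G: group "free_group T" by (rule group_free_group)
  have c: "\<chi> u * \<chi>' u = 1" "\<chi> v * \<chi>' v = 1" by (simp_all add: char_char')
  have c': "\<chi> u * (\<chi>' u * x) = x" "\<chi> v * (\<chi>' v * x) = x" for x
    by (simp_all add: c flip: mult.assoc)
  then have c'': "\<chi> u * (\<chi> v * (\<chi>' u * x)) = \<chi> v * x" for x by (metis mult.left_commute)
  show "\<chi> (commutator (free_group T) u v) = 1"
    by (simp add: c c' c'' commutator_def char_mult free_char u v algebra_simps)
  show "D j (commutator (free_group T) u v) = (1 - \<chi> v) * D j u + (\<chi> u - 1) * D j v"
    by (simp add: c c' c'' commutator_def char_mult fox_mult free_char u v algebra_simps)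
qed

end

section \<open>Power series coefficients in characteristic 2\<close>

locale fox_series = fox_calculus c c' for c c' :: "'a \<Rightarrow> 'k::comm_ring_1 fps" +
  assumes char2: "(1 :: 'k) + 1 = 0" and near_one: "fps_X dvd c a - 1"
begin

lemma fps_char2: "(x :: 'k fps) + x = 0"
proof (rule fps_ext)
  fix n
  have "fps_nth x n + fps_nth x n = fps_nth x n * (1 + 1)" by (simp only: distrib_left mult_1_right)
  then show "fps_nth (x + x) n = fps_nth 0 n" unfolding char2 fps_add_nth by simp
qed

lemma fps_minus: "- (x :: 'k fps) = x"
  using fps_char2[of x] by (simp add: eq_neg_iff_add_eq_0 minus_equation_iff)

lemma dvd_swap: "x dvd a - b \<Longrightarrow> x dvd b - (a :: 'k fps)"
  by (metis dvd_minus_iff minus_diff_eq)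

lemma near_one': "fps_X dvd c' a - 1"
proof -
  have "c' a - 1 = - (c' a * (c a - 1))" using char_inverse'[of a] by (simp add: algebra_simps)
  then show ?thesis using near_one[of a] by (metis dvd_minus_iff dvd_mult)
qed

lemma dvd_prod_diff: "x dvd a - 1 \<Longrightarrow> x dvd b - 1 \<Longrightarrow> x dvd a * b - (1 :: 'k fps)"
proof -
  assume "x dvd a - 1" "x dvd b - 1"
  then have "x dvd (a - 1) * b + (b - 1)" by auto
  then show ?thesis by (simp add: algebra_simps)
qed

lemma dvd_prod_diff2: "x dvd a - a' \<Longrightarrow> x dvd b - b' \<Longrightarrow> x dvd a * b - a' * (b' :: 'k fps)"
proof -
  assume "x dvd a - a'" "x dvd b - b'"
  then have "x dvd (a - a') * b + a' * (b - b')" by auto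
  then show ?thesis by (simp add: algebra_simps)
qed

text \<open>In characteristic 2, c - c' = c' (c - 1)^2, so inverting the character changes its
  values only from order X^2 on.\<close>

lemma word_near:
  "fps_X dvd \<chi> w - 1" "fps_X ^ 2 dvd \<chi>' w - \<chi> w" "fps_X dvd D' j w - D j w"
proof -
  have sq: "fps_X ^ 2 dvd c a - c' a" for a
  proof -
    have "c a - c' a = c' a * ((c a - 1) * (c a + 1))"
      using char_inverse'[of a] by (simp add: algebra_simps cancel)
    also have "c a + 1 = c a - 1" using fps_minus[of 1] by simp
    finally show ?thesis using near_one[of a] by (simp add: power2_eq_square dvd_mult mult_dvd_mono)
  qed
  then have sq': "fps_X ^ 2 dvd c' a - c a" for a by (rule dvd_swap)
  show "fps_X dvd \<chi> w - 1"
    by (induction w) (auto intro!: dvd_prod_diff simp: near_one near_one')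
  show "fps_X ^ 2 dvd \<chi>' w - \<chi> w"
    by (induction w) (auto intro!: dvd_prod_diff2 simp: sq sq')
  have "fps_X dvd fps_X ^ 2" by (simp add: power2_eq_square)
  then have 1: "fps_X dvd c a - c' a" "fps_X dvd c' a - c a" for a using sq sq' dvd_trans by blast+
  have letter: "fps_X dvd fox_letter c j l - fox_letter c' j l" for l
    using 1[of j] by (auto simp: fox_letter_def)
  show "fps_X dvd D' j w - D j w"
  proof (induction w)
    case (Cons l w)
    let ?p = "if snd l then c (fst l) else c' (fst l)" and ?q = "if snd l then c' (fst l) else c (fst l)"
    have "fps_X dvd ?p * D' j w - ?q * D j w"
      using Cons 1 by (intro dvd_prod_diff2) auto
    then have "fps_X dvd (fox_letter c j l - fox_letter c' j l) + (?p * D' j w - ?q * D j w)"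
      using letter by (rule dvd_add[rotated])
    then show ?case by (simp add: algebra_simps if_distrib split: if_splits)
  qed simp
qed

text \<open>Only in characteristic 2 does inverting the character preserve the leading terms.\<close>

lemma lcs_near:
  assumes "v \<in> lcs (free_group T) (Suc m)"
  shows "fps_X ^ Suc m dvd \<chi> v - 1 \<and> fps_X ^ (m + 2) dvd \<chi>' v - \<chi> v \<and> fps_X ^ m dvd D j v \<and>
    fps_X ^ Suc m dvd D' j v - D j v \<and> (m > 0 \<longrightarrow> \<chi> v = 1 \<and> \<chi>' v = 1)"
  using assms
proof (induction m arbitrary: v)
  case 0
  then show ?case using word_near[where w = v] by (simp add: numeral_2_eq_2)
next
  case (Suc m)
  interpret G: group "free_group T" by (rule group_free_group)
  interpret swap: fox_calculus c' c by (rule fox_calculus_swap)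
  let ?C = "{commutator (free_group T) x y |x y. x \<in> carrier (free_group T) \<and> y \<in> lcs (free_group T) (Suc m)}"
  let ?Q = "\<lambda>v. v \<in> carrier (free_group T) \<and> \<chi> v = 1 \<and> \<chi>' v = 1 \<and> fps_X ^ Suc m dvd D j v \<and> fps_X ^ (m + 2) dvd D' j v - D j v"
  have comm: "?Q (commutator (free_group T) x y)"
    if x: "x \<in> carrier (free_group T)" and y: "y \<in> lcs (free_group T) (Suc m)" for x y
  proof -
    have y': "y \<in> carrier (free_group T)" using y by simp
    note IH = Suc.IH[OF y]
    have 1: "fps_X ^ Suc m dvd 1 - \<chi> y" by (rule dvd_swap) (use IH in blast)
    have 2: "fps_X ^ 1 dvd \<chi> x - 1" using word_near by simp
    have 3: "fps_X ^ 1 dvd D' j x - D j x" using word_near by simp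
    have 4: "fps_X ^ (m + 2) dvd \<chi> y - \<chi>' y" by (rule dvd_swap) (use IH in blast)
    have d: "fps_X ^ Suc m dvd (1 - \<chi> y) * D j x + (\<chi> x - 1) * D j y"
      by (intro dvd_add dvd_mult2[OF 1] fps_X_dvd_mult[OF 2, of m]) (use IH in blast, simp)
    \<comment> \<open>The difference of the two commutator formulas, split so that each summand
      contains a comparison of some quantity with its counterpart for the inverted character; this
      comparison gains one order.\<close>
    have "fps_X ^ (m + 2) dvd (\<chi> y - \<chi>' y) * D' j x + (1 - \<chi> y) * (D' j x - D j x)
      + ((\<chi>' x - \<chi> x) * D' j y + (\<chi> x - 1) * (D' j y - D j y))"
    proof (intro dvd_add)
      show "fps_X ^ (m + 2) dvd (\<chi> y - \<chi>' y) * D' j x" by (rule dvd_mult2[OF 4])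
      show "fps_X ^ (m + 2) dvd (1 - \<chi> y) * (D' j x - D j x)"
        by (rule fps_X_dvd_mult[OF 1 3]) simp
      have "fps_X ^ m dvd D' j y - D j y" by (rule fps_X_dvd_le[of "Suc m"]) (use IH in blast, simp)
      then have "fps_X ^ m dvd (D' j y - D j y) + D j y" using IH by (intro dvd_add) blast+
      then have "fps_X ^ m dvd D' j y" by simp
      then show "fps_X ^ (m + 2) dvd (\<chi>' x - \<chi> x) * D' j y"
        by (rule fps_X_dvd_mult[OF word_near(2)]) simp
      show "fps_X ^ (m + 2) dvd (\<chi> x - 1) * (D' j y - D j y)"
        by (rule fps_X_dvd_mult[OF 2, of "Suc m"]) (use IH in blast, simp)
    qed
    also have "(\<chi> y - \<chi>' y) * D' j x + (1 - \<chi> y) * (D' j x - D j x)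
      + ((\<chi>' x - \<chi> x) * D' j y + (\<chi> x - 1) * (D' j y - D j y)) =
      ((1 - \<chi>' y) * D' j x + (\<chi>' x - 1) * D' j y) - ((1 - \<chi> y) * D j x + (\<chi> x - 1) * D j y)"
      by (simp add: algebra_simps)
    finally show ?thesis
      using d free_comm[OF x y'] swap.free_comm[OF x y'] x y' by simp
  qed
  have "v \<in> generate (free_group T) ?C" using Suc.prems by (simp add: lcs.simps(3))
  then have "?Q v"
  proof (induction v rule: generate.induct)
    case (incl h)
    then show ?case using comm by blast
  next
    case (inv h)
    then have h: "?Q h" using comm by blast
    then have "D' j (inv\<^bsub>free_group T\<^esub> h) = - D' j h" "D j (inv\<^bsub>free_group T\<^esub> h) = - D j h"
      using free_char[of h T] swap.free_char[of h T] by simp_all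
    moreover have "fps_X ^ (m + 2) dvd D j h - D' j h" by (rule dvd_swap) (use h in blast)
    ultimately show ?case using h free_char(1)[of h T] swap.free_char(1)[of h T] by simp
  next
    case (eng h1 h2)
    have e: "D' j h1 + D' j h2 - (D j h1 + D j h2) = (D' j h1 - D j h1) + (D' j h2 - D j h2)"
      by simp
    have "fps_X ^ (m + 2) dvd D' j h1 + D' j h2 - (D j h1 + D j h2)"
      unfolding e using eng by (intro dvd_add) simp_all
    moreover have "h1 \<otimes>\<^bsub>free_group T\<^esub> h2 \<in> carrier (free_group T)" using eng by blast
    ultimately show ?case using eng by (simp add: char_mult fox_mult)
  qed (simp add: free_group_carrier)
  then show ?case by auto
qed

end


section \<open>Chain rules for first and second Fox derivatives\<close>

context fox_calculus
begin

lemma char_inverse_unique: "\<chi> u = c a \<longleftrightarrow> \<chi>' u = c' a"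
proof -
  have "\<chi>' u = c' a" if "\<chi> u = c a"
    using char_char'[of u] cancel(2)[of a "\<chi>' u"] that by simp
  moreover have "\<chi> u = c a" if "\<chi>' u = c' a"
    using char_char'[of u] cancel(1)[of a "\<chi> u"] that by (simp add: mult.commute)
  ultimately show ?thesis by blast
qed

lemma chain_rule:
  assumes T: "finite T" and f: "f \<in> hom (free_group T) (free_group T)"
    and fc: "\<And>a. a \<in> T \<Longrightarrow> \<chi> (f [(a, False)]) = c a" and w: "w \<in> carrier (free_group T)"
  shows "\<chi> (f w) = \<chi> w" "D j (f w) = (\<Sum>i\<in>T. D i w * D j (f [(i, False)]))"
proof -
  interpret f: group_hom "free_group T" "free_group T" f
    using f by (simp add: group_hom_def group_hom_axioms_def group_free_group)
  have "\<chi> (f w) = \<chi> w \<and> D j (f w) = (\<Sum>i\<in>T. D i w * D j (f [(i, False)]))" using w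
  proof (induction w)
    case Nil
    then show ?case using f.hom_one by simp
  next
    case (Cons l w)
    note lw = free_group_Cons[OF Cons.prems]
    obtain a b where l: "l = (a, b)" by fastforce
    have a: "a \<in> T" using lw(1) by (simp add: l free_group_carrier)
    then have ga: "[(a, False)] \<in> carrier (free_group T)" by (simp add: free_group_carrier)
    have fl: "\<chi> (f [l]) = \<chi> [l] \<and> D j (f [l]) = (if b then - c' a else 1) * D j (f [(a, False)])"
    proof (cases b)
      case True
      then have "f [l] = inv\<^bsub>free_group T\<^esub> (f [(a, False)])"
        using f.hom_inv[OF ga] by (simp add: l free_group_inv_letter[OF a])
      moreover have "\<chi>' (f [(a, False)]) = c' a" using fc[OF a] char_inverse_unique by blast
      ultimately show ?thesis using True free_char[OF f.hom_closed[OF ga]] by (simp add: l)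
    qed (simp add: l fc a)
    have "f (l # w) = foldr push_letter (f [l]) (f w)"
      using f.hom_mult[OF lw(1,2)] lw(3) by simp
    moreover have "(\<Sum>i\<in>T. fox_letter c' i l * D j (f [(i, False)])) =
        (if b then - c' a else 1) * D j (f [(a, False)])"
    proof -
      have "(\<Sum>i\<in>T. fox_letter c' i l * D j (f [(i, False)])) =
        (\<Sum>i\<in>T. if i = a then (if b then - c' a else 1) * D j (f [(a, False)]) else 0)"
        by (rule sum.cong) (auto simp: fox_letter_def l)
      then show ?thesis using T a by simp
    qed
    ultimately show ?case
      using fl Cons.IH[OF lw(2)]
      by (simp add: char_mult fox_mult distrib_right sum.distrib sum_distrib_left mult.assoc)
  qed
  then show "\<chi> (f w) = \<chi> w" "D j (f w) = (\<Sum>i\<in>T. D i w * D j (f [(i, False)]))" by blast+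
qed

text \<open>The defect between both sides is additive, hence vanishes on commutators.\<close>

lemma fox2_chain_rule:
  assumes T: "finite T" and f: "f \<in> hom (free_group T) (free_group T)"
    and fc: "\<And>a. a \<in> T \<Longrightarrow> \<chi> (f [(a, False)]) = c a" and w: "w \<in> lcs (free_group T) 2"
  shows "D2 l j (f w) = (\<Sum>p\<in>T. \<Sum>q\<in>T. D' l (f [(p, False)]) * D2 p q w * D j (f [(q, False)]))"
proof -
  interpret G: group "free_group T" by (rule group_free_group)
  interpret f: group_hom "free_group T" "free_group T" f
    using f by (simp add: group_hom_def group_hom_axioms_def group_free_group)
  interpret swap: fox_calculus c' c by (rule fox_calculus_swap)
  define E where "E w = D2 l j (f w) -
    (\<Sum>p\<in>T. \<Sum>q\<in>T. D' l (f [(p, False)]) * D2 p q w * D j (f [(q, False)]))" for w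
  have fc': "\<chi>' (f [(a, False)]) = c' a" if "a \<in> T" for a
    using fc[OF that] char_inverse_unique by blast
  have E_mult: "E (u \<otimes>\<^bsub>free_group T\<^esub> v) = E u + E v"
    if u: "u \<in> carrier (free_group T)" and v: "v \<in> carrier (free_group T)" for u v
  proof -
    have "(\<Sum>p\<in>T. \<Sum>q\<in>T. D' l (f [(p, False)]) * (\<chi> u * D' p u * D q v) * D j (f [(q, False)])) =
      \<chi> u * ((\<Sum>p\<in>T. D' p u * D' l (f [(p, False)])) * (\<Sum>q\<in>T. D q v * D j (f [(q, False)])))"
      unfolding sum_product unfolding sum_distrib_left by (simp add: mult_ac)
    also have "\<dots> = \<chi> (f u) * D' l (f u) * D j (f v)"
      using chain_rule[OF T f fc u] chain_rule[OF T f fc v] swap.chain_rule(2)[OF T f fc' u]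
      by (simp add: mult.assoc)
    finally show ?thesis
      using f.hom_mult[OF u v]
      by (simp add: E_def fox2_mult distrib_left distrib_right sum.distrib)
  qed
  have E_one: "E [] = 0" using E_mult[of "[]" "[]"] by (simp add: free_group_carrier)
  have E_inv: "E (inv\<^bsub>free_group T\<^esub> u) = - E u" if "u \<in> carrier (free_group T)" for u
    using E_mult[OF that G.inv_closed[OF that]] G.r_inv[OF that] E_one
    by (simp add: eq_neg_iff_add_eq_0 add.commute)
  have E_comm: "E (commutator (free_group T) u v) = 0"
    if u: "u \<in> carrier (free_group T)" and v: "v \<in> carrier (free_group T)" for u v
    using u v by (simp add: commutator_def E_mult E_inv del: free_group_sel)
  have w': "w \<in> generate (free_group T) {commutator (free_group T) x y |x y.
      x \<in> carrier (free_group T) \<and> y \<in> lcs (free_group T) (Suc 0)}"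
    using w by (simp add: numeral_2_eq_2 lcs.simps(3))
  have "w \<in> carrier (free_group T) \<and> E w = 0" using w'
  proof (induction w rule: generate.induct)
    case (incl h)
    then show ?case using E_comm by auto
  next
    case (inv h)
    then have "h \<in> carrier (free_group T)" "E h = 0" using E_comm by auto
    then show ?case by (simp add: E_inv)
  next
    case (eng h1 h2)
    then show ?case using E_mult[of h1 h2] G.m_closed[of h1 h2] by (simp del: free_group_sel)
  qed (simp add: E_one free_group_carrier)
  then show ?thesis by (simp add: E_def)
qed

end


lemma sum_perturbed_bilinear:
  fixes \<Omega> :: "'a \<Rightarrow> 'a \<Rightarrow> 'r::comm_ring_1"
  assumes "finite T" "l \<in> T" "j \<in> T"
  shows "(\<Sum>p\<in>T. \<Sum>q\<in>T. (of_bool (p = l) + x p) * \<Omega> p q * (of_bool (q = j) + y q)) =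
    \<Omega> l j + (\<Sum>p\<in>T. x p * \<Omega> p j) + (\<Sum>q\<in>T. \<Omega> l q * y q) + (\<Sum>p\<in>T. \<Sum>q\<in>T. x p * \<Omega> p q * y q)"
proof -
  have delta: "(\<Sum>p\<in>T. (of_bool (p = i) + f p) * h p) = h i + (\<Sum>p\<in>T. f p * h p)"
    if "i \<in> T" for i and f h :: "'a \<Rightarrow> 'r"
  proof -
    have "(\<Sum>p\<in>T. of_bool (p = i) * h p) = (\<Sum>p\<in>T. if p = i then h i else 0)"
      by (rule sum.cong) auto
    then show ?thesis using \<open>finite T\<close> that by (simp add: distrib_right sum.distrib)
  qed
  have inner: "(\<Sum>q\<in>T. (of_bool (p = l) + x p) * \<Omega> p q * (of_bool (q = j) + y q)) =
      (of_bool (p = l) + x p) * (\<Omega> p j + (\<Sum>q\<in>T. y q * \<Omega> p q))" for p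
    unfolding delta[OF \<open>j \<in> T\<close>, symmetric] sum_distrib_left by (simp add: mult_ac)
  show ?thesis
    unfolding inner delta[OF \<open>l \<in> T\<close>] by (simp add: distrib_left sum.distrib sum_distrib_left mult_ac)
qed

section \<open>Second derivatives of the boundary word\<close>

locale surface_fox = surface2 g + fox_series c c'
  for g and c c' :: "surface_gen \<Rightarrow> 'k::comm_ring_1 fps" +
  assumes c_beta: "c (Beta i) = 1" and c_alpha: "i \<ge> 3 \<Longrightarrow> c (Alpha i) = 1"
begin

definition "gens = Alpha ` {1..g} \<union> Beta ` {1..g}"

lemma P_gens: "P = free_group gens"
  by (simp add: P_def surface_group_def gens_def)

lemma finite_gens: "finite gens" by (simp add: gens_def)

lemma gens_mem [simp]: "i \<in> {1..g} \<Longrightarrow> Alpha i \<in> gens" "i \<in> {1..g} \<Longrightarrow> Beta i \<in> gens"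
  by (simp_all add: gens_def)

lemma letter_closed: "a \<in> gens \<Longrightarrow> [(a, False)] \<in> carrier P"
  by (simp add: P_gens free_group_carrier)

lemma c'_beta: "c' (Beta i) = 1"
  using char_inverse[of "Beta i"] by (simp add: c_beta)

lemma mult_P: "u \<otimes>\<^bsub>P\<^esub> v = foldr push_letter u v" by (simp add: P_gens)

lemma boundary_factor_word:
  assumes "i \<in> {1..g}"
  shows "boundary_factor i = [(Beta i, True), (Alpha i, False), (Beta i, False), (Alpha i, True)]"
proof -
  have "inv\<^bsub>P\<^esub> (beta i) = [(Beta i, True)]" "inv\<^bsub>P\<^esub> (alpha i) = [(Alpha i, True)]"
    using assms by (simp_all add: P_gens alpha_def beta_def free_group_inv_letter)
  moreover from this have "inv\<^bsub>P\<^esub> [(Beta i, True)] = beta i"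
    using assms inv_inv[of "beta i"] by simp
  ultimately show ?thesis
    using assms by (simp add: commutator_def mult_P alpha_def beta_def letter_inv_def)
qed

text \<open>Only the row of \<open>Alpha i\<close> and the column of \<open>Beta i\<close> are
  computed: \<open>diagonal_relation\<close> takes the entry at this row and column of the
  symplecticity relation, which involves nothing else.\<close>

lemma fox2_boundary_factor:
  assumes "m \<in> {1..g}"
  shows "D2 (Alpha i) q (boundary_factor m) = (if m = i \<and> q = Beta i then c (Alpha i) else 0)"
    "D2 p (Beta i) (boundary_factor m) = (if m = i then if p = Alpha i then c (Alpha i)
      else if p = Beta i then 1 - c (Alpha i) else 0 else 0)"
  unfolding boundary_factor_word[OF assms]
  by (auto simp: fox_letter_def c_beta c'_beta char_inverse char_inverse' cancel)

lemma lcs_fox: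
  assumes "v \<in> lcs P (Suc m)"
  shows "fps_X ^ m dvd D j v" "fps_X ^ Suc m dvd D' j v - D j v" "fps_X ^ m dvd D' j v"
    "m > 0 \<Longrightarrow> \<chi> v = 1" "m > 0 \<Longrightarrow> \<chi>' v = 1"
proof -
  note * = lcs_near[OF assms[unfolded P_gens], of j]
  then show "fps_X ^ m dvd D j v" "fps_X ^ Suc m dvd D' j v - D j v"
    "m > 0 \<Longrightarrow> \<chi> v = 1" "m > 0 \<Longrightarrow> \<chi>' v = 1" by blast+
  have "fps_X ^ m dvd D' j v - D j v" by (rule fps_X_dvd_le[of "Suc m"]) (use * in blast, simp)
  then have "fps_X ^ m dvd (D' j v - D j v) + D j v" using * by (intro dvd_add) blast+
  then show "fps_X ^ m dvd D' j v" by simp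
qed

lemma boundary_factor_lcs: "i \<in> {1..g} \<Longrightarrow> boundary_factor i \<in> lcs P 2"
  using commutator_in_lcs_Suc[of "inv\<^bsub>P\<^esub> (beta i)" "alpha i" 1] by (simp add: numeral_2_eq_2)

lemma fox2_boundary_word:
  "set is \<subseteq> {1..g} \<Longrightarrow> foldr (\<lambda>i w. boundary_factor i \<otimes>\<^bsub>P\<^esub> w) is \<one>\<^bsub>P\<^esub> \<in> lcs P 2 \<and>
    fps_X ^ 2 dvd D2 p q (foldr (\<lambda>i w. boundary_factor i \<otimes>\<^bsub>P\<^esub> w) is \<one>\<^bsub>P\<^esub>) -
      (\<Sum>i\<leftarrow>is. D2 p q (boundary_factor i))"
proof (induction "is")
  case Nil
  have "D2 p q \<one>\<^bsub>P\<^esub> = 0" by (simp add: P_gens)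
  then show ?case by simp
next
  case (Cons i "is")
  let ?w = "foldr (\<lambda>i w. boundary_factor i \<otimes>\<^bsub>P\<^esub> w) is \<one>\<^bsub>P\<^esub>"
  have w: "?w \<in> lcs P (Suc 1)" "boundary_factor i \<in> lcs P (Suc 1)"
    using Cons boundary_factor_lcs[of i] by (simp_all add: numeral_2_eq_2)
  have "fps_X ^ 2 dvd D' p (boundary_factor i) * D q ?w"
    by (rule fps_X_dvd_mult[OF lcs_fox(3)[OF w(2)] lcs_fox(1)[OF w(1)]]) simp
  then have "fps_X ^ 2 dvd (D2 p q ?w - (\<Sum>i\<leftarrow>is. D2 p q (boundary_factor i))) +
      \<chi> (boundary_factor i) * (D' p (boundary_factor i) * D q ?w)"
    using Cons by (intro dvd_add dvd_mult[of _ "D' p (boundary_factor i) * D q ?w"]) auto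
  then have "fps_X ^ 2 dvd D2 p q (boundary_factor i \<otimes>\<^bsub>P\<^esub> ?w) - (\<Sum>i\<leftarrow>i # is. D2 p q (boundary_factor i))"
    by (simp add: mult_P fox2_mult algebra_simps)
  then show ?case using w by (simp add: numeral_2_eq_2)
qed

text \<open>At X = 0 this is the standard symplectic matrix. It approximates the second derivatives
  of \<zeta>^-1, since the cross terms between different boundary factors are products of two first
  derivatives of order X each.\<close>

definition "\<Omega>0 p q = (\<Sum>i\<in>{1..g}. D2 p q (boundary_factor i))"

lemma fox2_inv_zeta:
  "inv\<^bsub>P\<^esub> (zeta g) \<in> lcs P 2" "fps_X ^ 2 dvd D2 p q (inv\<^bsub>P\<^esub> (zeta g)) - \<Omega>0 p q"
proof -
  let ?w = "foldr (\<lambda>i w. boundary_factor i \<otimes>\<^bsub>P\<^esub> w) [1..<g + 1] \<one>\<^bsub>P\<^esub>"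
  have s: "set [1..<g + 1] = {1..g}" by auto
  note * = fox2_boundary_word[of "[1..<g + 1]" p q]
  have "(\<Sum>i\<leftarrow>[1..<g + 1]. D2 p q (boundary_factor i)) = \<Omega>0 p q"
    unfolding \<Omega>0_def using s by (subst sum_list_distinct_conv_sum_set) auto
  moreover have "inv\<^bsub>P\<^esub> (zeta g) = ?w"
    unfolding zeta_eq by (rule inv_inv) (use * s in auto)
  ultimately show "inv\<^bsub>P\<^esub> (zeta g) \<in> lcs P 2" "fps_X ^ 2 dvd D2 p q (inv\<^bsub>P\<^esub> (zeta g)) - \<Omega>0 p q"
    using * s by simp_all
qed

lemma \<Omega>0_simps:
  assumes "i \<in> {1..g}"
  shows "\<Omega>0 (Alpha i) q = (if q = Beta i then c (Alpha i) else 0)"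
    "\<Omega>0 p (Beta i) = (if p = Alpha i then c (Alpha i) else if p = Beta i then 1 - c (Alpha i) else 0)"
proof -
  have *: "(\<Sum>m\<in>{1..g}. if m = i then x else 0) = (x :: 'k fps)" for x
    using assms by (simp add: sum.delta)
  show "\<Omega>0 (Alpha i) q = (if q = Beta i then c (Alpha i) else 0)"
    using *[of "if q = Beta i then c (Alpha i) else 0"] unfolding \<Omega>0_def
    by (subst (asm) sum.cong[OF HOL.refl, where h = "\<lambda>m. D2 (Alpha i) q (boundary_factor m)"])
       (auto simp: fox2_boundary_factor)
  show "\<Omega>0 p (Beta i) = (if p = Alpha i then c (Alpha i) else if p = Beta i then 1 - c (Alpha i) else 0)"
    using *[of "if p = Alpha i then c (Alpha i) else if p = Beta i then 1 - c (Alpha i) else 0"] unfolding \<Omega>0_def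
    by (subst (asm) sum.cong[OF HOL.refl, where h = "\<lambda>m. D2 p (Beta i) (boundary_factor m)"])
       (auto simp: fox2_boundary_factor)
qed

end

section \<open>The symplecticity relation for the Jacobian of a map near the identity\<close>

locale near_identity = surface_fox g c c'
  for g and c c' :: "surface_gen \<Rightarrow> 'k::comm_ring_1 fps" +
  fixes f and K :: nat
  assumes f_hom: "f \<in> hom P P" and f_zeta: "f (zeta g) = zeta g" and K: "K \<ge> 2"
    and f_shift: "x \<in> carrier P \<Longrightarrow> f x \<otimes>\<^bsub>P\<^esub> inv\<^bsub>P\<^esub> x \<in> lcs P (Suc K)"
begin

sublocale f: group_hom P P f
  using f_hom by unfold_locales

definition "dev a = f [(a, False)] \<otimes>\<^bsub>P\<^esub> inv\<^bsub>P\<^esub> [(a, False)]"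

lemma dev_lcs: "a \<in> gens \<Longrightarrow> dev a \<in> lcs P (Suc K)"
  unfolding dev_def by (intro f_shift letter_closed)

lemma f_letter:
  assumes "a \<in> gens"
  shows "\<chi> (f [(a, False)]) = c a" "D j (f [(a, False)]) = of_bool (a = j) + D j (dev a)"
    "D' j (f [(a, False)]) = of_bool (a = j) + D' j (dev a)"
proof -
  have a: "[(a, False)] \<in> carrier P" by (rule letter_closed[OF assms])
  then have "f [(a, False)] = dev a \<otimes>\<^bsub>P\<^esub> [(a, False)]" by (simp add: dev_def m_assoc)
  then have *: "f [(a, False)] = foldr push_letter (dev a) [(a, False)]" by (simp add: mult_P)
  have "\<chi> (dev a) = 1" "\<chi>' (dev a) = 1" using lcs_fox(4,5)[OF dev_lcs[OF assms]] K by simp_all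
  then show "\<chi> (f [(a, False)]) = c a" "D j (f [(a, False)]) = of_bool (a = j) + D j (dev a)"
    "D' j (f [(a, False)]) = of_bool (a = j) + D' j (dev a)"
    unfolding * by (auto simp: char_mult fox_mult fox_letter_def)
qed

text \<open>The linearization of J'^T \<Omega> J = \<Omega>, which is \<open>fox2_chain_rule\<close>
  at the fixed word \<zeta>^-1. The quadratic terms have order 2K, which is at least K+2, and
  replacing \<Omega> by \<open>\<Omega>0\<close> costs X^2 times X^K.\<close>

lemma pushforward_relation:
  assumes l: "l \<in> gens" and j: "j \<in> gens"
  shows "fps_X ^ (K + 2) dvd (\<Sum>p\<in>gens. D' l (dev p) * \<Omega>0 p j) + (\<Sum>q\<in>gens. \<Omega>0 l q * D j (dev q))"
proof -
  let ?w = "inv\<^bsub>P\<^esub> (zeta g)"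
  have fw: "f ?w = ?w" using f_zeta zeta_closed by simp
  have "D2 l j ?w = (\<Sum>p\<in>gens. \<Sum>q\<in>gens. D' l (f [(p, False)]) * D2 p q ?w * D j (f [(q, False)]))"
    using fox2_chain_rule[OF finite_gens, of f ?w l j] f_hom f_letter(1) fox2_inv_zeta(1) fw
    by (simp add: P_gens)
  also have "\<dots> = (\<Sum>p\<in>gens. \<Sum>q\<in>gens.
      (of_bool (p = l) + D' l (dev p)) * D2 p q ?w * (of_bool (q = j) + D j (dev q)))"
    by (intro sum.cong) (simp_all add: f_letter)
  finally have zero: "0 = (\<Sum>p\<in>gens. D' l (dev p) * D2 p j ?w) + (\<Sum>q\<in>gens. D2 l q ?w * D j (dev q)) +
      (\<Sum>p\<in>gens. \<Sum>q\<in>gens. D' l (dev p) * D2 p q ?w * D j (dev q))" (is "0 = ?A + ?B + ?C")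
    unfolding sum_perturbed_bilinear[OF finite_gens l j] by (simp add: add.assoc)
  have C: "fps_X ^ (K + 2) dvd ?C"
  proof (intro dvd_sum)
    fix p q assume pq: "p \<in> gens" "q \<in> gens"
    have "fps_X ^ (K + 2) dvd D' l (dev p) * (D2 p q ?w * D j (dev q))"
      by (rule fps_X_dvd_mult[OF lcs_fox(3)[OF dev_lcs[OF pq(1)]] dvd_mult[OF lcs_fox(1)[OF dev_lcs[OF pq(2)]]]])
         (use K in simp)
    then show "fps_X ^ (K + 2) dvd D' l (dev p) * D2 p q ?w * D j (dev q)" by (simp add: mult.assoc)
  qed
  have A: "fps_X ^ (K + 2) dvd ?A - (\<Sum>p\<in>gens. D' l (dev p) * \<Omega>0 p j)"
    unfolding sum_subtractf[symmetric] right_diff_distrib[symmetric]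
    by (intro dvd_sum fps_X_dvd_mult[OF lcs_fox(3)[OF dev_lcs] fox2_inv_zeta(2)]) simp_all
  have B: "fps_X ^ (K + 2) dvd ?B - (\<Sum>q\<in>gens. \<Omega>0 l q * D j (dev q))"
    unfolding sum_subtractf[symmetric] left_diff_distrib[symmetric]
    by (intro dvd_sum fps_X_dvd_mult[OF fox2_inv_zeta(2) lcs_fox(1)[OF dev_lcs]]) simp_all
  have "fps_X ^ (K + 2) dvd (?A - (\<Sum>p\<in>gens. D' l (dev p) * \<Omega>0 p j)) +
      (?B - (\<Sum>q\<in>gens. \<Omega>0 l q * D j (dev q))) + ?C"
    by (rule dvd_add[OF dvd_add[OF A B] C])
  also have "\<dots> = 0 - ((\<Sum>p\<in>gens. D' l (dev p) * \<Omega>0 p j) + (\<Sum>q\<in>gens. \<Omega>0 l q * D j (dev q)))"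
    unfolding zero by (simp only: algebra_simps)
  finally show ?thesis by (simp only: diff_0 dvd_minus_iff)
qed

text \<open>The entry of the relation at \<open>Alpha i\<close> and \<open>Beta i\<close>. The depth
  of \<open>dev (Alpha i)\<close> and the factor 1 - c in front of the mixed term supply the extra
  order needed to replace derivatives for the inverted character by ordinary ones.\<close>

lemma diagonal_relation:
  assumes i: "i \<in> {1..g}" and dev: "dev (Alpha i) \<in> lcs P (K + 2)"
  shows "fps_X ^ (K + 2) dvd D (Alpha i) (dev (Alpha i)) + D (Beta i) (dev (Beta i)) -
    (c (Alpha i) - 1) * D (Alpha i) (dev (Beta i))"
proof -
  let ?s = "c (Alpha i)" and ?a = "Alpha i" and ?b = "Beta i"
  have mem: "?a \<in> gens" "?b \<in> gens" using i by simp_all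
  have if_mult: "x * (if B then u else 0) = (if B then x * u else 0)" "(if B then u else 0) * x = (if B then u * x else 0)"
    for B and x u :: "'k fps" by simp_all
  have "(\<Sum>p\<in>gens. D' ?a (dev p) * \<Omega>0 p ?b) =
      (\<Sum>p\<in>gens. if p = ?a then D' ?a (dev p) * ?s else 0) + (\<Sum>p\<in>gens. if p = ?b then D' ?a (dev p) * (1 - ?s) else 0)"
    unfolding sum.distrib[symmetric] by (intro sum.cong) (auto simp: \<Omega>0_simps[OF i])
  then have A: "(\<Sum>p\<in>gens. D' ?a (dev p) * \<Omega>0 p ?b) = D' ?a (dev ?a) * ?s + D' ?a (dev ?b) * (1 - ?s)"
    using finite_gens mem by simp
  have "(\<Sum>q\<in>gens. \<Omega>0 ?a q * D ?b (dev q)) = (\<Sum>q\<in>gens. if q = ?b then ?s * D ?b (dev q) else 0)"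
    by (intro sum.cong) (auto simp: \<Omega>0_simps[OF i])
  then have B: "(\<Sum>q\<in>gens. \<Omega>0 ?a q * D ?b (dev q)) = ?s * D ?b (dev ?b)"
    using finite_gens mem by simp
  have 1: "fps_X ^ (K + 2) dvd D' ?a (dev ?a) * ?s + D' ?a (dev ?b) * (1 - ?s) + ?s * D ?b (dev ?b)"
    using pushforward_relation[OF mem] unfolding A B .
  have 2: "fps_X ^ (K + 2) dvd D' ?a (dev ?a) - D ?a (dev ?a)"
    using lcs_fox(2)[of "dev ?a" "Suc K" ?a] dev by simp
  have s: "fps_X ^ 1 dvd ?s - 1" using near_one by simp
  have 3: "fps_X ^ (K + 2) dvd (?s - 1) * (D' ?a (dev ?b) - D ?a (dev ?b))"
    by (rule fps_X_dvd_mult[OF s lcs_fox(2)[OF dev_lcs[OF mem(2)]]]) simp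
  let ?R = "D ?a (dev ?a) + D ?b (dev ?b)"
  have "fps_X ^ (K + 2) dvd (D' ?a (dev ?a) * ?s + D' ?a (dev ?b) * (1 - ?s) + ?s * D ?b (dev ?b))
      - ?s * (D' ?a (dev ?a) - D ?a (dev ?a)) + (?s - 1) * (D' ?a (dev ?b) - D ?a (dev ?b))"
    by (rule dvd_add[OF dvd_diff[OF 1 dvd_mult[OF 2]] 3])
  also have "\<dots> = ?s * ?R - (?s - 1) * D ?a (dev ?b)" by (simp add: algebra_simps)
  finally have 4: "fps_X ^ (K + 2) dvd ?s * ?R - (?s - 1) * D ?a (dev ?b)" .
  \<comment> \<open>Vanishing of ?R to order K+1 is extracted first; then its coefficient ?s can be
    replaced by 1, since ?s - 1 brings one more power of X.\<close>
  have 5: "fps_X ^ Suc K dvd (?s - 1) * D ?a (dev ?b)"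
    by (rule fps_X_dvd_mult[OF s lcs_fox(1)[OF dev_lcs[OF mem(2)]]]) simp
  have "fps_X ^ Suc K dvd (?s * ?R - (?s - 1) * D ?a (dev ?b)) + (?s - 1) * D ?a (dev ?b)"
    by (intro dvd_add 5 fps_X_dvd_le[OF 4]) simp
  then have "fps_X ^ Suc K dvd ?s * ?R" by (simp only: diff_add_cancel)
  then have "fps_X ^ Suc K dvd c' ?a * (?s * ?R)" by (rule dvd_mult)
  then have "fps_X ^ Suc K dvd ?R" by (simp only: cancel)
  then have "fps_X ^ (K + 2) dvd (?s - 1) * ?R" by (rule fps_X_dvd_mult[OF s]) simp
  with 4 have "fps_X ^ (K + 2) dvd (?s * ?R - (?s - 1) * D ?a (dev ?b)) - (?s - 1) * ?R"
    by (rule dvd_diff)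
  then show ?thesis by (simp add: algebra_simps)
qed

end


section \<open>Fox derivatives of the strand words and the trace\<close>

context surface_fox
begin

lemma fox_inv:
  assumes u: "u \<in> carrier P"
  shows "\<chi> (inv\<^bsub>P\<^esub> u) = \<chi>' u" "\<chi>' (inv\<^bsub>P\<^esub> u) = \<chi> u" "D j (inv\<^bsub>P\<^esub> u) = - (\<chi>' u * D j u)"
  using free_char[of u gens] fox_calculus.free_char(1)[OF fox_calculus_swap, of u gens] u
  by (simp_all add: P_gens)

lemma fox_mult_P:
  assumes u: "u \<in> carrier P" and v: "v \<in> carrier P"
  shows "\<chi> (u \<otimes>\<^bsub>P\<^esub> v) = \<chi> u * \<chi> v" "\<chi>' (u \<otimes>\<^bsub>P\<^esub> v) = \<chi>' u * \<chi>' v"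
    "D j (u \<otimes>\<^bsub>P\<^esub> v) = D j u + \<chi> u * D j v"
    "\<chi> (comm u v) = 1" "D j (comm u v) = (1 - \<chi> v) * D j u + (\<chi> u - 1) * D j v"
  using free_comm[of u gens v] u v
  by (simp_all add: P_gens char_mult fox_mult)

lemmas fox_P = fox_inv fox_mult_P

text \<open>A Johnson image is known only as a class in the graded Lie ring; this allows any word
  representing the class to be used in the trace.\<close>

lemma fox_cls_cong:
  assumes "cls (Suc m) u = cls (Suc m) v" "u \<in> carrier P" "v \<in> carrier P"
  shows "fps_X ^ Suc m dvd D j u - D j v"
proof -
  have n: "u \<otimes>\<^bsub>P\<^esub> inv\<^bsub>P\<^esub> v \<in> lcs P (Suc (Suc m))" using assms cls_eq_iff by blast
  have "D j u = D j ((u \<otimes>\<^bsub>P\<^esub> inv\<^bsub>P\<^esub> v) \<otimes>\<^bsub>P\<^esub> v)" using assms by (simp add: m_assoc)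
  also have "\<dots> = D j (u \<otimes>\<^bsub>P\<^esub> inv\<^bsub>P\<^esub> v) + D j v"
    using assms lcs_fox(4)[OF n] by (subst fox_mult_P(3)) simp_all
  finally show ?thesis using lcs_fox(1)[OF n, of j] by simp
qed

lemma letter_word [simp]:
  "\<chi> a1 = c (Alpha 1)" "\<chi> a2 = c (Alpha 2)" "\<chi> b1 = 1" "\<chi> b2 = 1"
  "\<chi>' a1 = c' (Alpha 1)" "\<chi>' a2 = c' (Alpha 2)" "\<chi>' b1 = 1" "\<chi>' b2 = 1"
  "D j a1 = of_bool (j = Alpha 1)" "D j a2 = of_bool (j = Alpha 2)"
  "D (Alpha i) b1 = 0" "D (Alpha i) b2 = 0"
  by (simp_all add: a1_def a2_def b1_def b2_def alpha_def beta_def c_beta c'_beta fox_letter_def)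

lemma strand_word:
  "\<chi> q2 = c (Alpha 2)" "\<chi>' q2 = c' (Alpha 2)" "\<chi> q3 = c' (Alpha 2)" "\<chi>' q3 = c (Alpha 2)"
  "\<chi> mm = c' (Alpha 1) * c (Alpha 2)" "\<chi>' mm = c (Alpha 1) * c' (Alpha 2)"
  "D (Alpha i) q2 = of_bool (i = 2)" "D (Alpha i) q3 = - (c' (Alpha 2) * of_bool (i = 2))"
  "D (Alpha i) mm = c' (Alpha 1) * (of_bool (i = 2) - of_bool (i = 1))"
  by (simp_all add: q1_def q2_def q3_def mm_def fox_P algebra_simps)

lemma XY_closed [simp]: "X n \<in> carrier P" "Y n \<in> carrier P"
  using X_lcs Y_lcs by simp_all

lemma char_XY: "n > 0 \<Longrightarrow> \<chi> (X n) = 1" "n > 0 \<Longrightarrow> \<chi> (Y n) = 1" "n > 0 \<Longrightarrow> \<chi>' (X n) = 1" "n > 0 \<Longrightarrow> \<chi>' (Y n) = 1"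
  using lcs_fox(4,5)[OF X_lcs] lcs_fox(4,5)[OF Y_lcs] by blast+

text \<open>The character of \<open>mm\<close>, respectively of its inverse, minus 1: the factor by
  which a further commutator step multiplies the Fox derivatives of \<open>X\<close>, respectively
  \<open>Y\<close>.\<close>

abbreviation "\<epsilon> \<equiv> c' (Alpha 1) * c (Alpha 2) - 1"
abbreviation "\<eta> \<equiv> c (Alpha 1) * c' (Alpha 2) - 1"

lemma fox_X: "D j (X (Suc n)) = \<epsilon> ^ n * D j (X 1)"
proof (induction n)
  case (Suc n)
  have "D j (X (Suc (Suc n))) = (1 - \<chi> mm) * (- D j (X (Suc n)))"
    by (subst X_eq) (simp add: fox_P char_XY del: X.simps)
  then show ?case using Suc by (simp add: strand_word algebra_simps del: X.simps)
qed simp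

lemma fox_Y: "D j (Y (Suc n)) = \<eta> ^ n * D j (Y 1)"
proof (induction n)
  case (Suc n)
  have "D j (Y (Suc (Suc n))) = (1 - \<chi>' mm) * (- D j (Y (Suc n)))"
    by (subst Y_eq) (simp add: fox_P char_XY del: Y.simps)
  then show ?case using Suc by (simp add: strand_word algebra_simps del: Y.simps)
qed simp

lemma fox_X1: "D (Alpha 2) (X 1) = (c' (Alpha 1) - 1) * c' (Alpha 2)"
proof -
  have "X 1 = comm (inv\<^bsub>P\<^esub> (X 0)) mm" using X_eq[of 0] by simp
  then have "D (Alpha 2) (X 1) = (1 - \<chi> mm) * (- \<chi>' q2) + (\<chi>' q2 - 1) * D (Alpha 2) mm"
    by (simp add: fox_P strand_word del: X.simps(2))
  then show ?thesis by (simp add: strand_word algebra_simps cancel char_inverse char_inverse')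
qed

lemma fox_Y1:
  "D (Alpha 1) (Y 1) = (c (Alpha 2) - 1) * c' (Alpha 2)"
  "D (Alpha 2) (Y 1) = (1 - c (Alpha 1)) * c' (Alpha 2)"
proof -
  have "Y 1 = comm (inv\<^bsub>P\<^esub> (Y 0)) (inv\<^bsub>P\<^esub> mm)" using Y_eq[of 0] by simp
  then have *: "D j (Y 1) = (1 - \<chi>' mm) * (- (\<chi>' q3 * D j q3)) + (\<chi>' q3 - 1) * (- (\<chi>' mm * D j mm))" for j
    by (simp add: fox_P del: Y.simps(2))
  show "D (Alpha 1) (Y 1) = (c (Alpha 2) - 1) * c' (Alpha 2)"
    "D (Alpha 2) (Y 1) = (1 - c (Alpha 1)) * c' (Alpha 2)"
    unfolding * by (simp_all add: strand_word algebra_simps cancel char_inverse char_inverse')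
qed

lemma Lw_closed: "Lw n r \<in> carrier P"
  using Lw_in_Sset Sset_closed by blast

text \<open>Fox derivatives vanish on a commutator of two words with trivial character. Hence only
  the factor j = 0 contributes, through \<open>X 0\<close>; the other word with nontrivial
  character, \<open>Y 0\<close>, would occur at j = n - 1, beyond r < n.\<close>

lemma fox_Lw:
  "0 < r \<Longrightarrow> r < n \<Longrightarrow> D (Alpha i) (Lw n r) =
    (c (Alpha 2) - 1) * D (Alpha i) (Y (n - 1)) + (1 - \<chi> (Y (n - 1))) * D (Alpha i) q2 \<and> \<chi> (Lw n r) = 1"
proof (induction r)
  case (Suc r)
  show ?case
  proof (cases "r = 0")
    case True
    then show ?thesis
      using Suc.prems by (simp add: fox_P strand_word)
  next
    case False
    then have "D (Alpha i) (comm (X r) (Y (n - Suc r))) = 0"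
      using Suc.prems by (simp add: fox_P char_XY)
    then show ?thesis using Suc False by (simp add: fox_P Lw_closed)
  qed
qed simp

text \<open>The two contributions of \<open>Lw\<close> cancel in characteristic 2.\<close>

lemma trace_term:
  assumes k: "k \<ge> 1"
  shows "(c (Alpha 1) - 1) * D (Alpha 1) (Lw (2 * k) k) +
      (c (Alpha 2) - 1) * (D (Alpha 2) (X (2 * k)) - D (Alpha 2) (Lw (2 * k) k)) =
    (c (Alpha 2) - 1) * (\<epsilon> ^ (2 * k - 1) * ((c' (Alpha 1) - 1) * c' (Alpha 2)))"
proof -
  obtain m where m: "2 * k - 1 = Suc m" using k by (cases k) auto
  have 2: "2 * k = Suc (2 * k - 1)" using k by simp
  have L: "D (Alpha i) (Lw (2 * k) k) = (c (Alpha 2) - 1) * D (Alpha i) (Y (Suc m))" for i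
    using fox_Lw[of k "2 * k" i] k by (simp add: char_XY m[simplified] del: Y.simps)
  have X: "D (Alpha 2) (X (2 * k)) = \<epsilon> ^ (2 * k - 1) * ((c' (Alpha 1) - 1) * c' (Alpha 2))"
    by (subst 2) (simp only: fox_X fox_X1)
  have "(c (Alpha 1) - 1) * D (Alpha 1) (Lw (2 * k) k) - (c (Alpha 2) - 1) * D (Alpha 2) (Lw (2 * k) k) =
      (c (Alpha 2) - 1) * \<eta> ^ m * ((c (Alpha 1) - 1) * (c (Alpha 2) - 1) * c' (Alpha 2) +
      (c (Alpha 1) - 1) * (c (Alpha 2) - 1) * c' (Alpha 2))"
    unfolding L fox_Y[of _ m] fox_Y1 by (simp add: algebra_simps)
  then have "(c (Alpha 1) - 1) * D (Alpha 1) (Lw (2 * k) k) - (c (Alpha 2) - 1) * D (Alpha 2) (Lw (2 * k) k) = 0"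
    by (simp only: fps_char2 mult_zero_right)
  then show ?thesis unfolding X by (simp add: algebra_simps)
qed

end


text \<open>In the sum of \<open>diagonal_relation\<close> over all handles, the mixed terms survive
  only for handles 1 and 2, the character being 1 on the other \<open>Alpha i\<close>. There the
  deviations are replaced by words with the same leading terms.\<close>

lemma (in near_identity) trace_dev:
  assumes k: "k \<ge> 1" "K = 2 * k" and \<alpha>: "\<And>i. i \<in> {1..g} \<Longrightarrow> dev (Alpha i) \<in> lcs P (K + 2)"
    and \<beta>1: "cls (Suc K) (dev (Beta 1)) = cls (Suc K) (Lw K k)"
    and \<beta>2: "cls (Suc K) (dev (Beta 2)) = cls (Suc K) (X K \<otimes>\<^bsub>P\<^esub> inv\<^bsub>P\<^esub> (Lw K k))"
  shows "fps_X ^ (K + 2) dvd (\<Sum>a\<in>gens. D a (dev a)) -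
    (c (Alpha 2) - 1) * (\<epsilon> ^ (K - 1) * ((c' (Alpha 1) - 1) * c' (Alpha 2)))"
proof -
  have "(\<Sum>a\<in>gens. D a (dev a)) =
      (\<Sum>a\<in>Alpha ` {1..g}. D a (dev a)) + (\<Sum>a\<in>Beta ` {1..g}. D a (dev a))"
    unfolding gens_def by (rule sum.union_disjoint) auto
  also have "\<dots> = (\<Sum>i\<in>{1..g}. D (Alpha i) (dev (Alpha i)) + D (Beta i) (dev (Beta i)))"
    by (simp add: sum.reindex inj_on_def sum.distrib)
  finally have tr: "(\<Sum>a\<in>gens. D a (dev a)) =
      (\<Sum>i\<in>{1..g}. D (Alpha i) (dev (Alpha i)) + D (Beta i) (dev (Beta i)))" .
  have 12: "1 \<in> {1..g}" "2 \<in> {1..g}" using g by simp_all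
  have "(\<Sum>i\<in>{1..g}. (c (Alpha i) - 1) * D (Alpha i) (dev (Beta i))) =
      (\<Sum>i\<in>{1, 2}. (c (Alpha i) - 1) * D (Alpha i) (dev (Beta i)))"
    using 12 c_alpha by (intro sum.mono_neutral_right) auto
  also have "\<dots> = (c (Alpha 1) - 1) * D (Alpha 1) (dev (Beta 1)) + (c (Alpha 2) - 1) * D (Alpha 2) (dev (Beta 2))"
    by simp
  finally have s12: "(\<Sum>i\<in>{1..g}. (c (Alpha i) - 1) * D (Alpha i) (dev (Beta i))) = \<dots>" .
  have d1: "fps_X ^ (K + 2) dvd (\<Sum>a\<in>gens. D a (dev a)) - ((c (Alpha 1) - 1) * D (Alpha 1) (dev (Beta 1)) +
      (c (Alpha 2) - 1) * D (Alpha 2) (dev (Beta 2)))"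
    unfolding tr s12[symmetric] sum_subtractf[symmetric]
    by (intro dvd_sum diagonal_relation \<alpha>)
  have n: "fps_X ^ 1 dvd c a - 1" for a using near_one by simp
  have mem: "Beta 1 \<in> gens" "Beta 2 \<in> gens" using 12 gens_mem by blast+
  have closed: "dev (Beta 1) \<in> carrier P" "dev (Beta 2) \<in> carrier P"
    using dev_lcs[OF mem(1)] dev_lcs[OF mem(2)] by simp_all
  have d2: "fps_X ^ (K + 2) dvd (c (Alpha 1) - 1) * (D (Alpha 1) (dev (Beta 1)) - D (Alpha 1) (Lw K k))"
    by (rule fps_X_dvd_mult[OF n fox_cls_cong[OF \<beta>1]]) (use closed in \<open>simp_all add: Lw_closed\<close>)
  have "D (Alpha 2) (X K \<otimes>\<^bsub>P\<^esub> inv\<^bsub>P\<^esub> (Lw K k)) = D (Alpha 2) (X K) - D (Alpha 2) (Lw K k)"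
    using lcs_fox(5)[OF Lw_lcs[of k K]] char_XY(1)[of K] k by (simp add: fox_P Lw_closed)
  moreover have "fps_X ^ (K + 2) dvd (c (Alpha 2) - 1) * (D (Alpha 2) (dev (Beta 2)) -
      D (Alpha 2) (X K \<otimes>\<^bsub>P\<^esub> inv\<^bsub>P\<^esub> (Lw K k)))"
    by (rule fps_X_dvd_mult[OF n fox_cls_cong[OF \<beta>2]]) (use closed in \<open>simp_all add: Lw_closed\<close>)
  ultimately have d3: "fps_X ^ (K + 2) dvd (c (Alpha 2) - 1) * (D (Alpha 2) (dev (Beta 2)) -
      (D (Alpha 2) (X K) - D (Alpha 2) (Lw K k)))" by simp
  show ?thesis
    using dvd_add[OF dvd_add[OF d1 d2] d3]
    unfolding trace_term[OF k(1), folded k(2), symmetric] by (simp only: algebra_simps) (simp add: algebra_simps)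
qed

section \<open>The Jacobian matrix of Fox derivatives\<close>

context surface_fox
begin

definition gen_at :: "nat \<Rightarrow> surface_gen" where
  "gen_at m = (if even m then Alpha (m div 2 + 1) else Beta (m div 2 + 1))"

lemma gen_at_bij: "bij_betw gen_at {..<2 * g} gens"
proof (rule bij_betw_byWitness)
  let ?h = "\<lambda>a. case a of Alpha i \<Rightarrow> 2 * (i - 1) | Beta i \<Rightarrow> 2 * (i - 1) + 1"
  show "\<forall>m\<in>{..<2 * g}. ?h (gen_at m) = m"
    by (auto simp: gen_at_def elim!: oddE)
  show "\<forall>a\<in>gens. gen_at (?h a) = a" by (auto simp: gens_def gen_at_def)
  show "gen_at ` {..<2 * g} \<subseteq> gens"
    by (auto simp: gens_def gen_at_def image_iff elim!: evenE oddE)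
  show "?h ` gens \<subseteq> {..<2 * g}" by (auto simp: gens_def)
qed

lemma gen_at_gens [simp]: "m < 2 * g \<Longrightarrow> gen_at m \<in> gens"
  using gen_at_bij by (auto dest: bij_betwE)

lemma gen_at_eq_iff: "m < 2 * g \<Longrightarrow> n < 2 * g \<Longrightarrow> gen_at m = gen_at n \<longleftrightarrow> m = n"
  using gen_at_bij by (auto simp: bij_betw_def inj_on_eq_iff)

definition jacobian where
  "jacobian f = mat (2 * g) (2 * g) (\<lambda>(p, q). D (gen_at q) (f [(gen_at p, False)]))"

lemma jacobian_carrier [simp]: "jacobian f \<in> carrier_mat (2 * g) (2 * g)"
  by (simp add: jacobian_def)

text \<open>Because \<open>f\<close> preserves the character, the chain rule turns the composite of
  f after f' into the matrix product in reversed order.\<close>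

lemma jacobian_inverse:
  assumes f: "f \<in> hom P P" and fc: "\<And>a. a \<in> gens \<Longrightarrow> \<chi> (f [(a, False)]) = c a"
    and f': "f' \<in> hom P P" "\<And>x. x \<in> carrier P \<Longrightarrow> f (f' x) = x"
  shows "det (jacobian f') * det (jacobian f) = 1"
proof -
  have "jacobian f' * jacobian f = 1\<^sub>m (2 * g)"
  proof (rule eq_matI)
    fix p q assume pq: "p < dim_row (1\<^sub>m (2 * g) :: 'k fps mat)" "q < dim_col (1\<^sub>m (2 * g) :: 'k fps mat)"
    then have p: "[(gen_at p, False)] \<in> carrier P" by (simp add: letter_closed)
    then have fp: "f' [(gen_at p, False)] \<in> carrier P" using f'(1) by (auto simp: hom_def)
    have "of_bool (p = q) = D (gen_at q) [(gen_at p, False)]"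
      using pq by (simp add: fox_letter_def gen_at_eq_iff)
    also have "\<dots> = D (gen_at q) (f (f' [(gen_at p, False)]))"
      using f'(2)[OF p] by simp
    also have "\<dots> = (\<Sum>i\<in>gens. D i (f' [(gen_at p, False)]) * D (gen_at q) (f [(i, False)]))"
      using chain_rule(2)[OF finite_gens, of f "f' [(gen_at p, False)]" "gen_at q"] f fc fp by (simp add: P_gens)
    also have "\<dots> = (\<Sum>m<2 * g. D (gen_at m) (f' [(gen_at p, False)]) * D (gen_at q) (f [(gen_at m, False)]))"
      by (rule sum.reindex_bij_betw[OF gen_at_bij, symmetric])
    also have "\<dots> = (jacobian f' * jacobian f) $$ (p, q)"
      using pq by (simp add: jacobian_def scalar_prod_def atLeast0LessThan)
    finally show "(jacobian f' * jacobian f) $$ (p, q) = 1\<^sub>m (2 * g) $$ (p, q)"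
      using pq by (cases "p = q") simp_all
  qed (simp_all add: jacobian_def)
  then show ?thesis
    using det_mult[OF jacobian_carrier jacobian_carrier, of f' f] by simp
qed

end

lemma (in near_identity) det_jacobian:
  "fps_X ^ (K + 2) dvd det (jacobian f) - 1 - (\<Sum>a\<in>gens. D a (dev a))"
proof -
  let ?N = "mat (2 * g) (2 * g) (\<lambda>(p, q). D (gen_at q) (dev (gen_at p)))"
  have J: "jacobian f = 1\<^sub>m (2 * g) + ?N"
    by (rule eq_matI) (auto simp: jacobian_def f_letter gen_at_eq_iff)
  have "(\<Sum>i<2 * g. ?N $$ (i, i)) = (\<Sum>m<2 * g. D (gen_at m) (dev (gen_at m)))"
    by simp
  also have "\<dots> = (\<Sum>a\<in>gens. D a (dev a))" by (rule sum.reindex_bij_betw[OF gen_at_bij])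
  finally have tr: "(\<Sum>i<2 * g. ?N $$ (i, i)) = (\<Sum>a\<in>gens. D a (dev a))" .
  have "fps_X ^ K * fps_X ^ K dvd det (1\<^sub>m (2 * g) + ?N) - 1 - (\<Sum>i<2 * g. ?N $$ (i, i))"
  proof (rule det_one_plus)
    fix i j assume "i < 2 * g" "j < 2 * g"
    then show "fps_X ^ K dvd ?N $$ (i, j)" using lcs_fox(1)[OF dev_lcs[of "gen_at i"]] by simp
  qed simp
  \<comment> \<open>The error of \<open>det_one_plus\<close> has order 2K, and 2K is at least
    K+2.\<close>
  moreover have "fps_X ^ (K + 2) dvd (fps_X ^ K * fps_X ^ K :: 'k fps)"
    using K by (intro fps_X_dvd_mult[of K _ K]) simp_all
  ultimately show ?thesis unfolding J tr by (rule dvd_trans[rotated])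
qed


section \<open>Specialization to a field of characteristic 2 and the contradiction\<close>

locale surface_units = surface2 g + U: two_units b
  for g and b :: "'k::field"
begin

definition "chr a = (if a = Alpha 1 then U.s else if a = Alpha 2 then U.t else 1)"
definition "chr' a = inverse (chr a)"

sublocale surface_fox g chr chr'
proof
  fix a i
  show "chr a * chr' a = 1" unfolding chr'_def by (rule inverse_mult_eq_1') (simp add: chr_def)
  show "fps_X dvd chr a - 1" by (simp add: chr_def)
  show "(1 :: 'k) + 1 = 0" by (rule U.char2)
qed (simp_all add: chr_def)

lemma chr_laurent: "chr a \<in> U.laurent" "chr' a \<in> U.laurent"
  by (auto simp: chr_def chr'_def U.laurent_units U.laurent_01)

lemma fox_laurent: "D j w \<in> U.laurent"
proof (induction w)
  case (Cons l w)
  have "fox_letter chr' j l \<in> U.laurent"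
    using U.laurent_01 U.laurent_minus chr_laurent by (simp add: fox_letter_def)
  then show ?case using Cons by (auto intro!: U.laurent_add U.laurent_mult chr_laurent)
qed (simp add: U.laurent_01)

text \<open>The factors are b X, the power of (b - 1) X s^-1 with exponent 2k-1, and -X s^-1 t^-1.
  So X^(1 + (2k-1) + 1) splits off, and the rest has constant term -b (b - 1)^(2k-1).\<close>

lemma trace_coeff:
  assumes k: "k \<ge> 1"
  defines "E \<equiv> (chr (Alpha 2) - 1) * (\<epsilon> ^ (2 * k - 1) * ((chr' (Alpha 1) - 1) * chr' (Alpha 2)))"
  shows "fps_nth E (2 * k + 1) \<noteq> 0" "i < 2 * k + 1 \<Longrightarrow> fps_nth E i = 0"
proof -
  let ?s' = "chr' (Alpha 1)" and ?t' = "chr' (Alpha 2)"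
  have s: "U.s * ?s' = 1" using char_inverse[of "Alpha 1"] by (simp add: chr_def)
  have 1: "?s' - 1 = fps_X * (- ?s')"
  proof -
    have "?s' - 1 = ?s' - U.s * ?s'" unfolding s ..
    then show ?thesis by (simp add: algebra_simps)
  qed
  have 2: "\<epsilon> = fps_X * (fps_const (b - 1) * ?s')"
  proof -
    have "\<epsilon> = ?s' * U.t - U.s * ?s'" unfolding s by (simp add: chr_def)
    also have "\<dots> = fps_X * ((fps_const b - 1) * ?s')" by (simp add: algebra_simps)
    also have "fps_const b - 1 = fps_const (b - 1)" by (simp flip: fps_const_1_eq_1)
    finally show ?thesis .
  qed
  have 3: "chr (Alpha 2) - 1 = fps_X * fps_const b" by (simp add: chr_def)
  let ?R = "fps_const b * ((fps_const (b - 1) * ?s') ^ (2 * k - 1) * (- ?s' * ?t'))"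
  obtain m where "2 * k = Suc m" using k by (cases "2 * k") auto
  then have m: "2 * k - 1 = m" "2 * k + 1 = Suc (Suc m)" by simp_all
  have E: "E = fps_X ^ (2 * k + 1) * ?R"
    unfolding E_def 1 2 3 m by (simp add: power_mult_distrib algebra_simps)
  have nth0: "fps_nth ?s' 0 = 1" "fps_nth ?t' 0 = 1" by (simp_all add: chr'_def chr_def)
  have "fps_nth ?R 0 = - (b * (b - 1) ^ (2 * k - 1))"
    by (simp add: nth0[simplified] fps_power_zeroth)
  then have "fps_nth ?R 0 \<noteq> 0" using U.b0 U.b1 by simp
  then show "fps_nth E (2 * k + 1) \<noteq> 0"
    unfolding E by (simp only: fps_X_power_mult_nth less_irrefl if_False diff_self_eq_0 not_False_eq_True)
  show "fps_nth E i = 0" if "i < 2 * k + 1"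
    unfolding E using that by (simp only: fps_X_power_mult_nth if_True)
qed

lemma not_johnson_image:
  assumes k: "k \<ge> 1" and \<phi>: "\<And>x. x \<in> carrier P \<Longrightarrow> d (hgen x) = \<phi> x"
    and b12: "\<phi> b1 = z k" "\<phi> b2 = y (2 * k) \<otimes>\<^bsub>FL.L\<^esub> inv\<^bsub>FL.L\<^esub> (z k)"
    and \<alpha>: "\<And>i. i \<in> {1..g} \<Longrightarrow> \<phi> (alpha i) = \<one>\<^bsub>FL.L\<^esub>"
  shows "d \<notin> johnson_image g (2 * k)"
proof
  assume "d \<in> johnson_image g (2 * k)"
  then obtain f where f: "f \<in> johnson_filtration g (2 * k)" "is_johnson_image g (2 * k) f d"
    unfolding johnson_image_def by blast
  have fm: "f \<in> mapping_class_group g" using f(1) johnson_filtration_iff by blast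
  then have fh: "f \<in> hom P P" "f (zeta g) = zeta g" using mapping_class_group_iff by auto
  interpret N: near_identity g chr chr' f "2 * k"
  proof
    fix x assume x: "x \<in> carrier P"
    then have "lcs P (Suc (2 * k)) #>\<^bsub>P\<^esub> f x = lcs P (Suc (2 * k)) #>\<^bsub>P\<^esub> x"
      using f(1) johnson_filtration_iff by blast
    then show "f x \<otimes>\<^bsub>P\<^esub> inv\<^bsub>P\<^esub> x \<in> lcs P (Suc (2 * k))"
      using x cls_eq_iff[of "f x" x] fm by simp
  qed (use fh k in auto)
  let ?n = "Suc (2 * k)"
  have img: "lcs_iso P (\<phi> x) ?n = cls ?n (f x \<otimes>\<^bsub>P\<^esub> inv\<^bsub>P\<^esub> x)" if "x \<in> carrier P" for x
    using is_johnson_imageD[OF f(2) that] \<phi>[OF that] by simp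
  have dev: "N.dev (Alpha i) = f (alpha i) \<otimes>\<^bsub>P\<^esub> inv\<^bsub>P\<^esub> (alpha i)"
    "N.dev (Beta i) = f (beta i) \<otimes>\<^bsub>P\<^esub> inv\<^bsub>P\<^esub> (beta i)" for i
    by (simp_all add: N.dev_def alpha_def beta_def)
  \<comment> \<open>Fox derivatives apply to words, not to Lie elements: the half product
    \<open>Lw (2 * k) k\<close> is a word with leading term z.\<close>
  have Lw: "gr ?n (Lw (2 * k) k) = lcs_iso P (z k)"
    unfolding z_def by (rule gr_Lw) simp
  have "cls ?n (f b1 \<otimes>\<^bsub>P\<^esub> inv\<^bsub>P\<^esub> b1) = cls ?n (Lw (2 * k) k)"
    using img[OF gens12(2)] by (simp only: b12 Lw[symmetric] gr_apply)
  then have "cls ?n (N.dev (Beta 1)) = cls ?n (Lw (2 * k) k)" unfolding dev b1_def .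
  moreover have "cls ?n (N.dev (Beta 2)) = cls ?n (X (2 * k) \<otimes>\<^bsub>P\<^esub> inv\<^bsub>P\<^esub> (Lw (2 * k) k))"
  proof -
    have L: "Lw (2 * k) k \<in> lcs P ?n" by (rule Lw_lcs) simp
    have "lcs_iso P (\<phi> b2) = gr ?n (X (2 * k)) \<otimes>\<^bsub>S\<^esub> inv\<^bsub>S\<^esub> (gr ?n (Lw (2 * k) k))"
      unfolding b12 Lw gr_X by (simp add: lcs_iso_mult lcs_iso_inv)
    also have "\<dots> = gr ?n (X (2 * k) \<otimes>\<^bsub>P\<^esub> inv\<^bsub>P\<^esub> (Lw (2 * k) k))"
      using gr_inv[OF L] gr_mult[OF X_lcs lcs_intros(3)[OF L]] by simp
    finally show ?thesis
      using img[OF gens12(4)] gr_apply[of "2 * k"] unfolding dev b2_def by simp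
  qed
  moreover have "N.dev (Alpha i) \<in> lcs P (2 * k + 2)" if i: "i \<in> {1..g}" for i
  proof -
    have "cls ?n (N.dev (Alpha i)) = lcs P (Suc ?n)"
      using img[of "alpha i"] i \<alpha>[OF i] unfolding dev by (simp add: lcs_iso_one lcs_graded_one)
    moreover have "N.dev (Alpha i) \<in> carrier P" using N.dev_lcs[of "Alpha i"] i by simp
    ultimately show ?thesis using cls_self[of "N.dev (Alpha i)" "Suc ?n"] by simp
  qed
  ultimately have tr: "fps_X ^ (2 * k + 2) dvd (\<Sum>a\<in>gens. D a (N.dev a)) -
      (chr (Alpha 2) - 1) * (\<epsilon> ^ (2 * k - 1) * ((chr' (Alpha 1) - 1) * chr' (Alpha 2)))"
    (is "_ dvd _ - ?E") by (intro N.trace_dev[OF k]) simp_all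
  obtain f' where f': "f' \<in> mapping_class_group g" "\<And>x. x \<in> carrier P \<Longrightarrow> f (f' x) = x"
    using mcg_inverse[OF fm] by blast
  then have "f' \<in> hom P P" using mapping_class_group_iff by blast
  then have inv: "det (jacobian f) * det (jacobian f') = 1"
    using jacobian_inverse[OF fh(1) N.f_letter(1) _ f'(2)] by (simp add: mult.commute)
  have laurent: "det (jacobian h) \<in> U.laurent" for h
    by (rule U.laurent_det[OF jacobian_carrier]) (simp add: jacobian_def fox_laurent)
  have "fps_X ^ (2 * k + 2) dvd det (jacobian f) - (1 + ?E)"
    using dvd_add[OF N.det_jacobian tr] by (simp add: algebra_simps)
  then have nth: "fps_nth (det (jacobian f)) i = fps_nth (1 + ?E) i" if "i < 2 * k + 2" for i
    using that unfolding fps_X_power_dvd_iff by simp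
  have "fps_nth (det (jacobian f)) (2 * k + 1) = 0"
  proof (rule U.laurent_unit_coeff[OF laurent laurent inv k])
    fix i assume "1 \<le> i" "i \<le> 2 * k"
    then show "fps_nth (det (jacobian f)) i = 0" using nth[of i] trace_coeff(2)[OF k, of i] by simp
  qed
  then show False using nth[of "2 * k + 1"] trace_coeff(1)[OF k] by simp
qed

end

text \<open>The rational function field over the field with two elements, with its variable as b;
  the field with two elements alone contains no admissible b.\<close>

lemma two_units_fract: "two_units (Fract [:0, 1:] 1 :: bit poly fract)"
proof
  have "(1 :: bit poly) + 1 = 0" by (simp add: one_pCons)
  then have "Fract (1 :: bit poly) 1 + Fract 1 1 = Fract 0 1" by simp
  then show "(1 :: bit poly fract) + 1 = 0" by (simp add: One_fract_def Zero_fract_def)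
  show "(Fract [:0, 1:] 1 :: bit poly fract) \<noteq> 0" by (simp add: Zero_fract_def eq_fract)
  show "(Fract [:0, 1:] 1 :: bit poly fract) \<noteq> 1" by (simp add: One_fract_def eq_fract one_pCons)
qed

theorem theoremA:
  fixes g k :: nat
  assumes "k \<ge> 1" and "g \<ge> k + 2"
  shows "let Q = symplectic_derivations g (2 * k) Mod johnson_image g (2 * k)
         in \<exists>X\<in>carrier Q. X \<noteq> \<one>\<^bsub>Q\<^esub> \<and> X [^]\<^bsub>Q\<^esub> (2::nat) = \<one>\<^bsub>Q\<^esub>"
proof -
  interpret surface_units g "Fract [:0, 1:] 1 :: bit poly fract"
    using two_units_fract assms(2) by (simp add: surface_units_def surface2_def)
  obtain d \<phi> where d: "d \<in> carrier (SD (2 * k))" "\<phi> \<in> hom P FL.L"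
    "\<And>x. x \<in> carrier P \<Longrightarrow> d (hgen x) = \<phi> x"
    "\<phi> b1 = z k" "\<phi> b2 = y (2 * k) \<otimes>\<^bsub>FL.L\<^esub> inv\<^bsub>FL.L\<^esub> (z k)"
    "\<And>i. i \<in> {1..g} \<Longrightarrow> \<phi> (alpha i) = \<one>\<^bsub>FL.L\<^esub>" "\<And>i. i \<in> {3..g} \<Longrightarrow> \<phi> (beta i) = \<one>\<^bsub>FL.L\<^esub>"
    using derivation_exists[OF assms(1)] by metis
  have "d \<notin> johnson_image g (2 * k)"
    by (rule not_johnson_image[OF assms(1) d(3-6)])
  moreover have "d \<otimes>\<^bsub>SD (2 * k)\<^esub> d \<in> johnson_image g (2 * k)"
    by (rule double_in_johnson_image[OF assms(1) d])
  moreover have "subgroup (johnson_image g (2 * k)) (SD (2 * k))"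
    using assms(1) by (intro subgroup_johnson_image) simp
  ultimately show ?thesis
    unfolding Let_def using comm_group.two_torsion_FactGroup[OF comm_group_SD _ d(1)] by blast
qed

end
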